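(* For every $\varepsilon>0$ there is a constant $C(\varepsilon)$, depending only on $\varepsilon$, such that the following holds for all integers $n\ge 2$ and $d\ge 2$ with $nd$ even. Let $G$ be a random $d$-regular graph on $n$ vertices drawn from the configuration model, with adjacency matrix $A_G$. Then with probability at least $1-\varepsilon$, $$\max\{\lambda_2(A_G),\,-\lambda_n(A_G)\}\le C(\varepsilon)\sqrt{d-1}.$$
   Context: Configuration model: let $\mathcal{G}$ be a uniformly random perfect matching on the set $[n]\times[d]$, and let $G$ be the multigraph on $[n]$ obtained by adding an edge $ij$ for each edge of $\mathcal{G}$ between the clouds $\{i\}\times[d]$ and $\{j\}\times[d]$ (multi-edges and self-loops are allowed). $A_G$ is the adjacency matrix of the multigraph $G$: for $i\neq j$, $(A_G)_{ij}$ is the number of edges between $i$ and $j$, and each self-loop at $i$ contributes $2$ to $(A_G)_{ii}$, so that all row sums equal $d$. $\lambda_1(A_G)\ge\lambda_2(A_G)\ge\dots\ge\lambda_n(A_G)$ are the eigenvalues of $A_G$. *)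

theory Defs
  imports
    "HOL-Probability.Probability_Mass_Function"
    "HOL-Library.Disjoint_Sets"
    "Jordan_Normal_Form.Char_Poly"
begin

definition perfect_matchings :: "'a set \<Rightarrow> 'a set set set" where
  "perfect_matchings S = {M. partition_on S M \<and> (\<forall>e\<in>M. card e = 2)}"

lemma finite_perfect_matchings: "finite S \<Longrightarrow> finite (perfect_matchings S)"
  by (rule finite_subset[of _ "Pow (Pow S)"])
    (auto simp: perfect_matchings_def partition_on_def)

lemma perfect_matchings_nonempty:
  assumes "finite S" and "even (card S)"
  shows "perfect_matchings S \<noteq> {}"
  using assms
proof (induction "card S" arbitrary: S rule: less_induct)
  case less
  show ?case
  proof (cases "S = {}")
    case True
    then have "{} \<in> perfect_matchings S"
      by (auto simp: perfect_matchings_def partition_on_def)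
    then show ?thesis by blast
  next
    case False
    with less.prems have "card S \<ge> 2"
      by (metis card_gt_0_iff dvd_imp_le)
    then obtain T where T: "T \<subseteq> S" "card T = 2"
      by (metis obtain_subset_with_card_n)
    have "finite T" using T less.prems finite_subset by blast
    then have c: "card (S - T) = card S - 2"
      using T by (simp add: card_Diff_subset)
    then have "card (S - T) < card S" "even (card (S - T))"
      using \<open>card S \<ge> 2\<close> less.prems by auto
    then obtain M where M: "M \<in> perfect_matchings (S - T)"
      using less.hyps less.prems by blast
    have "T \<noteq> {}" using T by auto
    have "partition_on (T \<union> (S - T)) (insert T M)"
      using M \<open>T \<noteq> {}\<close>
      by (subst partition_on_insert) (auto simp: perfect_matchings_def disjnt_def partition_on_def)
    moreover have "T \<union> (S - T) = S" using T by blast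
    ultimately have "insert T M \<in> perfect_matchings S"
      using M T by (auto simp: perfect_matchings_def)
    then show ?thesis by blast
  qed
qed

text \<open>
  A multigraph on \<open>{..<n}\<close> is given by its multiset of edges, an edge being its set of
  endpoints: a proper edge is \<open>{i, j}\<close> with \<open>i \<noteq> j\<close>, and a self-loop at \<open>i\<close> is \<open>{i}\<close>.
  Accordingly, the matching edge \<open>{(i, a), (j, b)}\<close> yields its image \<open>{i, j}\<close> under \<^const>\<open>fst\<close>.
\<close>

definition multigraph_of_matching :: "(nat \<times> nat) set set \<Rightarrow> nat set multiset" where
  "multigraph_of_matching M = image_mset (\<lambda>e. fst ` e) (mset_set M)"

text \<open>
  By the two lemmas above, the uniform distribution is well-defined whenever \<open>n * d\<close> is even.
\<close>

definition configuration_model :: "nat \<Rightarrow> nat \<Rightarrow> nat set multiset pmf" where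
  "configuration_model n d =
     map_pmf multigraph_of_matching (pmf_of_set (perfect_matchings ({..<n} \<times> {..<d})))"

definition adjacency_matrix :: "nat \<Rightarrow> nat set multiset \<Rightarrow> real mat" where
  "adjacency_matrix n G =
     mat n n (\<lambda>(i, j). if i = j then 2 * real (count G {i}) else real (count G {i, j}))"

text \<open>
  The \<open>k\<close>-th largest real eigenvalue, for \<open>k\<close> from \<open>1\<close>, counted with algebraic multiplicity.
  It is meaningful for \<open>k\<close> up to the number of real eigenvalues, which is the full dimension
  for a symmetric matrix.
\<close>

definition nth_eigenvalue :: "real mat \<Rightarrow> nat \<Rightarrow> real" where
  "nth_eigenvalue A k = rev (sorted_list_of_multiset (proots (char_poly A))) ! (k - 1)"

end

theory Submission
  imports Defs "HOL-Combinatorics.Transposition" "HOL-Library.Discrete_Functions"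
begin

text \<open>
  Write \<open>A - (d/n) J\<close> for the centred adjacency matrix. Deflating the all-ones vector, it suffices to
  bound its bilinear form on pairs of points of a finite net of the unit ball, following Kahn and Szemeredi:
  a pair of coordinates is light if the product of the two entries is at most \<open>sqrt d / n\<close> (up to a
  constant) and heavy otherwise. The light part is a statistic of the random matching whose exponential
  moments are bounded by a switching identity, strongly enough for a union bound over the net. The heavy
  part is bounded by the number of edges between level sets of the two vectors, for which a union bound
  over all pairs of vertex sets gives a Poisson-type estimate. The switching identity is exact and costs no
  factor depending on \<open>d\<close>, so the bounds are uniform in \<open>n\<close> and \<open>d\<close>.
\<close>

section \<open>Switchings of perfect matchings\<close>

text \<open>The mechanism is size biasing. Forcing \<open>p\<close> and \<open>q\<close> to be
  partners by one transposition turns the uniform matching into the uniform matching containing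
  \<open>{p, q}\<close>. Hence the expectation of \<open>edge_stat\<close> times any functional
  \<open>F\<close> is a weighted sum of expectations of \<open>F\<close> after a switch. A switch
  trades two edges for two others, so for exponential \<open>F\<close> the derivative of the moment
  is bounded by a multiple of the moment, which can be integrated. Nonnegative weights up to 1 give
  a Poisson moment, which serves the discrepancy. Signed light weights need a bound governed by the
  mean square. There the obstacle is that the deleted edges carry random weights: the variance proxy
  contains the statistic of the squared weights. The threshold \<open>sqrt d\<close> serves both
  sides. Light weights divided by \<open>sqrt d\<close> are bounded with a variance proxy of order
  \<open>n\<close>, so deviations of order \<open>n * sqrt d\<close> are rare enough for a net of
  size exponential in \<open>n\<close>. On heavy pairs the centring term, product times
  \<open>d / n\<close>, is at most the squared product times \<open>sqrt d / n\<close>, so it sums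
  to order \<open>n * sqrt d\<close>.\<close>

definition mate :: "'a set set \<Rightarrow> 'a \<Rightarrow> 'a" where
  "mate M p = (THE q. {p, q} \<in> M)"

lemma perfect_matchings_ex1_mate:
  assumes "M \<in> perfect_matchings S" "p \<in> S"
  shows "\<exists>!q. {p, q} \<in> M"
proof -
  have part: "\<Union>M = S" "disjoint M" and two: "\<And>e. e \<in> M \<Longrightarrow> card e = 2"
    using assms(1) by (auto simp: perfect_matchings_def partition_on_def)
  obtain e where e: "e \<in> M" "p \<in> e" using part(1) assms(2) by blast
  then obtain q where q: "e = {p, q}"
    using two[OF e(1)] by (auto simp: card_2_iff)
  show ?thesis
  proof (rule ex1I[of _ q])
    show "{p, q} \<in> M" using e q by simp
    fix r assume r: "{p, r} \<in> M"
    then have "{p, r} = {p, q}"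
      using disjointD[OF part(2) r, of e] e q by auto
    then show "r = q" using two[OF r] by (auto simp: doubleton_eq_iff)
  qed
qed

lemma mate_edge: "M \<in> perfect_matchings S \<Longrightarrow> p \<in> S \<Longrightarrow> {p, mate M p} \<in> M"
  unfolding mate_def by (rule theI') (rule perfect_matchings_ex1_mate)

lemma mate_eqI: "M \<in> perfect_matchings S \<Longrightarrow> p \<in> S \<Longrightarrow> {p, q} \<in> M \<Longrightarrow> mate M p = q"
  using perfect_matchings_ex1_mate[of M S p] mate_edge[of M S p] by blast

lemma mate_in: "M \<in> perfect_matchings S \<Longrightarrow> p \<in> S \<Longrightarrow> mate M p \<in> S"
  using mate_edge[of M S p] by (auto simp: perfect_matchings_def partition_on_def)

lemma mate_neq: "M \<in> perfect_matchings S \<Longrightarrow> p \<in> S \<Longrightarrow> mate M p \<noteq> p"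
  using mate_edge[of M S p] by (fastforce simp: perfect_matchings_def)

lemma mate_mate: "M \<in> perfect_matchings S \<Longrightarrow> p \<in> S \<Longrightarrow> mate M (mate M p) = p"
  by (rule mate_eqI) (auto simp: mate_in insert_commute mate_edge)

lemma bij_betw_mate: "M \<in> perfect_matchings S \<Longrightarrow> bij_betw (mate M) S S"
  by (rule bij_betwI[of _ _ _ "mate M"]) (auto simp: mate_in mate_mate)

definition relabel :: "('a \<Rightarrow> 'a) \<Rightarrow> 'a set set \<Rightarrow> 'a set set" where
  "relabel \<pi> M = (`) \<pi> ` M"

lemma relabel_perfect_matchings:
  assumes "M \<in> perfect_matchings S" "bij_betw \<pi> S S"
  shows "relabel \<pi> M \<in> perfect_matchings S"
proof -
  have part: "partition_on S M" and two: "\<And>e. e \<in> M \<Longrightarrow> card e = 2"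
    using assms(1) by (auto simp: perfect_matchings_def)
  have sub: "e \<subseteq> S" if "e \<in> M" for e using part that by (auto simp: partition_on_def)
  have inj: "inj_on \<pi> S" and img: "\<pi> ` S = S" using assms(2) by (auto simp: bij_betw_def)
  have "partition_on (\<pi> ` S) ((`) \<pi> ` M - {{}})"
    using part inj by (rule partition_on_inj_image)
  moreover have "{} \<notin> (`) \<pi> ` M" using part by (auto simp: partition_on_def)
  ultimately have "partition_on S ((`) \<pi> ` M)" by (simp add: img)
  moreover have "card (\<pi> ` e) = 2" if "e \<in> M" for e
    using card_image[OF inj_on_subset[OF inj sub[OF that]]] two[OF that] by simp
  ultimately show ?thesis by (auto simp: perfect_matchings_def relabel_def)
qed

lemma mate_relabel:
  assumes "M \<in> perfect_matchings S" "bij_betw \<pi> S S" "p \<in> S"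
  shows "mate (relabel \<pi> M) (\<pi> p) = \<pi> (mate M p)"
proof (rule mate_eqI[OF relabel_perfect_matchings[OF assms(1,2)]])
  show "\<pi> p \<in> S" using assms by (auto simp: bij_betw_def)
  have "\<pi> ` {p, mate M p} \<in> relabel \<pi> M"
    unfolding relabel_def using mate_edge[OF assms(1,3)] by (rule imageI)
  then show "{\<pi> p, \<pi> (mate M p)} \<in> relabel \<pi> M" by simp
qed

lemma bij_betw_transpose: "a \<in> S \<Longrightarrow> b \<in> S \<Longrightarrow> bij_betw (Transposition.transpose a b) S S"
  by (metis bij_betw_transpose_iff bij_betw_id id_def bij_betw_imageI inj_on_transpose transpose_image_eq)

lemma relabel_transpose_involutory: "relabel (Transposition.transpose a b) (relabel (Transposition.transpose a b) M) = M"
  by (simp add: relabel_def image_comp comp_def)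

text \<open>Relabelling by this transposition makes \<open>p\<close> and \<open>q\<close> partners. Over all matchings every matching
  containing the edge \<open>{p, q}\<close> is hit equally often.\<close>

definition switch :: "'a \<Rightarrow> 'a \<Rightarrow> 'a set set \<Rightarrow> 'a set set" where
  "switch p q M = relabel (Transposition.transpose q (mate M p)) M"

text \<open>For \<open>r\<close> different from \<open>p\<close>, transposing \<open>q\<close> and
  \<open>r\<close> fixes \<open>p\<close> and maps the matchings pairing \<open>p\<close> with
  \<open>r\<close> bijectively to those pairing \<open>p\<close> with \<open>q\<close>; on the
  former it is exactly \<open>switch p q\<close>. So each of the \<open>card S - 1\<close> possible
  partners of \<open>p\<close> contributes the same sum.\<close>

lemma sum_mate_eq:
  fixes F :: "'a set set \<Rightarrow> real"
  assumes "finite S" "p \<in> S" "q \<in> S" "p \<noteq> q"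
  shows "(real (card S) - 1) * (\<Sum>M | M \<in> perfect_matchings S \<and> mate M p = q. F M)
       = (\<Sum>M\<in>perfect_matchings S. F (switch p q M))"
proof -
  let ?P = "perfect_matchings S"
  have fin: "finite ?P" using assms(1) by (rule finite_perfect_matchings)
  have eq: "(\<Sum>M | M \<in> ?P \<and> mate M p = r. F (switch p q M)) = (\<Sum>M | M \<in> ?P \<and> mate M p = q. F M)"
    if r: "r \<in> S - {p}" for r
  proof (rule sum.reindex_bij_witness[of _ "relabel (Transposition.transpose q r)" "relabel (Transposition.transpose q r)"], goal_cases)
    case (2 M)
    have "mate (relabel (Transposition.transpose q r) M) (Transposition.transpose q r p) = Transposition.transpose q r (mate M p)"
      using 2 assms r by (intro mate_relabel[of M S] bij_betw_transpose) auto
    moreover have "Transposition.transpose q r p = p" using r assms(4) by auto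
    ultimately show ?case using 2 assms r
      by (auto intro!: relabel_perfect_matchings bij_betw_transpose)
  next
    case (4 M)
    have "mate (relabel (Transposition.transpose q r) M) (Transposition.transpose q r p) = Transposition.transpose q r (mate M p)"
      using 4 assms r by (intro mate_relabel[of M S] bij_betw_transpose) auto
    moreover have "Transposition.transpose q r p = p" using r assms(4) by auto
    ultimately show ?case using 4 assms r
      by (auto intro!: relabel_perfect_matchings bij_betw_transpose)
  qed (auto simp: relabel_transpose_involutory switch_def)
  have "(\<Sum>M\<in>?P. F (switch p q M)) = (\<Sum>r\<in>S - {p}. \<Sum>M | M \<in> ?P \<and> mate M p = r. F (switch p q M))"
    using fin assms(1,2) by (intro sum.group[symmetric]) (auto simp: mate_in mate_neq)
  also have "\<dots> = (\<Sum>r\<in>S - {p}. \<Sum>M | M \<in> ?P \<and> mate M p = q. F M)"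
    by (rule sum.cong[OF refl eq])
  also have "\<dots> = (real (card S) - 1) * (\<Sum>M | M \<in> ?P \<and> mate M p = q. F M)"
  proof -
    have "card S > 0" using assms by (auto simp: card_gt_0_iff)
    then show ?thesis using assms by (simp add: of_nat_diff)
  qed
  finally show ?thesis by simp
qed

text \<open>Ordered pairs are summed, so every edge of the matching contributes in both directions.\<close>

definition edge_stat :: "'a set \<Rightarrow> ('a \<Rightarrow> 'a \<Rightarrow> real) \<Rightarrow> 'a set set \<Rightarrow> real" where
  "edge_stat S w M = (\<Sum>p\<in>S. w p (mate M p))"

text \<open>The expectation of \<open>edge_stat\<close> under the uniform matching: each
  \<open>q\<close> other than \<open>p\<close> is the partner of \<open>p\<close> with probability
  \<open>1 / (card S - 1)\<close>.\<close>

definition edge_mean :: "'a set \<Rightarrow> ('a \<Rightarrow> 'a \<Rightarrow> real) \<Rightarrow> real" where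
  "edge_mean S w = (\<Sum>p\<in>S. \<Sum>q\<in>S - {p}. w p q) / (real (card S) - 1)"

text \<open>Group the matchings by the partner of \<open>p\<close> and apply
  \<open>sum_mate_eq\<close> to each group. It is used with \<open>F\<close> an exponential of the
  statistic, where the left-hand side appears in the derivative of the exponential moment.\<close>

lemma sum_edge_stat_mult:
  fixes F :: "'a set set \<Rightarrow> real"
  assumes "finite S" "card S \<ge> 2"
  shows "(\<Sum>M\<in>perfect_matchings S. edge_stat S w M * F M)
       = (\<Sum>p\<in>S. \<Sum>q\<in>S - {p}. w p q * (\<Sum>M\<in>perfect_matchings S. F (switch p q M))) / (real (card S) - 1)"
proof -
  let ?P = "perfect_matchings S"
  have fin: "finite ?P" using assms(1) by (rule finite_perfect_matchings)
  have "(\<Sum>M\<in>?P. edge_stat S w M * F M) = (\<Sum>p\<in>S. \<Sum>M\<in>?P. w p (mate M p) * F M)"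
    unfolding edge_stat_def sum_distrib_right by (rule sum.swap)
  also have "\<dots> = (\<Sum>p\<in>S. \<Sum>q\<in>S - {p}. \<Sum>M | M \<in> ?P \<and> mate M p = q. w p (mate M p) * F M)"
    using fin assms(1) by (intro sum.cong refl sum.group[symmetric]) (auto simp: mate_in mate_neq)
  also have "\<dots> = (\<Sum>p\<in>S. \<Sum>q\<in>S - {p}. w p q * (\<Sum>M | M \<in> ?P \<and> mate M p = q. F M))"
    unfolding sum_distrib_left by (intro sum.cong refl) auto
  also have "\<dots> = (\<Sum>p\<in>S. \<Sum>q\<in>S - {p}. w p q * (\<Sum>M\<in>?P. F (switch p q M)) / (real (card S) - 1))"
    using assms by (intro sum.cong refl) (auto simp: sum_mate_eq[symmetric])
  finally show ?thesis by (simp add: sum_divide_distrib)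
qed

text \<open>The switch replaces the edges \<open>{p, r}\<close> and \<open>{q, s}\<close> by
  \<open>{p, q}\<close> and \<open>{r, s}\<close> and leaves all other partners alone. Each edge
  enters in both directions, hence eight terms.\<close>

lemma edge_stat_switch:
  assumes "finite S" "M \<in> perfect_matchings S" "p \<in> S" "q \<in> S" "p \<noteq> q" "mate M p \<noteq> q"
  defines "r \<equiv> mate M p" and "s \<equiv> mate M q"
  shows "edge_stat S w (switch p q M) = edge_stat S w M
     + (w p q + w q p + w r s + w s r) - (w p r + w r p + w q s + w s q)"
proof -
  let ?M = "switch p q M" and ?T = "{p, q, r, s}"
  have S: "r \<in> S" "s \<in> S" using assms by (auto simp: mate_in)
  have inv: "mate M r = p" "mate M s = q" using assms by (auto simp: mate_mate)
  have dist: "p \<noteq> r" "q \<noteq> s" "r \<noteq> q" "r \<noteq> s" "s \<noteq> p"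
    using assms inv by (auto dest: mate_neq)
  have bij: "bij_betw (Transposition.transpose q r) S S" using assms S by (intro bij_betw_transpose) auto
  have mt: "mate ?M x = Transposition.transpose q r (mate M (Transposition.transpose q r x))" if "x \<in> S" for x
  proof -
    have "Transposition.transpose q r x \<in> S" using bij that by (auto simp: bij_betw_def)
    from mate_relabel[OF assms(2) bij this] show ?thesis by (simp add: switch_def r_def)
  qed
  have new: "mate ?M p = q" "mate ?M q = p" "mate ?M r = s" "mate ?M s = r"
    using mt assms(3,4) S dist inv by (auto simp: r_def[symmetric] s_def[symmetric] assms(5))
  have rest: "mate ?M x = mate M x" if "x \<in> S - ?T" for x
  proof -
    have "mate M (mate M x) = x" using that assms(2) by (auto simp: mate_mate)
    then have "mate M x \<noteq> q" "mate M x \<noteq> r"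
      using that inv by (auto simp: s_def)
    then show ?thesis using that mt[of x] by auto
  qed
  have "?T \<subseteq> S" using assms S by auto
  then have split: "edge_stat S w M' = (\<Sum>x\<in>S - ?T. w x (mate M' x)) + (\<Sum>x\<in>?T. w x (mate M' x))" for M'
    unfolding edge_stat_def using assms(1) by (rule sum.subset_diff)
  have four: "(\<Sum>x\<in>?T. g x) = g p + g q + g r + g s" for g :: "'a \<Rightarrow> real"
    using dist assms(5) by (auto simp: insert_commute)
  show ?thesis
    unfolding split four new inv using rest by (simp add: r_def[symmetric] s_def[symmetric])
qed

lemma switch_trivial: "mate M p = q \<Longrightarrow> switch p q M = M"
  by (simp add: switch_def relabel_def)

section \<open>Exponential moments of edge statistics\<close>

text \<open>Gronwall's inequality: the quotient of \<open>f\<close> by \<open>exp g\<close> is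
  nonincreasing. Below, \<open>f\<close> is an exponential moment as a function of
  \<open>t\<close>.\<close>

lemma exp_growth_bound:
  fixes f g :: "real \<Rightarrow> real"
  assumes "0 \<le> b"
    and f: "\<And>t. 0 \<le> t \<Longrightarrow> t \<le> b \<Longrightarrow> (f has_real_derivative f' t) (at t)"
    and g: "\<And>t. 0 \<le> t \<Longrightarrow> t \<le> b \<Longrightarrow> (g has_real_derivative g' t) (at t)"
    and le: "\<And>t. 0 \<le> t \<Longrightarrow> t \<le> b \<Longrightarrow> f' t \<le> g' t * f t"
  shows "f b \<le> f 0 * exp (g b - g 0)"
proof -
  have "f b * exp (- g b) \<le> f 0 * exp (- g 0)"
  proof (rule DERIV_nonpos_imp_nonincreasing[OF assms(1)])
    fix t assume t: "0 \<le> t" "t \<le> b"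
    have "((\<lambda>t. f t * exp (- g t)) has_real_derivative (f' t - g' t * f t) * exp (- g t)) (at t)"
      using f[OF t] g[OF t] by (auto intro!: derivative_eq_intros simp: algebra_simps)
    moreover have "(f' t - g' t * f t) * exp (- g t) \<le> 0"
      using le[OF t] by (auto simp: mult_le_0_iff)
    ultimately show "\<exists>y. ((\<lambda>t. f t * exp (- g t)) has_real_derivative y) (at t) \<and> y \<le> 0" by blast
  qed
  then have "f b * exp (- g b) * exp (g b) \<le> f 0 * exp (- g 0) * exp (g b)"
    by (intro mult_right_mono) auto
  then show ?thesis by (simp add: exp_diff exp_minus field_simps)
qed

lemma abs_exp_minus_one_le:
  fixes h :: real
  assumes "\<bar>h\<bar> \<le> 1"
  shows "\<bar>exp h - 1\<bar> \<le> 2 * \<bar>h\<bar>"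
proof (cases "h \<ge> 0")
  case True
  have "exp h \<le> 1 + h + h\<^sup>2" using True assms by (intro exp_bound) auto
  also have "h\<^sup>2 \<le> h * 1" unfolding power2_eq_square using True assms by (intro mult_left_mono) auto
  finally show ?thesis using True by simp
next
  case False
  define r where "r = exp h - 1 - h"
  have "0 \<le> r" using exp_ge_add_one_self[of h] unfolding r_def by (simp only: le_diff_eq add_0_left add.commute)
  have "\<bar>exp h - 1\<bar> = 1 - exp h" using False by simp
  also have "\<dots> = - h - r" by (simp add: r_def)
  also have "\<dots> \<le> 2 * \<bar>h\<bar>" using False \<open>0 \<le> r\<close> by simp
  finally show ?thesis .
qed

lemma abs_exp_diff_le:
  fixes x y :: real
  assumes "\<bar>y - x\<bar> \<le> 1"
  shows "\<bar>exp y - exp x\<bar> \<le> 2 * \<bar>y - x\<bar> * exp x"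
proof -
  have "\<bar>exp (y - x) - 1\<bar> * exp x \<le> 2 * \<bar>y - x\<bar> * exp x"
    using abs_exp_minus_one_le[OF assms] by (rule mult_right_mono) simp
  moreover have "exp y - exp x = (exp (y - x) - 1) * exp x" by (simp add: exp_diff algebra_simps)
  ultimately show ?thesis by (simp add: abs_mult)
qed

text \<open>Markov's inequality in counting form; probabilities are kept as cardinalities until the
  final theorem.\<close>

lemma card_exp_tail:
  fixes g :: "'a \<Rightarrow> real"
  assumes "finite P" "(\<Sum>x\<in>P. exp (g x)) \<le> c"
  shows "real (card {x\<in>P. g x \<ge> t}) \<le> c * exp (- t)"
proof -
  have "real (card {x\<in>P. g x \<ge> t}) * exp t = (\<Sum>x | x \<in> P \<and> g x \<ge> t. exp t)" by simp
  also have "\<dots> \<le> (\<Sum>x | x \<in> P \<and> g x \<ge> t. exp (g x))" by (intro sum_mono) auto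
  also have "\<dots> \<le> (\<Sum>x\<in>P. exp (g x))" using assms(1) by (intro sum_mono2) auto
  finally show ?thesis using assms(2) by (simp add: exp_minus field_simps)
qed

lemma edge_stat_switch_le:
  assumes "finite S" "M \<in> perfect_matchings S" "p \<in> S" "q \<in> S" "p \<noteq> q"
    and "\<And>p q. 0 \<le> w p q" "\<And>p q. w p q \<le> 1"
  shows "edge_stat S w (switch p q M) \<le> edge_stat S w M + 4"
proof (cases "mate M p = q")
  case False
  note assms(6)[of p "mate M p"] assms(6)[of "mate M p" p] assms(6)[of q "mate M q"] assms(6)[of "mate M q" q]
    assms(7)[of p q] assms(7)[of q p] assms(7)[of "mate M p" "mate M q"] assms(7)[of "mate M q" "mate M p"]
  then show ?thesis using edge_stat_switch[OF assms(1-5) False, of w] by linarith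
qed (simp add: switch_trivial)

text \<open>A switch adds at most the four directed weights of its two new edges, so by size biasing
  the moment \<open>m\<close> satisfies \<open>m' \<le> edge_mean S w * exp (4 * t) * m\<close>. The
  integrated bound is the moment of 4 times a Poisson variable of mean
  \<open>edge_mean S w / 4\<close>.\<close>

lemma edge_stat_mgf_nonneg:
  fixes S :: "'a set"
  assumes "finite S" "card S \<ge> 2" "\<And>p q. 0 \<le> w p q" "\<And>p q. w p q \<le> 1" "0 \<le> \<theta>"
  shows "(\<Sum>M\<in>perfect_matchings S. exp (\<theta> * edge_stat S w M))
     \<le> card (perfect_matchings S) * exp (edge_mean S w * (exp (4 * \<theta>) - 1) / 4)"
proof -
  let ?P = "perfect_matchings S" and ?X = "edge_stat S w"
  let ?m = "\<lambda>t. \<Sum>M\<in>?P. exp (t * ?X M)"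
  have "?m \<theta> \<le> ?m 0 * exp (edge_mean S w * exp (4 * \<theta>) / 4 - edge_mean S w * exp (4 * 0) / 4)"
  proof (rule exp_growth_bound[OF assms(5)])
    fix t :: real assume t: "0 \<le> t" "t \<le> \<theta>"
    show "(?m has_real_derivative (\<Sum>M\<in>?P. ?X M * exp (t * ?X M))) (at t)"
      by (auto intro!: derivative_eq_intros sum.cong)
    show "((\<lambda>t. edge_mean S w * exp (4 * t) / 4) has_real_derivative edge_mean S w * exp (4 * t)) (at t)"
      by (auto intro!: derivative_eq_intros)
    have "(\<Sum>p\<in>S. \<Sum>q\<in>S - {p}. w p q * (\<Sum>M\<in>?P. exp (t * ?X (switch p q M))))
        \<le> (\<Sum>p\<in>S. \<Sum>q\<in>S - {p}. w p q * (exp (4 * t) * ?m t))"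
    proof (intro sum_mono mult_left_mono assms(3))
      fix p q assume pq: "p \<in> S" "q \<in> S - {p}"
      have "exp (t * ?X (switch p q M)) \<le> exp (4 * t) * exp (t * ?X M)" if "M \<in> ?P" for M
      proof -
        have "t * ?X (switch p q M) \<le> t * (?X M + 4)"
          using edge_stat_switch_le[of S M p q w] assms pq that t by (intro mult_left_mono) auto
        then show ?thesis by (simp flip: exp_add add: algebra_simps)
      qed
      then show "(\<Sum>M\<in>?P. exp (t * ?X (switch p q M))) \<le> exp (4 * t) * ?m t"
        unfolding sum_distrib_left by (intro sum_mono) auto
    qed
    also have "\<dots> = (\<Sum>p\<in>S. \<Sum>q\<in>S - {p}. w p q) * (exp (4 * t) * ?m t)"
      by (simp add: sum_distrib_right)
    finally show "(\<Sum>M\<in>?P. ?X M * exp (t * ?X M)) \<le> edge_mean S w * exp (4 * t) * ?m t"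
      using assms(2) unfolding sum_edge_stat_mult[OF assms(1,2)] edge_mean_def
      by (simp add: divide_right_mono mult.assoc)
  qed
  then show ?thesis by (simp add: algebra_simps diff_divide_distrib)
qed

section \<open>Exponential moments for symmetric signed weights\<close>

lemma edge_mean_cmult: "edge_mean S (\<lambda>p q. c * w p q) = c * edge_mean S w"
  by (simp add: edge_mean_def sum_distrib_left)

lemma edge_mean_mono:
  "card S \<ge> 2 \<Longrightarrow> (\<And>p q. p \<in> S \<Longrightarrow> q \<in> S \<Longrightarrow> w p q \<le> v p q) \<Longrightarrow> edge_mean S w \<le> edge_mean S v"
  by (auto simp: edge_mean_def intro!: divide_right_mono sum_mono)

lemma edge_stat_cmult: "edge_stat S (\<lambda>p q. c * w p q) M = c * edge_stat S w M"
  by (simp add: edge_stat_def sum_distrib_left)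

text \<open>Weights up to 1/16 keep the change of the exponent below 1, where the exponential is
  Lipschitz up to a factor 2. The bound is linear in the weights of the four edges involved, so
  multiplying by \<open>\<bar>w p q\<bar>\<close> makes it quadratic.\<close>

lemma edge_stat_exp_switch_diff:
  fixes w :: "'a \<Rightarrow> 'a \<Rightarrow> real"
  assumes "finite S" "M \<in> perfect_matchings S" "p \<in> S" "q \<in> S" "p \<noteq> q"
    and sym: "\<And>p q. w p q = w q p" and small: "\<And>p q. \<bar>w p q\<bar> \<le> 1 / 16"
    and t: "0 \<le> t" "t \<le> 1"
  defines "F \<equiv> \<lambda>M. exp (t * edge_stat S w M - 6 * t\<^sup>2 * edge_stat S (\<lambda>p q. (w p q)\<^sup>2) M)"
  shows "\<bar>F (switch p q M) - F M\<bar> \<le> 6 * t * (\<bar>w p q\<bar> + \<bar>w p (mate M p)\<bar> + \<bar>w q (mate M q)\<bar>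
     + \<bar>w (mate M p) (mate M q)\<bar>) * F M"
proof (cases "mate M p = q")
  case False
  define a b c d where abcd: "a = w p q" "b = w p (mate M p)" "c = w q (mate M q)" "d = w (mate M p) (mate M q)"
  define D where "D = \<bar>a\<bar> + \<bar>b\<bar> + \<bar>c\<bar> + \<bar>d\<bar>"
  \<comment> \<open>Squares are at most a sixteenth of absolute values, so the compensator changes
    the exponent by at most \<open>6 * t\<^sup>2 * (D / 8) \<le> t * D\<close>; with
    \<open>2 * t * D\<close> from the statistic this makes \<open>3 * t * D\<close>.\<close>
  have sq: "x\<^sup>2 \<le> \<bar>x\<bar> / 16" if "\<bar>x\<bar> \<le> 1 / 16" for x :: real
  proof -
    have "\<bar>x\<bar> * \<bar>x\<bar> \<le> \<bar>x\<bar> * (1 / 16)" using that by (intro mult_left_mono) auto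
    then show ?thesis by (simp add: power2_eq_square flip: abs_mult)
  qed
  have small': "\<bar>a\<bar> \<le> 1 / 16" "\<bar>b\<bar> \<le> 1 / 16" "\<bar>c\<bar> \<le> 1 / 16" "\<bar>d\<bar> \<le> 1 / 16"
    using small by (auto simp: abcd)
  have X: "edge_stat S w (switch p q M) - edge_stat S w M = 2 * (a + d - b - c)"
    using edge_stat_switch[OF assms(1-5) False, of w] sym[of q p] sym[of "mate M p" p]
      sym[of "mate M q" q] sym[of "mate M q" "mate M p"] by (simp add: abcd)
  have Y: "edge_stat S (\<lambda>p q. (w p q)\<^sup>2) (switch p q M) - edge_stat S (\<lambda>p q. (w p q)\<^sup>2) M
      = 2 * (a\<^sup>2 + d\<^sup>2 - b\<^sup>2 - c\<^sup>2)"
    using edge_stat_switch[OF assms(1-5) False, of "\<lambda>p q. (w p q)\<^sup>2"] sym[of q p] sym[of "mate M p" p]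
      sym[of "mate M q" q] sym[of "mate M q" "mate M p"] by (simp add: abcd)
  define U where "U = (\<lambda>M. t * edge_stat S w M - 6 * t\<^sup>2 * edge_stat S (\<lambda>p q. (w p q)\<^sup>2) M)"
  have U: "U (switch p q M) - U M = t * (2 * (a + d - b - c)) - 6 * t\<^sup>2 * (2 * (a\<^sup>2 + d\<^sup>2 - b\<^sup>2 - c\<^sup>2))"
    unfolding U_def X[symmetric] Y[symmetric] by (simp add: algebra_simps)
  have "\<bar>2 * (a + d - b - c)\<bar> \<le> 2 * D" by (simp add: D_def)
  then have 1: "\<bar>t * (2 * (a + d - b - c))\<bar> \<le> t * (2 * D)"
    unfolding abs_mult[of t] using t by (simp add: mult_left_mono)
  define z where "z = 2 * (a\<^sup>2 + d\<^sup>2 - b\<^sup>2 - c\<^sup>2)"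
  have "\<bar>z\<bar> \<le> 2 * (a\<^sup>2 + d\<^sup>2 + b\<^sup>2 + c\<^sup>2)"
    using zero_le_power2[of a] zero_le_power2[of b] zero_le_power2[of c] zero_le_power2[of d]
    unfolding abs_le_iff z_def by (simp add: algebra_simps)
  also have "\<dots> \<le> D / 8" using small'[THEN sq] by (simp add: D_def)
  finally have "6 * t\<^sup>2 * \<bar>z\<bar> \<le> 6 * t\<^sup>2 * (D / 8)" by (rule mult_left_mono) simp
  then have "\<bar>6 * t\<^sup>2 * z\<bar> \<le> 6 * t\<^sup>2 * (D / 8)" by (simp add: abs_mult)
  also have "\<dots> \<le> t * D"
  proof -
    have "t\<^sup>2 \<le> t" using t by (simp add: power2_eq_square mult_left_le)
    moreover have "0 \<le> D" by (simp add: D_def)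
    ultimately have "t\<^sup>2 * D \<le> t * D" "0 \<le> t\<^sup>2 * D" by (auto intro: mult_right_mono)
    moreover have "6 * t\<^sup>2 * (D / 8) = 3 / 4 * (t\<^sup>2 * D)" by simp
    ultimately show ?thesis by linarith
  qed
  finally have dU: "\<bar>U (switch p q M) - U M\<bar> \<le> 3 * t * D" using 1 unfolding U z_def by linarith
  \<comment> \<open>Hence \<open>3 * t * D\<close> is at most 3/4, as \<open>abs_exp_diff_le\<close>
    requires.\<close>
  have "D \<le> 1 / 4" using small' by (simp add: D_def)
  then have "t * D \<le> 1 * (1 / 4)" using t by (intro mult_mono) (auto simp: D_def)
  with dU have "\<bar>exp (U (switch p q M)) - exp (U M)\<bar> \<le> 2 * \<bar>U (switch p q M) - U M\<bar> * exp (U M)"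
    by (intro abs_exp_diff_le) auto
  also have "\<dots> \<le> 2 * (3 * t * D) * exp (U M)"
    by (rule mult_right_mono[OF mult_left_mono[OF dU]]) auto
  finally show ?thesis by (simp add: F_def U_def D_def abcd)
qed (use t in \<open>simp add: switch_trivial F_def\<close>)

text \<open>A bijection of \<open>S\<close> permutes the ordered pairs of distinct points. For
  \<open>mate M\<close> this makes the second new edge of a switch count like the first.\<close>

lemma sum_offdiag_image:
  fixes g :: "'a \<Rightarrow> 'a \<Rightarrow> real"
  assumes "bij_betw \<sigma> S S" "finite S"
  shows "(\<Sum>p\<in>S. \<Sum>q\<in>S - {p}. g (\<sigma> p) (\<sigma> q)) = (\<Sum>p\<in>S. \<Sum>q\<in>S - {p}. g p q)"
proof -
  have "(\<Sum>q\<in>S - {p}. g (\<sigma> p) (\<sigma> q)) = (\<Sum>q\<in>S - {\<sigma> p}. g (\<sigma> p) q)" if "p \<in> S" for p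
  proof (rule sum.reindex_bij_betw)
    have "bij_betw \<sigma> (S - {p}) (S - \<sigma> ` {p})"
      using assms that by (intro bij_betw_DiffI) (auto simp: bij_betw_def)
    then show "bij_betw \<sigma> (S - {p}) (S - {\<sigma> p})" by simp
  qed
  then show ?thesis
    using sum.reindex_bij_betw[OF assms(1), of "\<lambda>p. \<Sum>q\<in>S - {p}. g p q"] by simp
qed

text \<open>The compensator \<open>6 Y\<close> absorbs the random part of the variance proxy: switching bounds the derivative
  of the exponential moment by a term in \<open>Y\<close>, which the derivative of the compensator cancels.\<close>

lemma edge_stat_mgf:
  fixes S :: "'a set"
  assumes S: "finite S" "card S \<ge> 2"
    and sym: "\<And>p q. w p q = w q p" and small: "\<And>p q. \<bar>w p q\<bar> \<le> 1 / 16"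
  defines "Y \<equiv> edge_stat S (\<lambda>p q. (w p q)\<^sup>2)" and "v \<equiv> edge_mean S (\<lambda>p q. (w p q)\<^sup>2)"
  shows "(\<Sum>M\<in>perfect_matchings S. exp (edge_stat S w M - 6 * Y M))
     \<le> card (perfect_matchings S) * exp (edge_mean S w + 9 * v)"
proof -
  let ?P = "perfect_matchings S" and ?X = "edge_stat S w"
  define N where "N = real (card S) - 1"
  have N: "N > 0" using S by (simp add: N_def)
  define F where "F = (\<lambda>t M. exp (t * ?X M - 6 * t\<^sup>2 * Y M))"
  define G where "G = (\<lambda>M p q. \<bar>w p q\<bar> + \<bar>w p (mate M p)\<bar> + \<bar>w q (mate M q)\<bar> + \<bar>w (mate M p) (mate M q)\<bar>)"
  let ?m = "\<lambda>t. \<Sum>M\<in>?P. F t M"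
  \<comment> \<open>The arithmetic-geometric mean splits the products: the two new edges of a switch
    give the deterministic \<open>3 * v\<close>, that is 5/2 plus 1/2, and the two deleted edges
    give the random \<open>Y M\<close>.\<close>
  have G: "(\<Sum>p\<in>S. \<Sum>q\<in>S - {p}. \<bar>w p q\<bar> * G M p q) \<le> N * (3 * v + Y M)" if M: "M \<in> ?P" for M
  proof -
    have "\<bar>w p q\<bar> * G M p q \<le> 5 / 2 * (w p q)\<^sup>2 + (w p (mate M p))\<^sup>2 / 2 + (w q (mate M q))\<^sup>2 / 2
       + (w (mate M p) (mate M q))\<^sup>2 / 2" for p q
    proof -
      have am: "\<bar>x\<bar> * \<bar>y\<bar> \<le> x\<^sup>2 / 2 + y\<^sup>2 / 2" for x y :: real
        using zero_le_power2[of "\<bar>x\<bar> - \<bar>y\<bar>"] by (simp add: power2_diff)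
      show ?thesis unfolding G_def distrib_left
        using am[of "w p q" "w p q"] am[of "w p q" "w p (mate M p)"] am[of "w p q" "w q (mate M q)"]
          am[of "w p q" "w (mate M p) (mate M q)"] by linarith
    qed
    then have "(\<Sum>p\<in>S. \<Sum>q\<in>S - {p}. \<bar>w p q\<bar> * G M p q)
      \<le> (\<Sum>p\<in>S. \<Sum>q\<in>S - {p}. 5 / 2 * (w p q)\<^sup>2 + (w p (mate M p))\<^sup>2 / 2 + (w q (mate M q))\<^sup>2 / 2
       + (w (mate M p) (mate M q))\<^sup>2 / 2)" by (intro sum_mono)
    also have "\<dots> = 5 / 2 * (\<Sum>p\<in>S. \<Sum>q\<in>S - {p}. (w p q)\<^sup>2) + (\<Sum>p\<in>S. \<Sum>q\<in>S - {p}. (w p (mate M p))\<^sup>2) / 2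
       + (\<Sum>p\<in>S. \<Sum>q\<in>S - {p}. (w q (mate M q))\<^sup>2) / 2 + (\<Sum>p\<in>S. \<Sum>q\<in>S - {p}. (w (mate M p) (mate M q))\<^sup>2) / 2"
      by (simp add: sum.distrib sum_distrib_left sum_divide_distrib)
    also have "(\<Sum>p\<in>S. \<Sum>q\<in>S - {p}. (w (mate M p) (mate M q))\<^sup>2) = (\<Sum>p\<in>S. \<Sum>q\<in>S - {p}. (w p q)\<^sup>2)"
      by (rule sum_offdiag_image[OF bij_betw_mate[OF M] S(1)])
    also have "(\<Sum>p\<in>S. \<Sum>q\<in>S - {p}. (w p q)\<^sup>2) = N * v"
      using N by (simp add: v_def edge_mean_def N_def)
    also have "(\<Sum>p\<in>S. \<Sum>q\<in>S - {p}. (w p (mate M p))\<^sup>2) = N * Y M"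
      using S by (simp add: Y_def edge_stat_def N_def sum_distrib_left of_nat_diff)
    also have "(\<Sum>p\<in>S. \<Sum>q\<in>S - {p}. (w q (mate M q))\<^sup>2) = N * Y M"
    proof -
      have "(\<Sum>p\<in>S. \<Sum>q\<in>S - {p}. (w q (mate M q))\<^sup>2) = (\<Sum>p\<in>S. Y M - (w p (mate M p))\<^sup>2)"
        using S by (intro sum.cong refl) (simp add: Y_def edge_stat_def sum_diff1)
      also have "\<dots> = real (card S) * Y M - Y M"
        by (simp add: sum_subtractf) (simp add: Y_def edge_stat_def)
      finally show ?thesis by (simp add: N_def algebra_simps)
    qed
    finally show ?thesis by (simp add: algebra_simps)
  qed
  have XF: "(\<Sum>M\<in>?P. ?X M * F t M) \<le> edge_mean S w * ?m t + 6 * t * (\<Sum>M\<in>?P. (3 * v + Y M) * F t M)"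
    if t: "0 \<le> t" "t \<le> 1" for t
  proof -
    have "(\<Sum>p\<in>S. \<Sum>q\<in>S - {p}. w p q * (\<Sum>M\<in>?P. F t (switch p q M)))
       \<le> (\<Sum>p\<in>S. \<Sum>q\<in>S - {p}. w p q * ?m t + (\<Sum>M\<in>?P. 6 * t * F t M * (\<bar>w p q\<bar> * G M p q)))"
    proof (intro sum_mono)
      fix p q assume pq: "p \<in> S" "q \<in> S - {p}"
      have "w p q * (\<Sum>M\<in>?P. F t (switch p q M)) - w p q * ?m t
         = (\<Sum>M\<in>?P. w p q * (F t (switch p q M) - F t M))"
        by (simp add: sum_distrib_left sum_subtractf algebra_simps)
      also have "\<dots> \<le> (\<Sum>M\<in>?P. 6 * t * F t M * (\<bar>w p q\<bar> * G M p q))"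
      proof (rule sum_mono)
        fix M assume M: "M \<in> ?P"
        have "w p q * (F t (switch p q M) - F t M) \<le> \<bar>w p q\<bar> * \<bar>F t (switch p q M) - F t M\<bar>"
          by (simp flip: abs_mult)
        also have "\<dots> \<le> \<bar>w p q\<bar> * (6 * t * G M p q * F t M)"
          unfolding F_def G_def Y_def
          using edge_stat_exp_switch_diff[OF S(1) M, of p q w t] pq sym small t
          by (intro mult_left_mono) auto
        finally show "w p q * (F t (switch p q M) - F t M) \<le> 6 * t * F t M * (\<bar>w p q\<bar> * G M p q)"
          by (simp add: mult_ac)
      qed
      finally show "w p q * (\<Sum>M\<in>?P. F t (switch p q M))
        \<le> w p q * ?m t + (\<Sum>M\<in>?P. 6 * t * F t M * (\<bar>w p q\<bar> * G M p q))" by simp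
    qed
    also have "\<dots> = (\<Sum>p\<in>S. \<Sum>q\<in>S - {p}. w p q) * ?m t
        + (\<Sum>M\<in>?P. 6 * t * F t M * (\<Sum>p\<in>S. \<Sum>q\<in>S - {p}. \<bar>w p q\<bar> * G M p q))"
    proof -
      have "(\<Sum>p\<in>S. \<Sum>q\<in>S - {p}. \<Sum>M\<in>?P. h M p q) = (\<Sum>M\<in>?P. \<Sum>p\<in>S. \<Sum>q\<in>S - {p}. h M p q)"
        for h :: "'a set set \<Rightarrow> 'a \<Rightarrow> 'a \<Rightarrow> real"
        by (subst sum.swap[of _ ?P], subst sum.swap[of _ ?P], rule refl)
      then show ?thesis by (simp add: sum.distrib sum_distrib_right sum_distrib_left)
    qed
    also have "\<dots> \<le> (\<Sum>p\<in>S. \<Sum>q\<in>S - {p}. w p q) * ?m t + (\<Sum>M\<in>?P. 6 * t * F t M * (N * (3 * v + Y M)))"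
      using t G by (intro add_left_mono sum_mono mult_left_mono) (auto simp: F_def)
    also have "(\<Sum>p\<in>S. \<Sum>q\<in>S - {p}. w p q) = N * edge_mean S w"
      using N by (simp add: edge_mean_def N_def)
    finally show ?thesis
      using N unfolding sum_edge_stat_mult[OF S] N_def[symmetric]
      by (simp add: divide_le_eq sum_distrib_left sum_distrib_right algebra_simps)
  qed
  \<comment> \<open>Differentiating the statistic costs \<open>6 * t * (3 * v + Y)\<close> and the
    compensator contributes \<open>- 12 * t * Y\<close>. No positive multiple of \<open>Y\<close>
    remains, and \<open>18 * t * v\<close> integrates to \<open>9 * v\<close>.\<close>
  have "?m 1 \<le> ?m 0 * exp ((edge_mean S w * 1 + 9 * v * 1\<^sup>2) - (edge_mean S w * 0 + 9 * v * 0\<^sup>2))"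
  proof (rule exp_growth_bound)
    fix t :: real assume t: "0 \<le> t" "t \<le> 1"
    show "(?m has_real_derivative (\<Sum>M\<in>?P. (?X M - 12 * t * Y M) * F t M)) (at t)"
      unfolding F_def by (auto intro!: derivative_eq_intros sum.cong simp: algebra_simps)
    show "((\<lambda>t. edge_mean S w * t + 9 * v * t\<^sup>2) has_real_derivative edge_mean S w + 18 * t * v) (at t)"
      by (auto intro!: derivative_eq_intros)
    have "0 \<le> (\<Sum>M\<in>?P. Y M * F t M)"
      by (auto simp: F_def Y_def edge_stat_def intro!: sum_nonneg mult_nonneg_nonneg)
    then have "0 \<le> t * (\<Sum>M\<in>?P. Y M * F t M)" using t by simp
    moreover have "(\<Sum>M\<in>?P. (?X M - 12 * t * Y M) * F t M)
        = (\<Sum>M\<in>?P. ?X M * F t M) - 12 * (t * (\<Sum>M\<in>?P. Y M * F t M))"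
      by (simp add: sum_subtractf sum_distrib_left algebra_simps)
    moreover have "(\<Sum>M\<in>?P. (3 * v + Y M) * F t M) = 3 * v * ?m t + (\<Sum>M\<in>?P. Y M * F t M)"
      by (simp add: distrib_right sum.distrib sum_distrib_left)
    ultimately show "(\<Sum>M\<in>?P. (?X M - 12 * t * Y M) * F t M) \<le> (edge_mean S w + 18 * t * v) * ?m t"
      using XF[OF t] by (simp add: algebra_simps)
  qed simp
  then show ?thesis by (simp add: F_def)
qed

text \<open>The compensator is removed by applying the same bound to the nonnegative weights \<open>16 w\<^sup>2\<close>,
  whose squares are at most \<open>w\<^sup>2\<close>.\<close>

lemma edge_stat_tail:
  fixes S :: "'a set"
  assumes S: "finite S" "card S \<ge> 2"
    and sym: "\<And>p q. w p q = w q p" and small: "\<And>p q. \<bar>w p q\<bar> \<le> 1 / 16"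
  defines "v \<equiv> edge_mean S (\<lambda>p q. (w p q)\<^sup>2)"
  assumes "s \<ge> 0"
  shows "real (card {M \<in> perfect_matchings S. edge_stat S w M \<ge> edge_mean S w + 24 * v + 2 * s})
     \<le> 2 * exp (- s) * card (perfect_matchings S)"
proof -
  let ?P = "perfect_matchings S" and ?X = "edge_stat S w"
  let ?Y = "edge_stat S (\<lambda>p q. (w p q)\<^sup>2)" and ?Z = "edge_stat S (\<lambda>p q. (16 * (w p q)\<^sup>2)\<^sup>2)"
  have fin: "finite ?P" using S(1) by (rule finite_perfect_matchings)
  have sq: "(w p q)\<^sup>2 \<le> 1 / 256" for p q
    using power_mono[OF small[of p q], of 2] by (simp add: power_divide)
  have sq16: "\<bar>16 * (w p q)\<^sup>2\<bar> \<le> 1 / 16" for p q using sq[of p q] by simp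
  have sym16: "16 * (w p q)\<^sup>2 = 16 * (w q p)\<^sup>2" for p q by (subst sym) (rule refl)
  have quart: "(16 * (w p q)\<^sup>2)\<^sup>2 \<le> (w p q)\<^sup>2" for p q
  proof -
    have "(w p q)\<^sup>2 * (w p q)\<^sup>2 \<le> (w p q)\<^sup>2 * (1 / 256)" using sq by (intro mult_left_mono) auto
    then show ?thesis by (simp add: power_mult_distrib power2_eq_square)
  qed
  have A: "real (card {M\<in>?P. ?X M - 6 * ?Y M \<ge> edge_mean S w + 9 * v + s}) \<le> card ?P * exp (- s)"
    using card_exp_tail[OF fin edge_stat_mgf[where w = w, OF S sym small], of "edge_mean S w + 9 * v + s"]
    by (simp add: v_def mult.assoc flip: exp_add)
  \<comment> \<open>\<open>16 Y - 6 Z\<close> is at least \<open>10 Y\<close>. The new weights have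
    mean \<open>16 * v\<close> and mean square at most \<open>v\<close>, and 16 + 9 gives the
    25.\<close>
  have "(\<Sum>M\<in>?P. exp (10 * ?Y M)) \<le> (\<Sum>M\<in>?P. exp (edge_stat S (\<lambda>p q. 16 * (w p q)\<^sup>2) M - 6 * ?Z M))"
  proof (intro sum_mono)
    fix M
    have "?Z M \<le> ?Y M" unfolding edge_stat_def by (intro sum_mono quart)
    then show "exp (10 * ?Y M) \<le> exp (edge_stat S (\<lambda>p q. 16 * (w p q)\<^sup>2) M - 6 * ?Z M)"
      by (simp add: edge_stat_cmult)
  qed
  also have "\<dots> \<le> card ?P * exp (edge_mean S (\<lambda>p q. 16 * (w p q)\<^sup>2) + 9 * edge_mean S (\<lambda>p q. (16 * (w p q)\<^sup>2)\<^sup>2))"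
    using S sq16 sym16 by (intro edge_stat_mgf)
  also have "\<dots> \<le> card ?P * exp (25 * v)"
    using edge_mean_mono[OF S(2) quart] by (intro mult_left_mono) (auto simp: edge_mean_cmult v_def)
  finally have B: "real (card {M\<in>?P. 10 * ?Y M \<ge> 25 * v + s}) \<le> card ?P * exp (- s)"
    using card_exp_tail[OF fin, of "\<lambda>M. 10 * ?Y M" "card ?P * exp (25 * v)" "25 * v + s"]
    by (simp add: mult.assoc flip: exp_add)
  \<comment> \<open>Outside both events the excess of the statistic over its mean is below
    \<open>9 * v + s\<close> plus 6/10 of \<open>25 * v + s\<close>, hence below
    \<open>24 * v + 2 * s\<close>.\<close>
  have "{M \<in> ?P. ?X M \<ge> edge_mean S w + 24 * v + 2 * s}
     \<subseteq> {M\<in>?P. ?X M - 6 * ?Y M \<ge> edge_mean S w + 9 * v + s} \<union> {M\<in>?P. 10 * ?Y M \<ge> 25 * v + s}"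
    using assms(6) by auto
  then have "card {M \<in> ?P. ?X M \<ge> edge_mean S w + 24 * v + 2 * s}
     \<le> card ({M\<in>?P. ?X M - 6 * ?Y M \<ge> edge_mean S w + 9 * v + s} \<union> {M\<in>?P. 10 * ?Y M \<ge> 25 * v + s})"
    using fin by (intro card_mono) auto
  also have "\<dots> \<le> card {M\<in>?P. ?X M - 6 * ?Y M \<ge> edge_mean S w + 9 * v + s} + card {M\<in>?P. 10 * ?Y M \<ge> 25 * v + s}"
    by (rule card_Un_le)
  finally have "real (card {M \<in> ?P. ?X M \<ge> edge_mean S w + 24 * v + 2 * s})
     \<le> real (card {M\<in>?P. ?X M - 6 * ?Y M \<ge> edge_mean S w + 9 * v + s}) + real (card {M\<in>?P. 10 * ?Y M \<ge> 25 * v + s})"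
    by linarith
  also have "\<dots> \<le> card ?P * exp (- s) + card ?P * exp (- s)" by (rule add_mono[OF A B])
  finally show ?thesis by (simp add: mult_ac)
qed

section \<open>Adjacency matrices of matchings\<close>

lemma card_slot:
  fixes n d :: nat
  shows "card ({..<n} \<times> {..<d}) = n * d" by (simp add: card_cartesian_product)

text \<open>Counting slots rather than edges makes a self-loop contribute both its ends, in
  agreement with the diagonal of \<open>adjacency_matrix\<close>.\<close>

definition edge_count :: "nat \<Rightarrow> nat \<Rightarrow> (nat \<times> nat) set set \<Rightarrow> nat \<Rightarrow> nat \<Rightarrow> real" where
  "edge_count n d M i j = (\<Sum>p\<in>{..<n} \<times> {..<d}. if fst p = i \<and> fst (mate M p) = j then 1 else 0)"

text \<open>Replaces the denominator \<open>n * d - 1\<close> of exact matching probabilities by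
  \<open>n * d\<close> at the price of a factor 2.\<close>

lemma slots_minus_one:
  fixes n d :: nat
  assumes "n * d \<ge> 2"
  shows "0 < real n * real d - 1" "real n * real d \<le> 2 * (real n * real d - 1)"
proof -
  have "real (n * d) \<ge> 2" using assms by (metis of_nat_le_iff of_nat_numeral)
  then have nd: "real n * real d \<ge> 2" by simp
  then show "0 < real n * real d - 1" by linarith
  have "x \<le> 2 * (x - 1)" if "2 \<le> x" for x :: real using that by (simp add: algebra_simps)
  then show "real n * real d \<le> 2 * (real n * real d - 1)" using nd by blast
qed

lemma edge_in_matching:
  assumes M: "M \<in> perfect_matchings S" and e: "e \<in> M" and p: "p \<in> e"
  shows "e = {p, mate M p}" "p \<in> S"
proof -
  show "p \<in> S" using assms by (auto simp: perfect_matchings_def partition_on_def)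
  obtain x y where "e = {x, y}" using assms by (auto simp: perfect_matchings_def card_2_iff)
  then obtain q where "e = {p, q}" using p by auto
  with e \<open>p \<in> S\<close> M show "e = {p, mate M p}" by (metis mate_eqI)
qed

text \<open>For \<open>i \<noteq> j\<close> an edge over \<open>{i, j}\<close> has exactly one end
  in cloud \<open>i\<close>, so slots and edges correspond one to one. For \<open>i = j\<close> the
  slots are the disjoint union of the two-element edges, whence the factor 2.\<close>

lemma adjacency_matrix_edge_count:
  assumes M: "M \<in> perfect_matchings ({..<n} \<times> {..<d})" and ij: "i < n" "j < n"
  shows "adjacency_matrix n (multigraph_of_matching M) $$ (i, j) = edge_count n d M i j"
proof -
  let ?S = "{..<n} \<times> {..<d}"
  have fM: "finite M" using M by (intro finite_elements[of ?S]) (auto simp: perfect_matchings_def)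
  let ?E = "{e \<in> M. fst ` e = {i, j}}" and ?P = "{p \<in> ?S. fst p = i \<and> fst (mate M p) = j}"
  have cnt: "count (multigraph_of_matching M) {i, j} = card ?E"
    using fM by (simp add: multigraph_of_matching_def count_image_mset_eq_card_vimage)
  have ec: "edge_count n d M i j = card ?P"
    by (simp add: edge_count_def sum.If_cases Int_def)
  show ?thesis
  proof (cases "i = j")
    case False
    have "bij_betw (\<lambda>p. {p, mate M p}) ?P ?E"
    proof (rule bij_betwI')
      fix p q assume "p \<in> ?P" "q \<in> ?P"
      then show "({p, mate M p} = {q, mate M q}) = (p = q)" using False by (auto simp: doubleton_eq_iff)
    next
      fix p assume "p \<in> ?P"
      then show "{p, mate M p} \<in> ?E" using mate_edge[OF M, of p] by auto
    next
      fix e assume e: "e \<in> ?E"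
      then have "i \<in> fst ` e" by auto
      then obtain p where p: "p \<in> e" "fst p = i" by auto
      have "e \<in> M" using e by simp
      have "e = {p, mate M p}" "p \<in> ?S" by (rule edge_in_matching[OF M \<open>e \<in> M\<close> p(1)])+
      moreover from this have "fst (mate M p) = j" using e p False by (auto simp: doubleton_eq_iff)
      ultimately show "\<exists>p\<in>?P. e = {p, mate M p}" using p by blast
    qed
    then have "card ?P = card ?E" by (rule bij_betw_same_card)
    then show ?thesis using False ij cnt ec by (simp add: adjacency_matrix_def)
  next
    case True
    have "?P = \<Union>?E"
    proof (intro equalityI subsetI)
      fix p assume p: "p \<in> ?P"
      then have "{p, mate M p} \<in> ?E" using mate_edge[OF M, of p] True by auto
      then show "p \<in> \<Union>?E" by blast
    next
      fix p assume "p \<in> \<Union>?E"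
      then obtain e where e: "e \<in> ?E" "p \<in> e" by blast
      then have "e \<in> M" by simp
      have "e = {p, mate M p}" "p \<in> ?S" by (rule edge_in_matching[OF M \<open>e \<in> M\<close> e(2)])+
      then show "p \<in> ?P" using e True by auto
    qed
    moreover have "card (\<Union>?E) = (\<Sum>e\<in>?E. card e)"
      using M by (intro card_Union_disjoint)
        (auto simp: perfect_matchings_def partition_on_def disjoint_def pairwise_def disjnt_def
          intro: card_ge_0_finite)
    moreover have "(\<Sum>e\<in>?E. card e) = (\<Sum>e\<in>?E. 2)"
      using M by (intro sum.cong) (auto simp: perfect_matchings_def)
    ultimately have "card ?P = 2 * card ?E" by simp
    then show ?thesis using True ij cnt ec by (simp add: adjacency_matrix_def)
  qed
qed

lemma edge_count_nonneg: "0 \<le> edge_count n d M i j"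
  by (auto simp: edge_count_def intro: sum_nonneg)

lemma edge_count_sym:
  assumes M: "M \<in> perfect_matchings ({..<n} \<times> {..<d})"
  shows "edge_count n d M i j = edge_count n d M j i"
  unfolding edge_count_def
  using M by (intro sum.reindex_bij_witness[of _ "mate M" "mate M"]) (auto simp: mate_in mate_mate)

text \<open>The bridge from forms in the adjacency matrix to statistics of the matching: the weight
  of a pair of slots depends only on their vertices.\<close>

lemma sum_edge_count:
  assumes M: "M \<in> perfect_matchings ({..<n} \<times> {..<d})"
  shows "(\<Sum>i<n. \<Sum>j<n. f i j * edge_count n d M i j)
    = edge_stat ({..<n} \<times> {..<d}) (\<lambda>p q. f (fst p) (fst q)) M"
proof -
  let ?S = "{..<n} \<times> {..<d}"
  have "(\<Sum>i<n. \<Sum>j<n. f i j * edge_count n d M i j)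
    = (\<Sum>i<n. \<Sum>j<n. \<Sum>p\<in>?S. if fst p = i \<and> fst (mate M p) = j then f i j else 0)"
    unfolding edge_count_def sum_distrib_left by (intro sum.cong refl) auto
  also have "\<dots> = (\<Sum>p\<in>?S. \<Sum>i<n. \<Sum>j<n. if fst p = i \<and> fst (mate M p) = j then f i j else 0)"
    by (subst sum.swap[of _ ?S], subst sum.swap[of _ ?S], rule refl)
  also have "\<dots> = (\<Sum>p\<in>?S. f (fst p) (fst (mate M p)))"
  proof (rule sum.cong[OF refl])
    fix p assume p: "p \<in> ?S"
    then have "mate M p \<in> ?S" by (rule mate_in[OF M])
    have "(\<Sum>i<n. \<Sum>j<n. if fst p = i \<and> fst (mate M p) = j then f i j else 0)
      = (\<Sum>i<n. if fst p = i then (\<Sum>j<n. if fst (mate M p) = j then f i j else 0) else 0)"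
      by (intro sum.cong refl) auto
    then show "(\<Sum>i<n. \<Sum>j<n. if fst p = i \<and> fst (mate M p) = j then f i j else 0) = f (fst p) (fst (mate M p))"
      using p \<open>mate M p \<in> ?S\<close> by auto
  qed
  finally show ?thesis by (simp add: edge_stat_def)
qed

lemma edge_count_row_sum:
  assumes M: "M \<in> perfect_matchings ({..<n} \<times> {..<d})" and "i < n"
  shows "(\<Sum>j<n. edge_count n d M i j) = d"
proof -
  let ?S = "{..<n} \<times> {..<d}"
  have "(\<Sum>j<n. edge_count n d M i j) = (\<Sum>k<n. \<Sum>j<n. (if k = i then 1 else 0) * edge_count n d M k j)"
  proof -
    have "(\<Sum>k<n. \<Sum>j<n. (if k = i then 1 else 0) * edge_count n d M k j)
       = (\<Sum>k<n. if k = i then \<Sum>j<n. edge_count n d M k j else 0)" by (intro sum.cong) auto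
    then show ?thesis using assms(2) by simp
  qed
  also have "\<dots> = (\<Sum>p\<in>?S. if fst p = i then 1 else 0)"
    using sum_edge_count[OF M, of "\<lambda>k j. if k = i then 1 else 0"] by (simp add: edge_stat_def)
  also have "\<dots> = card {p \<in> ?S. fst p = i}" by (simp add: sum.If_cases Int_def)
  also have "{p \<in> ?S. fst p = i} = {i} \<times> {..<d}" using assms(2) by auto
  finally show ?thesis by simp
qed

text \<open>There are \<open>d\<^sup>2\<close> pairs of slots over each \<open>(i, j)\<close>; the
  subtracted term removes the pairs of a slot with itself.\<close>

lemma edge_mean_slots:
  fixes f :: "nat \<Rightarrow> nat \<Rightarrow> real"
  assumes "n * d \<ge> 2"
  shows "edge_mean ({..<n} \<times> {..<d}) (\<lambda>p q. f (fst p) (fst q))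
    = (real d ^ 2 * (\<Sum>i<n. \<Sum>j<n. f i j) - real d * (\<Sum>i<n. f i i)) / (real n * real d - 1)"
proof -
  let ?S = "{..<n} \<times> {..<d}"
  have S: "(\<Sum>p\<in>?S. g (fst p)) = real d * (\<Sum>i<n. g i)" for g :: "nat \<Rightarrow> real"
  proof -
    have "(\<Sum>p\<in>?S. g (fst p)) = (\<Sum>(i, a)\<in>?S. g i)" by (simp add: case_prod_beta)
    also have "\<dots> = (\<Sum>i<n. \<Sum>a<d. g i)" by (rule sum.cartesian_product[symmetric])
    finally show ?thesis by (simp add: sum_distrib_left)
  qed
  have "(\<Sum>p\<in>?S. \<Sum>q\<in>?S - {p}. f (fst p) (fst q)) = (\<Sum>p\<in>?S. (\<Sum>q\<in>?S. f (fst p) (fst q)) - f (fst p) (fst p))"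
    by (intro sum.cong refl) (simp add: sum_diff1)
  also have "\<dots> = (\<Sum>p\<in>?S. (real d * (\<Sum>j<n. f (fst p) j)) - f (fst p) (fst p))"
    by (simp only: S)
  also have "\<dots> = real d * (\<Sum>i<n. real d * (\<Sum>j<n. f i j) - f i i)" by (rule S)
  finally show ?thesis
    by (simp add: edge_mean_def sum_subtractf card_slot power2_eq_square algebra_simps sum_distrib_left)
qed

section \<open>Eigenvalues and bilinear forms\<close>

lemma eigenvalue_real_symmetric:
  fixes A :: "real mat"
  assumes A: "A \<in> carrier_mat n n" and sym: "\<And>i j. i < n \<Longrightarrow> j < n \<Longrightarrow> A $$ (i, j) = A $$ (j, i)"
    and ev: "eigenvalue (map_mat complex_of_real A) a"
  shows "Im a = 0"
proof -
  let ?A = "map_mat complex_of_real A"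
  obtain v where v: "v \<in> carrier_vec n" "v \<noteq> 0\<^sub>v n" "?A *\<^sub>v v = a \<cdot>\<^sub>v v"
    using ev A by (auto simp: eigenvalue_def eigenvector_def)
  define q where "q = (\<Sum>i<n. \<Sum>j<n. cnj (v $ i) * of_real (A $$ (i, j)) * v $ j)"
  define r where "r = (\<Sum>i<n. (cmod (v $ i))\<^sup>2)"
  have row: "(\<Sum>j<n. of_real (A $$ (i, j)) * v $ j) = a * v $ i" if "i < n" for i
  proof -
    have "(?A *\<^sub>v v) $ i = (\<Sum>j<n. of_real (A $$ (i, j)) * v $ j)"
      using that A v(1) by (auto simp: scalar_prod_def lessThan_atLeast0)
    then show ?thesis using v that by simp
  qed
  have "q = (\<Sum>i<n. cnj (v $ i) * (\<Sum>j<n. of_real (A $$ (i, j)) * v $ j))"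
    unfolding q_def by (simp add: sum_distrib_left mult.assoc)
  also have "\<dots> = (\<Sum>i<n. a * (of_real ((cmod (v $ i))\<^sup>2)))"
  proof (intro sum.cong refl)
    fix i assume "i \<in> {..<n}"
    then have "cnj (v $ i) * (\<Sum>j<n. of_real (A $$ (i, j)) * v $ j) = cnj (v $ i) * (a * v $ i)"
      using row by simp
    also have "\<dots> = a * of_real ((cmod (v $ i))\<^sup>2)" by (simp only: complex_norm_square mult_ac)
    finally show "cnj (v $ i) * (\<Sum>j<n. of_real (A $$ (i, j)) * v $ j) = a * of_real ((cmod (v $ i))\<^sup>2)" .
  qed
  finally have q: "q = a * of_real r" by (simp add: r_def sum_distrib_left)
  have "cnj q = (\<Sum>i<n. \<Sum>j<n. v $ i * of_real (A $$ (i, j)) * cnj (v $ j))"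
    unfolding q_def by (simp add: cnj_sum)
  also have "\<dots> = (\<Sum>j<n. \<Sum>i<n. v $ i * of_real (A $$ (i, j)) * cnj (v $ j))" by (rule sum.swap)
  also have "\<dots> = q" unfolding q_def by (intro sum.cong refl) (simp add: sym mult_ac)
  finally have "Im q = 0" by (simp add: complex_eq_iff)
  moreover have "r \<noteq> 0"
  proof
    assume "r = 0"
    then have "\<forall>i\<in>{..<n}. (cmod (v $ i))\<^sup>2 = 0"
      unfolding r_def by (subst (asm) sum_nonneg_eq_0_iff) auto
    then have "v = 0\<^sub>v n" using v(1) by (intro eq_vecI) auto
    with v(2) show False by simp
  qed
  ultimately show ?thesis using q by simp
qed

text \<open>All complex roots are real, and two real polynomials that agree at every real point are
  equal. This guarantees \<open>n\<close> real roots, so that \<open>nth_eigenvalue A n\<close> is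
  the smallest eigenvalue.\<close>

lemma char_poly_real_symmetric:
  fixes A :: "real mat"
  assumes A: "A \<in> carrier_mat n n" and sym: "\<And>i j. i < n \<Longrightarrow> j < n \<Longrightarrow> A $$ (i, j) = A $$ (j, i)"
  shows "\<exists>bs. char_poly A = (\<Prod>b\<leftarrow>bs. [:- b, 1:]) \<and> length bs = n"
proof -
  let ?A = "map_mat complex_of_real A"
  have cA: "?A \<in> carrier_mat n n" using A by simp
  obtain as where as: "char_poly ?A = (\<Prod>a\<leftarrow>as. [:- a, 1:])" "length as = n"
    using char_poly_factorized[OF cA] by blast
  have im: "of_real (Re a) = a" if "a \<in> set as" for a
  proof -
    have "poly (char_poly ?A) a = 0"
      using that unfolding as(1) by (simp add: poly_prod_list o_def prod_list_zero_iff)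
    then have "eigenvalue ?A a" using eigenvalue_root_char_poly[OF cA] by simp
    from eigenvalue_real_symmetric[OF A sym this] show ?thesis by (simp add: complex_eq_iff)
  qed
  have "poly (char_poly A) x = poly (\<Prod>b\<leftarrow>map Re as. [:- b, 1:]) x" for x
  proof -
    have "complex_of_real (poly (char_poly A) x) = poly (char_poly ?A) (of_real x)"
      unfolding of_real_hom.char_poly_hom[OF A] by simp
    also have "\<dots> = (\<Prod>a\<leftarrow>as. of_real x - a)" unfolding as(1) by (simp add: poly_prod_list o_def)
    also have "\<dots> = (\<Prod>a\<leftarrow>as. of_real (x - Re a))"
      by (rule arg_cong[of _ _ prod_list], rule map_cong) (auto simp: im)
    also have "\<dots> = of_real (\<Prod>a\<leftarrow>as. x - Re a)" by (induction as) auto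
    also have "(\<Prod>a\<leftarrow>as. x - Re a) = poly (\<Prod>b\<leftarrow>map Re as. [:- b, 1:]) x"
      by (simp add: poly_prod_list o_def)
    finally show ?thesis by (simp only: of_real_eq_iff)
  qed
  then have "char_poly A = (\<Prod>b\<leftarrow>map Re as. [:- b, 1:])" by (simp only: flip: poly_eq_poly_eq_iff) auto
  then show ?thesis using as(2) by (intro exI[of _ "map Re as"]) auto
qed

text \<open>Conjugating by the matrix whose columns are the all-ones vector and the unit vectors
  \<open>e\<^sub>1, \<dots>, e\<^sub>m\<close> splits off the eigenvalue of the all-ones vector.\<close>

lemma char_poly_constant_row_sum:
  fixes A :: "real mat"
  assumes A: "A \<in> carrier_mat (Suc m) (Suc m)" and row: "\<And>i. i < Suc m \<Longrightarrow> (\<Sum>j<Suc m. A $$ (i, j)) = s"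
  shows "char_poly A = [:- s, 1:] * char_poly (mat m m (\<lambda>(i, j). A $$ (Suc i, Suc j) - A $$ (0, Suc j)))"
proof -
  let ?n = "Suc m"
  define P where "P = mat ?n ?n (\<lambda>(i, k). if k = 0 \<or> k = i then 1 else (0::real))"
  define Q where "Q = mat ?n ?n (\<lambda>(i, k). if k = i then 1 else if k = 0 then - 1 else (0::real))"
  define C where "C = four_block_mat (mat 1 1 (\<lambda>_. s)) (mat 1 m (\<lambda>(i, j). A $$ (0, Suc j)))
    (0\<^sub>m m 1) (mat m m (\<lambda>(i, j). A $$ (Suc i, Suc j) - A $$ (0, Suc j)))"
  have car: "P \<in> carrier_mat ?n ?n" "Q \<in> carrier_mat ?n ?n" "C \<in> carrier_mat ?n ?n"
    by (auto simp: P_def Q_def C_def)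
  have Psum: "(\<Sum>k<?n. (if k = 0 \<or> k = i then 1 else 0) * g k) = g 0 + (if i = 0 then 0 else g i)"
    if "i < ?n" for g :: "nat \<Rightarrow> real" and i
  proof -
    have "(\<Sum>k<?n. (if k = 0 \<or> k = i then 1 else 0) * g k) = (\<Sum>k\<in>{0, i}. g k)"
      using that by (intro sum.mono_neutral_cong_right) auto
    then show ?thesis by auto
  qed
  \<comment> \<open>Left multiplication by \<open>P\<close> adds row 0 to every other row; this
    verifies both \<open>P * Q = 1\<close> and \<open>A * P = P * C\<close> entrywise.\<close>
  have PX: "(P * X) $$ (i, j) = X $$ (0, j) + (if i = 0 then 0 else X $$ (i, j))"
    if "X \<in> carrier_mat ?n ?n" "i < ?n" "j < ?n" for X i j
  proof -
    have "(P * X) $$ (i, j) = (\<Sum>k<?n. (if k = 0 \<or> k = i then 1 else 0) * X $$ (k, j))"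
      using that car by (auto simp: scalar_prod_def P_def lessThan_atLeast0)
    then show ?thesis by (simp only: Psum[OF that(2)])
  qed
  have PQ: "P * Q = 1\<^sub>m ?n"
  proof (rule eq_matI)
    fix i j assume "i < dim_row (1\<^sub>m ?n :: real mat)" "j < dim_col (1\<^sub>m ?n :: real mat)"
    then show "(P * Q) $$ (i, j) = 1\<^sub>m ?n $$ (i, j)"
      by (simp add: PX[OF car(2)]) (auto simp: Q_def)
  qed (use car in auto)
  have QP: "Q * P = 1\<^sub>m ?n" by (rule mat_mult_left_right_inverse[OF car(1,2) PQ])
  have AP: "A * P = P * C"
  proof (rule eq_matI)
    fix i j assume "i < dim_row (P * C)" "j < dim_col (P * C)"
    then have ij: "i < ?n" "j < ?n" using car by auto
    have "(A * P) $$ (i, j) = (\<Sum>k<?n. A $$ (i, k) * (if j = 0 \<or> j = k then 1 else 0))"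
      using ij A car by (auto simp: scalar_prod_def P_def lessThan_atLeast0)
    also have "\<dots> = (if j = 0 then s else A $$ (i, j))"
    proof (cases "j = 0")
      case True
      then show ?thesis using row[OF ij(1)] by simp
    next
      case False
      then have "(\<Sum>k<?n. A $$ (i, k) * (if j = 0 \<or> j = k then 1 else 0)) = (\<Sum>k\<in>{j}. A $$ (i, k))"
        using ij by (intro sum.mono_neutral_cong_right) auto
      then show ?thesis using False by simp
    qed
    also have "\<dots> = (P * C) $$ (i, j)"
      unfolding PX[OF car(3) ij] using ij by (cases i; cases j) (auto simp: C_def)
    finally show "(A * P) $$ (i, j) = (P * C) $$ (i, j)" .
  qed (use A car in auto)
  have "A = A * (P * Q)" using A PQ by simp
  also have "\<dots> = P * C * Q" using A car AP by (simp flip: assoc_mult_mat[OF A car(1,2)])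
  finally have "A = P * C * Q" .
  then have "similar_mat A C"
    unfolding similar_mat_def similar_mat_wit_def Let_def using A car PQ QP
    by (intro exI[of _ P] exI[of _ Q]) auto
  then have "char_poly A = char_poly C" by (rule char_poly_similar)
  also have "\<dots> = char_poly (mat 1 1 (\<lambda>_. s)) * char_poly (mat m m (\<lambda>(i, j). A $$ (Suc i, Suc j) - A $$ (0, Suc j)))"
    unfolding C_def by (rule char_poly_four_block_zeros_col) auto
  also have "char_poly (mat 1 1 (\<lambda>_. s)) = [:- s, 1:]"
    by (subst char_poly_upper_triangular[of _ 1]) (auto simp: diag_mat_def)
  finally show ?thesis .
qed

lemma abs_eigenvalue_le:
  fixes A :: "real mat"
  assumes A: "A \<in> carrier_mat n n" and ev: "eigenvalue A r"
    and bound: "\<And>x y. (\<Sum>i<n. (x i)\<^sup>2) \<le> 1 \<Longrightarrow> (\<Sum>i<n. (y i)\<^sup>2) \<le> 1 \<Longrightarrow>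
      \<bar>\<Sum>i<n. \<Sum>j<n. x i * A $$ (i, j) * y j\<bar> \<le> t"
  shows "\<bar>r\<bar> \<le> t"
proof -
  obtain v where v: "v \<in> carrier_vec n" "v \<noteq> 0\<^sub>v n" "A *\<^sub>v v = r \<cdot>\<^sub>v v"
    using ev A by (auto simp: eigenvalue_def eigenvector_def)
  define q where "q = (\<Sum>i<n. (v $ i)\<^sup>2)"
  have "q \<noteq> 0"
  proof
    assume "q = 0"
    then have "\<forall>i\<in>{..<n}. (v $ i)\<^sup>2 = 0" unfolding q_def by (subst (asm) sum_nonneg_eq_0_iff) auto
    then have "v = 0\<^sub>v n" using v(1) by (intro eq_vecI) auto
    with v(2) show False by simp
  qed
  moreover have "q \<ge> 0" unfolding q_def by (intro sum_nonneg) auto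
  ultimately have q: "q > 0" by simp
  define x where "x = (\<lambda>i. v $ i / sqrt q)"
  have x: "(\<Sum>i<n. (x i)\<^sup>2) = 1"
    using q by (simp add: x_def power_divide q_def flip: sum_divide_distrib)
  have row: "(\<Sum>j<n. A $$ (i, j) * v $ j) = r * v $ i" if "i < n" for i
  proof -
    have "(A *\<^sub>v v) $ i = (\<Sum>j<n. A $$ (i, j) * v $ j)"
      using that A v(1) by (auto simp: scalar_prod_def lessThan_atLeast0)
    then show ?thesis using v that by simp
  qed
  have "(\<Sum>i<n. \<Sum>j<n. x i * A $$ (i, j) * x j) = (\<Sum>i<n. x i * (\<Sum>j<n. A $$ (i, j) * v $ j) / sqrt q)"
    by (simp add: x_def sum_distrib_left sum_divide_distrib mult_ac)
  also have "\<dots> = (\<Sum>i<n. r * (x i)\<^sup>2)"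
    by (intro sum.cong refl) (simp add: row x_def power2_eq_square)
  also have "\<dots> = r" using x by (simp flip: sum_distrib_left)
  finally show ?thesis using bound[of x x] x by simp
qed

text \<open>Only the single copy of \<open>s\<close> can exceed \<open>t\<close>, so the second
  largest entry cannot. The last entry lies in \<open>R\<close> or equals \<open>s\<close>, and
  \<open>s \<ge> 0\<close> settles the latter case.\<close>

lemma second_nth_rev_sorted_le:
  fixes M R :: "real multiset"
  assumes M: "M = add_mset s R" and n: "size M = n" "n \<ge> 2" and R: "\<And>r. r \<in># R \<Longrightarrow> \<bar>r\<bar> \<le> t"
    and s: "s \<ge> 0" "t \<ge> 0"
  shows "max (rev (sorted_list_of_multiset M) ! 1) (- (rev (sorted_list_of_multiset M) ! (n - 1))) \<le> t"
proof -
  define L where "L = rev (sorted_list_of_multiset M)"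
  have mL: "mset L = M" by (simp add: L_def)
  then have lL: "length L = n" using n by (metis size_mset)
  have srt: "sorted (rev L)" by (simp add: L_def)
  have "L ! 1 \<le> t"
  proof (rule ccontr)
    assume c: "\<not> L ! 1 \<le> t"
    obtain a b L' where L: "L = a # b # L'" using lL n by (metis One_nat_def Suc_le_length_iff numeral_2_eq_2)
    then have "b \<le> a" using srt by (auto simp: sorted_append)
    with c have ab: "t < a" "t < b" by (auto simp: L)
    have "size (filter_mset (\<lambda>x. t < x) (mset L)) \<le> 1 + size (filter_mset (\<lambda>x. t < x) R)"
      by (simp add: mL M)
    also have "filter_mset (\<lambda>x. t < x) R = filter_mset (\<lambda>_. False) R"
      using R by (intro filter_mset_cong) force+
    finally have "size (filter_mset (\<lambda>x. t < x) (mset L)) \<le> 1" by simp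
    then show False using ab by (simp add: L)
  qed
  moreover have "L ! (n - 1) \<in> set L" using lL n by simp
  then have "L ! (n - 1) \<in># add_mset s R" using mL M by (metis set_mset_mset)
  then have "- (L ! (n - 1)) \<le> t" using R[of "L ! (n - 1)"] s by auto
  ultimately show ?thesis by (simp add: L_def)
qed

text \<open>Subtracting \<open>s / n\<close> from every entry leaves differences of rows unchanged,
  so \<open>A\<close> and \<open>B\<close> deflate to the same matrix \<open>R\<close>, with linear
  factors \<open>[:- s, 1:]\<close> and \<open>[:0, 1:]\<close>. Thus all eigenvalues of
  \<open>A\<close> but one copy of \<open>s\<close> are eigenvalues of \<open>B\<close>, which the
  bilinear form bounds.\<close>

lemma nth_eigenvalue_le:
  fixes A :: "real mat"
  assumes A: "A \<in> carrier_mat n n" and n: "n \<ge> 2"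
    and sym: "\<And>i j. i < n \<Longrightarrow> j < n \<Longrightarrow> A $$ (i, j) = A $$ (j, i)"
    and row: "\<And>i. i < n \<Longrightarrow> (\<Sum>j<n. A $$ (i, j)) = s" and s: "s \<ge> 0"
    and bound: "\<And>x y. (\<Sum>i<n. (x i)\<^sup>2) \<le> 1 \<Longrightarrow> (\<Sum>i<n. (y i)\<^sup>2) \<le> 1 \<Longrightarrow>
      \<bar>\<Sum>i<n. \<Sum>j<n. x i * (A $$ (i, j) - s / n) * y j\<bar> \<le> t"
  shows "max (nth_eigenvalue A 2) (- nth_eigenvalue A n) \<le> t"
proof -
  obtain m where m: "n = Suc m" using n by (cases n) auto
  define B where "B = mat n n (\<lambda>(i, j). A $$ (i, j) - s / n)"
  have B: "B \<in> carrier_mat n n" by (simp add: B_def)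
  define R where "R = mat m m (\<lambda>(i, j). A $$ (Suc i, Suc j) - A $$ (0, Suc j))"
  have "t \<ge> 0" using bound[of "\<lambda>_. 0" "\<lambda>_. 0"] by simp
  have charA: "char_poly A = [:- s, 1:] * char_poly R"
    unfolding R_def using char_poly_constant_row_sum[of A m s] A row by (simp add: m)
  have "mat m m (\<lambda>(i, j). B $$ (Suc i, Suc j) - B $$ (0, Suc j)) = R"
    by (rule eq_matI) (auto simp: R_def B_def m)
  moreover have "(\<Sum>j<n. B $$ (i, j)) = 0" if "i < n" for i
  proof -
    have "(\<Sum>j<n. B $$ (i, j)) = (\<Sum>j<n. A $$ (i, j) - s / n)"
      using that by (intro sum.cong) (auto simp: B_def)
    then show ?thesis using row[OF that] n by (simp add: sum_subtractf)
  qed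
  ultimately have charB: "char_poly B = [:- 0, 1:] * char_poly R"
    using char_poly_constant_row_sum[of B m 0] B by (simp add: m)
  obtain bs where bs: "char_poly A = (\<Prod>b\<leftarrow>bs. [:- b, 1:])" "length bs = n"
    using char_poly_real_symmetric[OF A sym] by blast
  have nz: "char_poly A \<noteq> 0" using degree_monic_char_poly[OF A] n by auto
  then have "char_poly R \<noteq> 0" using charA by auto
  then have proots: "proots (char_poly A) = add_mset s (proots (char_poly R))"
    unfolding charA by (subst proots_mult) auto
  have "proots (\<Prod>b\<leftarrow>bs. [:- b, 1:]) = mset bs"
    by (induction bs) (auto simp: proots_mult prod_list_zero_iff image_iff simp del: mult_pCons_left)
  then have size: "size (proots (char_poly A)) = n" using bs by simp
  have small: "\<bar>r\<bar> \<le> t" if "r \<in># proots (char_poly R)" for r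
  proof (rule abs_eigenvalue_le[OF B])
    have "poly (char_poly R) r = 0" using that \<open>char_poly R \<noteq> 0\<close> by simp
    then have "poly (char_poly B) r = 0" by (simp add: charB)
    then show "eigenvalue B r" using eigenvalue_root_char_poly[OF B] by simp
    fix x y :: "nat \<Rightarrow> real" assume xy: "(\<Sum>i<n. (x i)\<^sup>2) \<le> 1" "(\<Sum>i<n. (y i)\<^sup>2) \<le> 1"
    have "(\<Sum>i<n. \<Sum>j<n. x i * B $$ (i, j) * y j) = (\<Sum>i<n. \<Sum>j<n. x i * (A $$ (i, j) - s / n) * y j)"
      by (intro sum.cong refl) (simp add: B_def)
    then show "\<bar>\<Sum>i<n. \<Sum>j<n. x i * B $$ (i, j) * y j\<bar> \<le> t" using bound[OF xy] by simp
  qed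
  show ?thesis
    using second_nth_rev_sorted_le[OF proots size n small s \<open>t \<ge> 0\<close>] by (simp add: nth_eigenvalue_def)
qed

section \<open>A net of the unit ball\<close>

text \<open>An integer vector \<open>k\<close> stands for the point \<open>k / (4 * sqrt n)\<close>
  of the unit ball; the extensional function space makes the set finite.\<close>

definition net :: "nat \<Rightarrow> (nat \<Rightarrow> int) set" where
  "net n = {k \<in> {..<n} \<rightarrow>\<^sub>E UNIV. (\<Sum>i<n. (k i)\<^sup>2) \<le> 16 * int n}"

lemma sum_half_powers_abs_le: "(\<Sum>k\<in>{- int m..int m}. (1 / 2 :: real) ^ nat \<bar>k\<bar>) \<le> 3"
proof -
  have "(\<Sum>k\<in>{- int m..int m}. (1 / 2 :: real) ^ nat \<bar>k\<bar>) = 3 - 2 * (1 / 2) ^ m"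
  proof (induction m)
    case (Suc m)
    have "{- int (Suc m)..int (Suc m)} = insert (int (Suc m)) (insert (- int (Suc m)) {- int m..int m})" by auto
    then have "(\<Sum>k\<in>{- int (Suc m)..int (Suc m)}. (1 / 2 :: real) ^ nat \<bar>k\<bar>)
      = 2 * (1 / 2) ^ Suc m + (\<Sum>k\<in>{- int m..int m}. (1 / 2 :: real) ^ nat \<bar>k\<bar>)"
      by (simp add: nat_add_distrib)
    then show ?case unfolding Suc.IH by simp
  qed simp
  then show ?thesis by simp
qed

lemma net_abs_le:
  assumes "k \<in> net n"
  shows "(\<Sum>i<n. nat \<bar>k i\<bar>) \<le> 16 * n" and "i < n \<Longrightarrow> \<bar>k i\<bar> \<le> int (16 * n)"
proof -
  have "int (\<Sum>i<n. nat \<bar>k i\<bar>) = (\<Sum>i<n. \<bar>k i\<bar>)" by simp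
  also have "\<dots> \<le> (\<Sum>i<n. (k i)\<^sup>2)"
  proof (rule sum_mono)
    fix i
    have "\<bar>x\<bar> \<le> x\<^sup>2" for x :: int
    proof (cases "x = 0")
      case False
      then have "\<bar>x\<bar> * 1 \<le> \<bar>x\<bar> * \<bar>x\<bar>" by (intro mult_left_mono) auto
      then show ?thesis by (simp add: power2_eq_square)
    qed simp
    then show "\<bar>k i\<bar> \<le> (k i)\<^sup>2" .
  qed
  also have "\<dots> \<le> 16 * int n" using assms by (simp add: net_def)
  finally show 1: "(\<Sum>i<n. nat \<bar>k i\<bar>) \<le> 16 * n" by linarith
  assume "i < n"
  then have "nat \<bar>k i\<bar> \<le> (\<Sum>i<n. nat \<bar>k i\<bar>)" by (intro member_le_sum) auto
  with 1 show "\<bar>k i\<bar> \<le> int (16 * n)" by linarith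
qed

lemma net_subset_box: "net n \<subseteq> {..<n} \<rightarrow>\<^sub>E {- int (16 * n)..int (16 * n)}"
proof
  fix k assume k: "k \<in> net n"
  then have "k \<in> {..<n} \<rightarrow>\<^sub>E UNIV" by (simp add: net_def)
  with net_abs_le(2)[OF k] show "k \<in> {..<n} \<rightarrow>\<^sub>E {- int (16 * n)..int (16 * n)}"
    by (auto simp: PiE_iff abs_le_iff minus_le_iff)
qed

lemma finite_net: "finite (net n)"
  by (rule finite_subset[OF net_subset_box]) (intro finite_PiE; simp)

text \<open>A generating-function count: the absolute values of a net point sum to at most
  \<open>16 * n\<close>, so \<open>2 ^ (16 * n)\<close> times the product of the
  \<open>(1 / 2) ^ nat \<bar>k i\<bar>\<close> is at least 1. Over the whole box these weights
  factor into \<open>n\<close> sums, each at most 4.\<close>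

lemma card_net_le: "real (card (net n)) \<le> 2 ^ (18 * n)"
proof -
  let ?B = "{- int (16 * n)..int (16 * n)}"
  have "real (card (net n)) = (\<Sum>k\<in>net n. 1)" by simp
  also have "\<dots> \<le> (\<Sum>k\<in>net n. 2 ^ (16 * n) * (\<Prod>i<n. (1 / 2) ^ nat \<bar>k i\<bar>))"
  proof (rule sum_mono)
    fix k assume "k \<in> net n"
    then have "(2::real) ^ (\<Sum>i<n. nat \<bar>k i\<bar>) \<le> 2 ^ (16 * n)" by (intro power_increasing net_abs_le) auto
    moreover have "(\<Prod>i<n. (1 / 2 :: real) ^ nat \<bar>k i\<bar>) = 1 / 2 ^ (\<Sum>i<n. nat \<bar>k i\<bar>)"
      by (simp add: power_one_over prod_dividef power_sum)
    ultimately show "1 \<le> 2 ^ (16 * n) * (\<Prod>i<n. (1 / 2 :: real) ^ nat \<bar>k i\<bar>)"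
      by (simp only: le_divide_eq_1_pos mult_1_right times_divide_eq_right zero_less_power zero_less_numeral)
  qed
  also have "\<dots> \<le> (\<Sum>k\<in>{..<n} \<rightarrow>\<^sub>E ?B. 2 ^ (16 * n) * (\<Prod>i<n. (1 / 2) ^ nat \<bar>k i\<bar>))"
  proof (rule sum_mono2)
    show "finite ({..<n} \<rightarrow>\<^sub>E ?B)" by (intro finite_PiE) auto
    show "net n \<subseteq> {..<n} \<rightarrow>\<^sub>E ?B" by (rule net_subset_box)
  qed (intro mult_nonneg_nonneg prod_nonneg zero_le_power ballI; simp)
  also have "\<dots> = 2 ^ (16 * n) * (\<Prod>i<n. \<Sum>k\<in>?B. (1 / 2) ^ nat \<bar>k\<bar>)"
  proof -
    have "(\<Prod>i<n. \<Sum>k\<in>?B. (1 / 2 :: real) ^ nat \<bar>k\<bar>) = (\<Sum>k\<in>{..<n} \<rightarrow>\<^sub>E ?B. \<Prod>i<n. (1 / 2) ^ nat \<bar>k i\<bar>)"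
      by (rule prod_sum_PiE) auto
    then show ?thesis by (simp only: sum_distrib_left)
  qed
  also have "\<dots> \<le> 2 ^ (16 * n) * (\<Prod>i<n. 4)"
  proof (intro mult_left_mono prod_mono conjI)
    show "(\<Sum>k\<in>?B. (1 / 2 :: real) ^ nat \<bar>k\<bar>) \<le> 4" using sum_half_powers_abs_le[of "16 * n"] by simp
  qed (auto intro: sum_nonneg)
  also have "(\<Prod>i<n. 4 :: real) = 2 ^ (2 * n)" by (simp add: power_mult)
  also have "2 ^ (16 * n) * 2 ^ (2 * n) = (2 :: real) ^ (18 * n)" by (simp flip: power_add)
  finally show ?thesis .
qed

section \<open>Bilinear forms and their reduction to the net\<close>

definition bilin :: "nat \<Rightarrow> (nat \<Rightarrow> nat \<Rightarrow> real) \<Rightarrow> (nat \<Rightarrow> real) \<Rightarrow> (nat \<Rightarrow> real) \<Rightarrow> real" where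
  "bilin n B x y = (\<Sum>i<n. \<Sum>j<n. x i * B i j * y j)"

lemma bilin_diff_left: "bilin n B (\<lambda>i. x i - x' i) y = bilin n B x y - bilin n B x' y"
  by (simp add: bilin_def algebra_simps sum_subtractf)

lemma bilin_diff_right: "bilin n B x (\<lambda>i. y i - y' i) = bilin n B x y - bilin n B x y'"
  by (simp add: bilin_def algebra_simps sum_subtractf)

lemma bilin_scale: "bilin n B (\<lambda>i. a * x i) (\<lambda>i. b * y i) = a * b * bilin n B x y"
  by (simp add: bilin_def sum_distrib_left mult_ac)

lemma bilin_bounded:
  assumes "(\<Sum>i<n. (x i)\<^sup>2) \<le> 1" "(\<Sum>i<n. (y i)\<^sup>2) \<le> 1"
  shows "\<bar>bilin n B x y\<bar> \<le> (\<Sum>i<n. \<Sum>j<n. \<bar>B i j\<bar>)"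
proof -
  have le1: "\<bar>z i\<bar> \<le> 1" if "(\<Sum>i<n. (z i)\<^sup>2) \<le> 1" "i < n" for z :: "nat \<Rightarrow> real" and i
  proof -
    have "(z i)\<^sup>2 \<le> (\<Sum>i<n. (z i)\<^sup>2)" using that by (intro member_le_sum) auto
    then show ?thesis using that by (simp flip: abs_square_le_1)
  qed
  have "\<bar>bilin n B x y\<bar> \<le> (\<Sum>i<n. \<Sum>j<n. \<bar>x i * B i j * y j\<bar>)"
    unfolding bilin_def by (rule order_trans[OF sum_abs]) (intro sum_mono sum_abs)
  also have "\<dots> \<le> (\<Sum>i<n. \<Sum>j<n. \<bar>B i j\<bar>)"
  proof (intro sum_mono)
    fix i j assume "i \<in> {..<n}" "j \<in> {..<n}"
    then have "\<bar>x i\<bar> * \<bar>B i j\<bar> * \<bar>y j\<bar> \<le> 1 * \<bar>B i j\<bar> * 1"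
      using le1 assms by (intro mult_mono) auto
    then show "\<bar>x i * B i j * y j\<bar> \<le> \<bar>B i j\<bar>" by (simp add: abs_mult)
  qed
  finally show ?thesis .
qed

text \<open>Rounding towards zero keeps a vector inside the unit ball, which is why lattice points of the
  ball itself suffice.\<close>

lemma net_approximation:
  assumes n: "n \<ge> 1" and x: "(\<Sum>i<n. (x i)\<^sup>2) \<le> 1"
  obtains k where "k \<in> net n" "(\<Sum>i<n. (4 * (x i - k i / (4 * sqrt n)))\<^sup>2) \<le> 1"
proof -
  define c where "c = 4 * sqrt (real n)"
  have c: "c > 0" "c\<^sup>2 = 16 * n" using n by (auto simp: c_def power_mult_distrib)
  define r where "r = (\<lambda>t::real. if t \<ge> 0 then \<lfloor>t\<rfloor> else \<lceil>t\<rceil>)"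
  have r: "\<bar>of_int (r t)\<bar> \<le> \<bar>t\<bar>" "\<bar>t - of_int (r t)\<bar> \<le> 1" for t
    unfolding r_def by (simp_all split: if_splits; linarith)+
  define k where "k = (\<lambda>i\<in>{..<n}. r (c * x i))"
  have k: "k \<in> net n"
  proof -
    have "real_of_int (\<Sum>i<n. (k i)\<^sup>2) = (\<Sum>i<n. (of_int (r (c * x i)))\<^sup>2)" by (simp add: k_def)
    also have "\<dots> \<le> (\<Sum>i<n. (c * x i)\<^sup>2)" by (intro sum_mono) (simp add: abs_le_square_iff[symmetric] r)
    also have "\<dots> = 16 * n * (\<Sum>i<n. (x i)\<^sup>2)" by (simp add: power_mult_distrib c sum_distrib_left)
    also have "\<dots> \<le> 16 * real n * 1" using mult_left_mono[OF x, of "16 * real n"] by simp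
    finally have "real_of_int (\<Sum>i<n. (k i)\<^sup>2) \<le> real_of_int (16 * int n)" by simp
    then have "(\<Sum>i<n. (k i)\<^sup>2) \<le> 16 * int n" by (simp only: of_int_le_iff)
    then show ?thesis by (simp add: net_def k_def)
  qed
  \<comment> \<open>Rounding moves each scaled coordinate by at most 1, so the squared distance is
    at most \<open>n / c\<^sup>2\<close>, which is 1/16.\<close>
  have "(\<Sum>i<n. (4 * (x i - k i / c))\<^sup>2) \<le> (\<Sum>i<n. 1 / n)"
  proof (rule sum_mono)
    fix i assume "i \<in> {..<n}"
    then have eq: "4 * (x i - k i / c) = 4 / c * (c * x i - of_int (r (c * x i)))"
      using c by (simp add: k_def field_simps)
    have "(4 * (x i - k i / c))\<^sup>2 = 16 / c\<^sup>2 * (c * x i - of_int (r (c * x i)))\<^sup>2"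
      by (simp only: eq power_mult_distrib power_divide) simp
    also have "\<dots> \<le> 16 / c\<^sup>2 * 1"
      using r(2)[of "c * x i"] by (intro mult_left_mono) (auto simp: abs_square_le_1)
    finally show "(4 * (x i - k i / c))\<^sup>2 \<le> 1 / n" by (simp add: c)
  qed
  also have "\<dots> = 1" using n by simp
  finally show thesis using that[OF k] by (simp add: c_def)
qed

text \<open>The supremum \<open>N\<close> over the ball, finite by \<open>bilin_bounded\<close>,
  improves itself: rounding each argument to a net point at distance at most 1/4 gives
  \<open>N \<le> R / 16 + N / 4 + N / 4\<close>. The 1/16 is \<open>n\<close> times the two scalings
  \<open>1 / (4 * sqrt n)\<close>.\<close>

lemma bilin_le_net:
  fixes B :: "nat \<Rightarrow> nat \<Rightarrow> real"
  assumes n: "n \<ge> 1" and R: "\<And>k l. k \<in> net n \<Longrightarrow> l \<in> net n \<Longrightarrow>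
      \<bar>bilin n B (\<lambda>i. of_int (k i)) (\<lambda>i. of_int (l i))\<bar> \<le> R * n"
    and x: "(\<Sum>i<n. (x i)\<^sup>2) \<le> 1" and y: "(\<Sum>i<n. (y i)\<^sup>2) \<le> 1"
  shows "\<bar>bilin n B x y\<bar> \<le> R / 8"
proof -
  define I where "I = {p :: (nat \<Rightarrow> real) \<times> (nat \<Rightarrow> real). (\<Sum>i<n. (fst p i)\<^sup>2) \<le> 1 \<and> (\<Sum>i<n. (snd p i)\<^sup>2) \<le> 1}"
  define N where "N = (SUP p\<in>I. \<bar>bilin n B (fst p) (snd p)\<bar>)"
  have bdd: "bdd_above ((\<lambda>p. \<bar>bilin n B (fst p) (snd p)\<bar>) ` I)"
    by (rule bdd_aboveI2[of _ _ "\<Sum>i<n. \<Sum>j<n. \<bar>B i j\<bar>"]) (auto simp: I_def intro: bilin_bounded)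
  have N: "\<bar>bilin n B x y\<bar> \<le> N" if "(\<Sum>i<n. (x i)\<^sup>2) \<le> 1" "(\<Sum>i<n. (y i)\<^sup>2) \<le> 1" for x y
    using cSUP_upper[OF _ bdd, of "(x, y)"] that by (simp add: N_def I_def)
  have ne: "I \<noteq> {}" by (auto simp: I_def intro!: exI[of _ "\<lambda>_. 0"])
  have "\<bar>bilin n B x y\<bar> \<le> R / 16 + N / 2" if xy: "(\<Sum>i<n. (x i)\<^sup>2) \<le> 1" "(\<Sum>i<n. (y i)\<^sup>2) \<le> 1" for x y
  proof -
    obtain k where k: "k \<in> net n" "(\<Sum>i<n. (4 * (x i - k i / (4 * sqrt n)))\<^sup>2) \<le> 1"
      using net_approximation[OF n xy(1)] by blast
    obtain l where l: "l \<in> net n" "(\<Sum>i<n. (4 * (y i - l i / (4 * sqrt n)))\<^sup>2) \<le> 1"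
      using net_approximation[OF n xy(2)] by blast
    define x' y' where x'_def: "x' = (\<lambda>i. k i / (4 * sqrt n))" and y'_def: "y' = (\<lambda>i. l i / (4 * sqrt n))"
    have x'1: "(\<Sum>i<n. (x' i)\<^sup>2) \<le> 1"
    proof -
      have "real_of_int (\<Sum>i<n. (k i)\<^sup>2) \<le> real_of_int (16 * int n)"
        using k(1) by (simp only: of_int_le_iff) (simp add: net_def)
      then have "(\<Sum>i<n. (real_of_int (k i))\<^sup>2) / (16 * n) \<le> 1" using n by (simp add: divide_le_eq)
      then show ?thesis by (simp add: x'_def power_divide power_mult_distrib sum_divide_distrib)
    qed
    have "\<bar>bilin n B x' y'\<bar> = \<bar>1 / (16 * n) * bilin n B (\<lambda>i. k i) (\<lambda>i. l i)\<bar>"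
      using bilin_scale[of n B "1 / (4 * sqrt n)" "\<lambda>i. k i" "1 / (4 * sqrt n)" "\<lambda>i. l i"]
      by (simp add: x'_def y'_def)
    also have "\<dots> \<le> 1 / (16 * n) * (R * n)"
      unfolding abs_mult using mult_left_mono[OF R[OF k(1) l(1)], of "1 / (16 * real n)"] by simp
    also have "1 / (16 * n) * (R * n) = R / 16" using n by simp
    finally have 1: "\<bar>bilin n B x' y'\<bar> \<le> R / 16" .
    have "\<bar>bilin n B (\<lambda>i. 4 * (x i - x' i)) (\<lambda>i. 1 * y i)\<bar> \<le> N"
      using k(2) xy by (intro N) (auto simp: x'_def)
    then have "\<bar>4\<bar> * \<bar>bilin n B x y - bilin n B x' y\<bar> \<le> N"
      by (simp only: bilin_scale bilin_diff_left abs_mult)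
    then have 2: "\<bar>bilin n B x y - bilin n B x' y\<bar> \<le> N / 4" by simp
    have "\<bar>bilin n B (\<lambda>i. 1 * x' i) (\<lambda>i. 4 * (y i - y' i))\<bar> \<le> N"
      using l(2) x'1 by (intro N) (auto simp: y'_def)
    then have "\<bar>4\<bar> * \<bar>bilin n B x' y - bilin n B x' y'\<bar> \<le> N"
      by (simp only: bilin_scale bilin_diff_right abs_mult)
    then have 3: "\<bar>bilin n B x' y - bilin n B x' y'\<bar> \<le> N / 4" by simp
    from 1 2 3 show ?thesis unfolding abs_le_iff by linarith
  qed
  then have "N \<le> R / 16 + N / 2"
    unfolding N_def using ne by (intro cSUP_least) (auto simp: I_def)
  with N[OF x y] show ?thesis by linarith
qed

section \<open>Heavy pairs\<close>

text \<open>The five summands are the cases of the Kahn--Szemeredi bound for a pair of dyadic levels, each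
  summable over the levels.\<close>

lemma level_pair_bound:
  fixes E T t n q x y c D :: real
  assumes n: "n \<ge> 1" and q: "q \<ge> 1" and x: "x \<ge> 1" and y: "y \<ge> 1" and c: "c \<ge> 0" and D: "D \<ge> 0"
    and T: "0 < t" "t \<le> T" "T \<le> n" and E: "0 \<le> E"
    and ty: "y\<^sup>2 * t \<le> D * n" and xy: "q < 4 * x * y" "y < 2 * q * x"
    and disc: "E \<le> exp 2 * (2 * q\<^sup>2 * T * t / n) \<or>
      E * ln (E / (2 * q\<^sup>2 * T * t / n)) \<le> c * T * ln (exp 1 * n / T)"
  shows "x * y * E \<le> 8 * exp 2 * q / n * (x\<^sup>2 * T) * (y\<^sup>2 * t)
    + 4 * c * (x * T) * (if y < 2 * q * x then y else 0)
    + 4 * c * (x\<^sup>2 * T) * (if y \<le> q then y else 0)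
    + 2 * D * q\<^sup>2 * (x\<^sup>2 * T) * (if y > q then 1 / y else 0)
    + 4 * exp 1 * c * n * (1 / x\<^sup>2) * (if y < 2 * q * x then y else 0)"
    (is "_ \<le> ?t1 + ?t2 + ?t3 + ?t4 + ?t5")
proof -
  define \<mu> where "\<mu> = 2 * q\<^sup>2 * T * t / n"
  define l where "l = ln (exp 1 * n / T)"
  have pos: "0 < n" "0 < q" "0 < x" "0 < y" "0 < T" using assms by linarith+
  have \<mu>: "\<mu> > 0" using pos T by (simp add: \<mu>_def)
  have nonneg: "0 \<le> ?t1" "0 \<le> ?t2" "0 \<le> ?t3" "0 \<le> ?t4" "0 \<le> ?t5"
    using pos T c D by auto
  have l1: "l \<ge> 1"
  proof -
    have "exp 1 \<le> exp 1 * n / T" using pos T by (simp add: field_simps)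
    then have "ln (exp 1) \<le> l" unfolding l_def by (rule ln_mono) simp
    then show ?thesis by simp
  qed
  consider (A) "E \<le> exp 2 * \<mu>" | (B) "E > exp 2 * \<mu>" "E * ln (E / \<mu>) \<le> c * T * l"
    using disc unfolding \<mu>_def l_def by linarith
  then show ?thesis
  proof cases
    case A
    \<comment> \<open>Few edges: since \<open>q < 4 * x * y\<close>, one factor \<open>q\<close> of
      \<open>\<mu>\<close> is exchanged for \<open>x * y\<close>, completing both squares.\<close>
    have "x * y * E \<le> x * y * (exp 2 * \<mu>)" using A pos by (intro mult_left_mono) auto
    also have "\<dots> = q * (2 * exp 2 * q * x * y * T * t / n)"
      by (simp add: \<mu>_def power2_eq_square field_simps)
    also have "\<dots> \<le> (4 * x * y) * (2 * exp 2 * q * x * y * T * t / n)"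
      using xy(1) pos T by (intro mult_right_mono) auto
    also have "\<dots> = ?t1" by (simp add: power2_eq_square field_simps)
    finally show ?thesis using nonneg by linarith
  next
    case B
    have E0: "E > 0" using B(1) \<mu> by (smt (verit) exp_gt_zero mult_pos_pos)
    define r where "r = ln (E / \<mu>)"
    have r2: "r \<ge> 2"
    proof -
      have "exp 2 \<le> E / \<mu>" using B(1) \<mu> by (simp add: field_simps)
      then have "ln (exp 2) \<le> r" unfolding r_def by (rule ln_mono) simp
      then show ?thesis by simp
    qed
    have Er: "E * r \<le> c * T * l" using B(2) by (simp add: r_def)
    have El: "E \<le> c * T * l"
    proof -
      have "E * 1 \<le> E * r" using E0 r2 by (intro mult_left_mono) auto
      then show ?thesis using Er by simp
    qed
    \<comment> \<open>\<open>l\<close> is the entropy per vertex of the larger level set and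
      \<open>r\<close> the logarithmic excess of \<open>E\<close>. Either \<open>r\<close> is a
      fixed fraction of \<open>l\<close>, which then cancels; or \<open>l\<close>, and with it
      \<open>r\<close>, is controlled by \<open>ln x\<close>; or \<open>x\<close> is below the
      fourth root of \<open>exp 1 * n / T\<close>, so that \<open>T\<close> is small enough for
      \<open>c * T * l\<close> to decay like \<open>n / x ^ 3\<close>.\<close>
    consider (B1) "l / 4 \<le> r" | (B2) "r < l / 4" "l \<le> 4 * ln x" | (B3) "l > 4 * ln x" by linarith
    then show ?thesis
    proof cases
      case B1
      have "E * (l / 4) \<le> E * r" using E0 B1 by (intro mult_left_mono) auto
      then have "E * (l / 4) \<le> (4 * c * T) * (l / 4)" using Er by simp
      then have "E \<le> 4 * c * T" by (rule mult_right_le_imp_le) (use l1 in simp)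
      then have "x * y * E \<le> x * y * (4 * c * T)" using pos by (intro mult_left_mono) auto
      also have "\<dots> = ?t2" using xy(2) by simp
      finally show ?thesis using nonneg by linarith
    next
      case B2
      show ?thesis
      proof (cases "y \<le> q")
        case True
        have "ln x \<le> x" using ln_le_minus_one[of x] pos by linarith
        then have "l \<le> 4 * x" using B2 by linarith
        then have "c * T * l \<le> c * T * (4 * x)" using c pos by (intro mult_left_mono) auto
        then have "x * y * E \<le> x * y * (c * T * (4 * x))" using El pos by (intro mult_left_mono) auto
        also have "\<dots> = ?t3" using True by (simp add: power2_eq_square)
        finally show ?thesis using nonneg by linarith
      next
        case False
        \<comment> \<open>Now \<open>E\<close> exceeds \<open>\<mu>\<close> by at most a factor
          \<open>x\<close>. The bound \<open>ty\<close> on the second moment leaves a factor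
          \<open>1 / y\<close>, summable over the levels above \<open>q\<close>.\<close>
        have "ln (E / \<mu>) < ln x" using B2 by (simp add: r_def)
        then have "E / \<mu> < x" using E0 \<mu> pos by simp
        then have "E \<le> x * \<mu>" using \<mu> by (simp add: field_simps)
        then have "x * y * E \<le> x * y * (x * \<mu>)" using pos by (intro mult_left_mono) auto
        also have "\<dots> = 2 * q\<^sup>2 * (x\<^sup>2 * T) / (y * n) * (y\<^sup>2 * t)"
          using pos by (simp add: \<mu>_def power2_eq_square field_simps)
        also have "\<dots> \<le> 2 * q\<^sup>2 * (x\<^sup>2 * T) / (y * n) * (D * n)"
          using ty pos by (intro mult_left_mono) auto
        also have "\<dots> = ?t4" using False pos by simp
        finally show ?thesis using nonneg by linarith
      qed
    next
      case B3
      define w where "w = exp (l / 4)"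
      have w: "w > 0" "w ^ 4 = exp 1 * n / T"
      proof -
        have "w ^ 4 = exp l" by (simp add: w_def flip: exp_of_nat_mult)
        then show "w ^ 4 = exp 1 * n / T" using pos by (simp add: l_def)
      qed (simp add: w_def)
      have xw: "x \<le> w"
      proof -
        have "x = exp (ln x)" using pos by simp
        also have "\<dots> \<le> w" unfolding w_def using B3 by (simp only: exp_le_cancel_iff)
        finally show ?thesis .
      qed
      have "l = 4 * ln w" by (simp add: w_def)
      also have "\<dots> \<le> 4 * w" using ln_le_minus_one[OF w(1)] by linarith
      finally have "c * T * l \<le> c * T * (4 * w)" using c pos by (intro mult_left_mono) auto
      also have "c * T * (4 * w) = 4 * exp 1 * c * n / w ^ 3"
      proof -
        have "T = exp 1 * n / w ^ 4" using w pos by (simp add: field_simps)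
        then show ?thesis using w(1) by (simp add: field_simps numeral_eq_Suc)
      qed
      also have "\<dots> \<le> 4 * exp 1 * c * n / x ^ 3"
        using xw pos c by (intro divide_left_mono power_mono mult_pos_pos zero_less_power) auto
      finally have "E \<le> 4 * exp 1 * c * n / x ^ 3" using El by linarith
      then have "x * y * E \<le> x * y * (4 * exp 1 * c * n / x ^ 3)" using pos by (intro mult_left_mono) auto
      also have "\<dots> = ?t5" using xy(2) pos by (simp add: field_simps power2_eq_square power3_eq_cube)
      finally show ?thesis using nonneg by linarith
    qed
  qed
qed

section \<open>Summation over dyadic levels\<close>

lemma sum_two_powers_le:
  fixes z :: real
  assumes "z \<ge> 0"
  shows "(\<Sum>b<L. if 2 ^ b \<le> z then 2 ^ b else 0) \<le> 2 * z"
proof -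
  \<comment> \<open>The bound \<open>2 ^ L - 1\<close> carries the induction: adding the term
    \<open>2 ^ L \<le> z\<close> to it stays below \<open>2 * z\<close>.\<close>
  have "(\<Sum>b<L. if 2 ^ b \<le> z then 2 ^ b else 0) \<le> min (2 * z) (2 ^ L - 1)"
  proof (induction L)
    case (Suc L)
    show ?case
    proof (cases "(2::real) ^ L \<le> z")
      case True
      then show ?thesis using Suc by simp
    next
      case False
      have "1 \<le> (2::real) ^ L" by simp
      then have "(2::real) ^ L - 1 \<le> 2 ^ Suc L - 1" by simp
      moreover have "(\<Sum>b<Suc L. if 2 ^ b \<le> z then 2 ^ b else (0::real)) = (\<Sum>b<L. if 2 ^ b \<le> z then 2 ^ b else 0)"
        using False by simp
      ultimately show ?thesis using Suc by linarith
    qed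
  qed (use assms in simp)
  then show ?thesis by simp
qed

lemma sum_inverse_two_powers_le:
  fixes z :: real
  assumes "z > 0"
  shows "(\<Sum>b<L. if z < 2 ^ b then 1 / 2 ^ b else 0) \<le> 2 / z"
proof -
  \<comment> \<open>The subtracted \<open>2 / 2 ^ L\<close> is the geometric tail still to
    come.\<close>
  have "(\<Sum>b<L. if z < 2 ^ b then 1 / 2 ^ b else 0) \<le> (if z < 2 ^ L then 2 / z - 2 / 2 ^ L else 0)"
  proof (induction L)
    case 0
    have "1 \<le> 1 / z" if "z < 1" using that assms by simp
    then show ?case by (auto simp: field_simps)
  next
    case (Suc L)
    have le: "2 / 2 ^ Suc L \<le> 2 / z" if "z < 2 ^ Suc L"
      using that assms by (intro divide_left_mono) auto
    consider "z < 2 ^ L" "z < 2 ^ Suc L" | "\<not> z < 2 ^ L"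
    proof -
      have "(2::real) ^ L \<le> 2 ^ Suc L" by (rule power_increasing) auto
      then show ?thesis using that by linarith
    qed
    then show ?case
    proof cases
      case 1
      then show ?thesis using Suc by simp
    next
      case 2
      then show ?thesis using Suc le by (cases "z < 2 ^ Suc L") auto
    qed
  qed
  also have "\<dots> \<le> 2 / z" using assms by auto
  finally show ?thesis .
qed

text \<open>Half of the heavy pairs: \<open>T\<close> lists the sizes of the larger level sets.\<close>

lemma level_sum_bound:
  fixes T t :: "nat \<Rightarrow> real" and E :: "nat \<Rightarrow> nat \<Rightarrow> real"
  assumes n: "n \<ge> 1" and q: "q \<ge> 1" and c: "c \<ge> 0" and D: "D \<ge> 0"
    and P: "P \<subseteq> {..<L} \<times> {..<L}"
    and T0: "\<And>a. 0 \<le> T a" and t0: "\<And>b. 0 \<le> t b"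
    and Tsum: "(\<Sum>a<L. (2 ^ a)\<^sup>2 * T a) \<le> D * n" and tsum: "(\<Sum>b<L. (2 ^ b)\<^sup>2 * t b) \<le> D * n"
    and pair: "\<And>a b. (a, b) \<in> P \<Longrightarrow> 0 < t b \<and> t b \<le> T a \<and> T a \<le> n \<and> 0 \<le> E a b \<and>
      q < 4 * 2 ^ a * 2 ^ b \<and> 2 ^ b < 2 * q * 2 ^ a \<and>
      (E a b \<le> exp 2 * (2 * q\<^sup>2 * T a * t b / n) \<or>
       E a b * ln (E a b / (2 * q\<^sup>2 * T a * t b / n)) \<le> c * T a * ln (exp 1 * n / T a))"
  shows "(\<Sum>(a, b)\<in>P. 2 ^ a * 2 ^ b * E a b)
    \<le> (8 * exp 2 * D\<^sup>2 + 24 * c * D + 4 * D\<^sup>2 + 32 * exp 1 * c) * q * n"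
proof -
  let ?x = "\<lambda>a. 2 ^ a :: real"
  define h1 where "h1 = (\<lambda>a b. 8 * exp 2 * q / n * ((?x a)\<^sup>2 * T a) * ((?x b)\<^sup>2 * t b))"
  define h2 where "h2 = (\<lambda>a b. 4 * c * (?x a * T a) * (if ?x b \<le> 2 * q * ?x a then ?x b else 0))"
  define h3 where "h3 = (\<lambda>a b. 4 * c * ((?x a)\<^sup>2 * T a) * (if ?x b \<le> q then ?x b else 0))"
  define h4 where "h4 = (\<lambda>a b. 2 * D * q\<^sup>2 * ((?x a)\<^sup>2 * T a) * (if q < ?x b then 1 / ?x b else 0))"
  define h5 where "h5 = (\<lambda>a b. 4 * exp 1 * c * n * (1 / (?x a)\<^sup>2) * (if ?x b \<le> 2 * q * ?x a then ?x b else 0))"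
  define h where "h = (\<lambda>a b. h1 a b + h2 a b + h3 a b + h4 a b + h5 a b)"
  have hpos: "0 \<le> h a b" for a b
    using n q c D T0 t0 by (auto simp: h_def h1_def h2_def h3_def h4_def h5_def intro!: add_nonneg_nonneg)
  have pb: "?x a * ?x b * E a b \<le> h a b" if ab: "(a, b) \<in> P" for a b
  proof -
    have bL: "b < L" using ab P by auto
    have "(?x b)\<^sup>2 * t b \<le> (\<Sum>b<L. (?x b)\<^sup>2 * t b)"
      using bL t0 by (intro member_le_sum[of b "{..<L}" "\<lambda>b. (?x b)\<^sup>2 * t b"]) auto
    then have ty: "(?x b)\<^sup>2 * t b \<le> D * n" using tsum by linarith
    show ?thesis
      using level_pair_bound[OF n q _ _ c D, of "?x a" "?x b" "t b" "T a" "E a b"] pair[OF ab] ty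
      by (simp add: h_def h1_def h2_def h3_def h4_def h5_def)
  qed
  have "(\<Sum>(a, b)\<in>P. ?x a * ?x b * E a b) \<le> (\<Sum>(a, b)\<in>P. h a b)"
    by (intro sum_mono) (auto intro: pb)
  also have "\<dots> \<le> (\<Sum>(a, b)\<in>{..<L} \<times> {..<L}. h a b)"
    using P hpos by (intro sum_mono2) auto
  also have "\<dots> = (\<Sum>a<L. \<Sum>b<L. h a b)" by (rule sum.cartesian_product[symmetric])
  finally have total: "(\<Sum>(a, b)\<in>P. ?x a * ?x b * E a b) \<le> (\<Sum>a<L. \<Sum>b<L. h1 a b) + (\<Sum>a<L. \<Sum>b<L. h2 a b) + (\<Sum>a<L. \<Sum>b<L. h3 a b)
      + (\<Sum>a<L. \<Sum>b<L. h4 a b) + (\<Sum>a<L. \<Sum>b<L. h5 a b)"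
    by (simp only: h_def sum.distrib)
  \<comment> \<open>\<open>h1\<close> sums to a product of the two second moments. In the other four
    terms the sum over \<open>b\<close> is geometric, and the sum over \<open>a\<close> is a second
    moment or, for \<open>h5\<close>, again geometric.\<close>
  have s1: "(\<Sum>a<L. \<Sum>b<L. h1 a b) \<le> 8 * exp 2 * D\<^sup>2 * q * n"
  proof -
    have "(\<Sum>a<L. \<Sum>b<L. h1 a b) = 8 * exp 2 * q / n * ((\<Sum>a<L. (?x a)\<^sup>2 * T a) * (\<Sum>b<L. (?x b)\<^sup>2 * t b))"
      unfolding h1_def sum_product by (simp add: sum_distrib_left mult.assoc)
    also have "\<dots> \<le> 8 * exp 2 * q / n * ((D * n) * (D * n))"
      using n q D T0 t0 by (intro mult_left_mono mult_mono Tsum tsum) (auto intro!: sum_nonneg)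
    finally show ?thesis using n by (simp add: power2_eq_square field_simps)
  qed
  have s2: "(\<Sum>a<L. \<Sum>b<L. h2 a b) \<le> 16 * c * D * q * n"
  proof -
    have "(\<Sum>a<L. \<Sum>b<L. h2 a b) \<le> (\<Sum>a<L. 4 * c * (?x a * T a) * (2 * (2 * q * ?x a)))"
      unfolding h2_def sum_distrib_left[symmetric] using q c T0
      by (intro sum_mono mult_left_mono sum_two_powers_le) auto
    also have "\<dots> = 16 * c * q * (\<Sum>a<L. (?x a)\<^sup>2 * T a)"
      by (simp add: sum_distrib_left power2_eq_square mult_ac)
    also have "\<dots> \<le> 16 * c * q * (D * n)" using c q by (intro mult_left_mono Tsum) auto
    finally show ?thesis by (simp add: mult_ac)
  qed
  have s3: "(\<Sum>a<L. \<Sum>b<L. h3 a b) \<le> 8 * c * D * q * n"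
  proof -
    have "(\<Sum>a<L. \<Sum>b<L. h3 a b) \<le> (\<Sum>a<L. 4 * c * ((?x a)\<^sup>2 * T a) * (2 * q))"
      unfolding h3_def sum_distrib_left[symmetric] using q c T0
      by (intro sum_mono mult_left_mono sum_two_powers_le) auto
    also have "\<dots> = 8 * c * q * (\<Sum>a<L. (?x a)\<^sup>2 * T a)"
      by (simp add: sum_distrib_left mult_ac)
    also have "\<dots> \<le> 8 * c * q * (D * n)" using c q by (intro mult_left_mono Tsum) auto
    finally show ?thesis by (simp add: mult_ac)
  qed
  have s4: "(\<Sum>a<L. \<Sum>b<L. h4 a b) \<le> 4 * D\<^sup>2 * q * n"
  proof -
    have "(\<Sum>a<L. \<Sum>b<L. h4 a b) \<le> (\<Sum>a<L. 2 * D * q\<^sup>2 * ((?x a)\<^sup>2 * T a) * (2 / q))"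
      unfolding h4_def sum_distrib_left[symmetric] using q D T0
      by (intro sum_mono mult_left_mono sum_inverse_two_powers_le) auto
    also have "\<dots> = 4 * D * q * (\<Sum>a<L. (?x a)\<^sup>2 * T a)"
      using q by (simp add: sum_distrib_left power2_eq_square mult_ac)
    also have "\<dots> \<le> 4 * D * q * (D * n)" using D q by (intro mult_left_mono Tsum) auto
    finally show ?thesis by (simp add: power2_eq_square mult_ac)
  qed
  have s5: "(\<Sum>a<L. \<Sum>b<L. h5 a b) \<le> 32 * exp 1 * c * q * n"
  proof -
    have "(\<Sum>a<L. \<Sum>b<L. h5 a b) \<le> (\<Sum>a<L. 4 * exp 1 * c * n * (1 / (?x a)\<^sup>2) * (2 * (2 * q * ?x a)))"
      unfolding h5_def sum_distrib_left[symmetric] using n q c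
      by (intro sum_mono mult_left_mono sum_two_powers_le) auto
    also have "\<dots> = 16 * exp 1 * c * n * q * (\<Sum>a<L. 1 / ?x a)"
      by (simp add: sum_distrib_left power2_eq_square mult_ac)
    also have "\<dots> \<le> 16 * exp 1 * c * n * q * 2"
    proof (intro mult_left_mono)
      have "(\<Sum>a<L. 1 / ?x a) = 2 - 2 / 2 ^ L" by (induction L) auto
      then show "(\<Sum>a<L. 1 / ?x a) \<le> 2" by simp
    qed (use n q c in auto)
    finally show ?thesis by (simp add: mult_ac)
  qed
  have "(\<Sum>(a, b)\<in>P. ?x a * ?x b * E a b) \<le> 8 * exp 2 * D\<^sup>2 * q * n + 16 * c * D * q * n + 8 * c * D * q * n
      + 4 * D\<^sup>2 * q * n + 32 * exp 1 * c * q * n"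
    using total s1 s2 s3 s4 s5 by linarith
  then show ?thesis by (simp add: algebra_simps)
qed


text \<open>Group the pairs of \<open>Q\<close> by their two levels and enlarge each group to the
  full product of level sets; nonnegativity of \<open>f\<close> permits the enlargement.\<close>

lemma sum_double_levels:
  fixes f :: "nat \<Rightarrow> nat \<Rightarrow> real" and u v :: "nat \<Rightarrow> nat"
  assumes f: "\<And>i j. 0 \<le> f i j" and Q: "Q \<subseteq> {..<n} \<times> {..<n}" and "finite P"
    and lev: "\<And>i j. (i, j) \<in> Q \<Longrightarrow> 0 < u i \<and> 0 < v j \<and> (floor_log (u i), floor_log (v j)) \<in> P"
  shows "(\<Sum>(i, j)\<in>Q. f i j) \<le> (\<Sum>(a, b)\<in>P. \<Sum>i | i < n \<and> 0 < u i \<and> floor_log (u i) = a.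
      \<Sum>j | j < n \<and> 0 < v j \<and> floor_log (v j) = b. f i j)"
proof -
  let ?g = "\<lambda>(i, j). (floor_log (u i), floor_log (v j))"
  have fin: "finite Q" using Q by (rule finite_subset) simp
  have "(\<Sum>p\<in>Q. case_prod f p) = (\<Sum>ab\<in>P. \<Sum>p | p \<in> Q \<and> ?g p = ab. case_prod f p)"
    using fin assms(3) lev by (intro sum.group[symmetric]) auto
  also have "\<dots> \<le> (\<Sum>(a, b)\<in>P. \<Sum>i | i < n \<and> 0 < u i \<and> floor_log (u i) = a.
      \<Sum>j | j < n \<and> 0 < v j \<and> floor_log (v j) = b. f i j)"
  proof (rule sum_mono)
    fix ab assume "ab \<in> P"
    obtain a b where ab: "ab = (a, b)" by fastforce
    have "(\<Sum>p | p \<in> Q \<and> ?g p = ab. case_prod f p)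
      \<le> (\<Sum>p\<in>{i. i < n \<and> 0 < u i \<and> floor_log (u i) = a} \<times> {j. j < n \<and> 0 < v j \<and> floor_log (v j) = b}. case_prod f p)"
      using Q lev f by (intro sum_mono2) (auto simp: ab)
    then show "(\<Sum>p | p \<in> Q \<and> ?g p = ab. case_prod f p)
      \<le> (case ab of (a, b) \<Rightarrow> \<Sum>i | i < n \<and> 0 < u i \<and> floor_log (u i) = a.
      \<Sum>j | j < n \<and> 0 < v j \<and> floor_log (v j) = b. f i j)"
      by (simp add: ab sum.cartesian_product)
  qed
  finally show ?thesis by simp
qed

lemma sum_level_sizes_le:
  fixes u :: "nat \<Rightarrow> nat"
  shows "(\<Sum>a<L. (2 ^ a)\<^sup>2 * real (card {i. i < n \<and> 0 < u i \<and> floor_log (u i) = a})) \<le> (\<Sum>i<n. (real (u i))\<^sup>2)"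
proof -
  have "(\<Sum>a<L. (2 ^ a)\<^sup>2 * real (card {i. i < n \<and> 0 < u i \<and> floor_log (u i) = a}))
    = (\<Sum>a<L. \<Sum>i | i < n \<and> 0 < u i \<and> floor_log (u i) = a. (2 ^ a)\<^sup>2)" by (simp add: mult.commute)
  also have "\<dots> \<le> (\<Sum>a<L. \<Sum>i | i < n \<and> 0 < u i \<and> floor_log (u i) = a. (real (u i))\<^sup>2)"
  proof (intro sum_mono power_mono)
    fix a i assume "i \<in> {i. i < n \<and> 0 < u i \<and> floor_log (u i) = a}"
    then have "2 ^ a \<le> u i" using floor_log_exp2_le[of "u i"] by auto
    then show "2 ^ a \<le> real (u i)" by (metis of_nat_le_iff of_nat_numeral of_nat_power)
  qed auto
  also have "\<dots> = (\<Sum>a<L. \<Sum>i | i \<in> {i. i < n \<and> 0 < u i \<and> floor_log (u i) < L} \<and> floor_log (u i) = a. (real (u i))\<^sup>2)"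
    by (intro sum.cong refl) auto
  also have "\<dots> = (\<Sum>i | i < n \<and> 0 < u i \<and> floor_log (u i) < L. (real (u i))\<^sup>2)"
    by (rule sum.group) auto
  also have "\<dots> \<le> (\<Sum>i<n. (real (u i))\<^sup>2)" by (intro sum_mono2) auto
  finally show ?thesis .
qed

text \<open>Pairs with \<open>u\<^sub>i\<close> and \<open>v\<^sub>j\<close> very unbalanced are controlled by the row sums alone, the others
  level by level, with the larger level set as the first one.\<close>

lemma heavy_pairs_bound:
  fixes A :: "nat \<Rightarrow> nat \<Rightarrow> real" and u v :: "nat \<Rightarrow> nat" and c d D :: real and n :: nat
  assumes n: "n \<ge> 1" and d: "d \<ge> 1" and c: "c \<ge> 0"
    and A0: "\<And>i j. 0 \<le> A i j" and sym: "\<And>i j. A i j = A j i"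
    and row: "\<And>i. i < n \<Longrightarrow> (\<Sum>j<n. A i j) = d"
    and disc: "\<And>S T. S \<subseteq> {..<n} \<Longrightarrow> T \<subseteq> {..<n} \<Longrightarrow> S \<noteq> {} \<Longrightarrow> card S \<le> card T \<Longrightarrow>
      (\<Sum>i\<in>S. \<Sum>j\<in>T. A i j) \<le> exp 2 * (2 * d * card S * card T / n) \<or>
      (\<Sum>i\<in>S. \<Sum>j\<in>T. A i j) * ln ((\<Sum>i\<in>S. \<Sum>j\<in>T. A i j) / (2 * d * card S * card T / n))
        \<le> c * card T * ln (exp 1 * n / card T)"
    and u: "(\<Sum>i<n. (real (u i))\<^sup>2) \<le> D * n" and v: "(\<Sum>i<n. (real (v i))\<^sup>2) \<le> D * n"
  shows "(\<Sum>i<n. \<Sum>j<n. if sqrt d < u i * v j then u i * v j * A i j else 0)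
    \<le> (2 * D + 8 * (8 * exp 2 * D\<^sup>2 + 24 * c * D + 4 * D\<^sup>2 + 32 * exp 1 * c)) * sqrt d * n"
proof -
  define q where "q = sqrt d"
  have q: "q \<ge> 1" "q\<^sup>2 = d" using d by (auto simp: q_def)
  have D: "D \<ge> 0"
  proof -
    have "0 \<le> D * n" using u by (rule order_trans[rotated]) (auto intro: sum_nonneg)
    then show ?thesis using n by (simp add: zero_le_mult_iff)
  qed
  define K where "K = 8 * exp 2 * D\<^sup>2 + 24 * c * D + 4 * D\<^sup>2 + 32 * exp 1 * c"
  \<comment> \<open>Only has to exceed every level that occurs; the final constant does not involve
    it.\<close>
  define L where "L = Suc (\<Sum>i<n. floor_log (u i) + floor_log (v i))"
  have L: "floor_log (u i) < L" "floor_log (v i) < L" if "i < n" for i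
  proof -
    have "floor_log (u i) + floor_log (v i) \<le> (\<Sum>i<n. floor_log (u i) + floor_log (v i))"
      using that by (intro member_le_sum) auto
    then show "floor_log (u i) < L" "floor_log (v i) < L" by (auto simp: L_def)
  qed
  define U where "U = (\<lambda>a. {i. i < n \<and> 0 < u i \<and> floor_log (u i) = a})"
  define V where "V = (\<lambda>b. {j. j < n \<and> 0 < v j \<and> floor_log (v j) = b})"
  define e where "e = (\<lambda>S T. \<Sum>i\<in>S. \<Sum>j\<in>T. A i j)"
  have e0: "0 \<le> e S T" for S T unfolding e_def by (intro sum_nonneg A0)
  have esym: "e S T = e T S" for S T
    unfolding e_def by (subst sum.swap) (simp add: sym)
  have disc': "e S T \<le> exp 2 * (2 * d * card T * card S / n) \<or>
      e S T * ln (e S T / (2 * d * card T * card S / n)) \<le> c * card T * ln (exp 1 * n / card T)"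
    if "S \<subseteq> {..<n}" "T \<subseteq> {..<n}" "S \<noteq> {}" "card S \<le> card T" for S T
    using disc[OF that] by (simp add: e_def mult_ac)
  \<comment> \<open>Both ratio conditions are kept, because \<open>level_sum_bound\<close> wants the
    value on the smaller set bounded through the value on the larger one, and which set is larger
    varies with the pair of levels.\<close>
  define R where "R = {(a, b). a < L \<and> b < L \<and> U a \<noteq> {} \<and> V b \<noteq> {} \<and> q < 4 * 2 ^ a * 2 ^ b \<and>
    (2::real) ^ b < 2 * q * 2 ^ a \<and> (2::real) ^ a < 2 * q * 2 ^ b}"
  define P1 where "P1 = {(a, b) \<in> R. card (V b) \<le> card (U a)}"
  define P2 where "P2 = {(b, a). (a, b) \<in> R \<and> card (U a) < card (V b)}"
  have Rsub: "R \<subseteq> {..<L} \<times> {..<L}" by (auto simp: R_def)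
  have sub: "U a \<subseteq> {..<n}" "V a \<subseteq> {..<n}" for a by (auto simp: U_def V_def)
  have fin: "finite (U a)" "finite (V a)" for a using sub[of a] by (auto intro: finite_subset)
  have cardle: "real (card (U a)) \<le> n" "real (card (V a)) \<le> n" for a
    using card_mono[OF finite_lessThan sub(1)[of a]] card_mono[OF finite_lessThan sub(2)[of a]] by auto
  have cardpos: "0 < card (U a) \<longleftrightarrow> U a \<noteq> {}" "0 < card (V a) \<longleftrightarrow> V a \<noteq> {}" for a
    using fin by (auto simp: card_gt_0_iff)
  have Usum: "(\<Sum>a<L. (2 ^ a)\<^sup>2 * real (card (U a))) \<le> D * n"
    using sum_level_sizes_le[of n u L] u unfolding U_def by linarith
  have Vsum: "(\<Sum>a<L. (2 ^ a)\<^sup>2 * real (card (V a))) \<le> D * n"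
    using sum_level_sizes_le[of n v L] v unfolding V_def by linarith
  have B1: "(\<Sum>(a, b)\<in>P1. 2 ^ a * 2 ^ b * e (U a) (V b)) \<le> K * q * n"
    unfolding K_def
  proof (rule level_sum_bound[of n q c D P1 L "\<lambda>a. card (U a)" "\<lambda>b. card (V b)" "\<lambda>a b. e (U a) (V b)"])
    fix a b assume "(a, b) \<in> P1"
    then have ab: "(a, b) \<in> R" "card (V b) \<le> card (U a)" by (auto simp: P1_def)
    then show "0 < real (card (V b)) \<and> real (card (V b)) \<le> real (card (U a)) \<and> real (card (U a)) \<le> real n \<and>
      0 \<le> e (U a) (V b) \<and> q < 4 * 2 ^ a * 2 ^ b \<and> 2 ^ b < 2 * q * 2 ^ a \<and>
      (e (U a) (V b) \<le> exp 2 * (2 * q\<^sup>2 * real (card (U a)) * real (card (V b)) / real n) \<or>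
       e (U a) (V b) * ln (e (U a) (V b) / (2 * q\<^sup>2 * real (card (U a)) * real (card (V b)) / real n))
         \<le> c * real (card (U a)) * ln (exp 1 * real n / real (card (U a))))"
      using disc'[OF sub(2) sub(1), of b a] cardle[of a] cardpos(2)[of b] e0[of "V b" "U a"]
      unfolding esym[of "U a"] q(2) by (simp add: R_def)
  qed (use n q c D Rsub Usum Vsum in \<open>auto simp: P1_def\<close>)
  have B2: "(\<Sum>(b, a)\<in>P2. 2 ^ b * 2 ^ a * e (U a) (V b)) \<le> K * q * n"
    unfolding K_def
  proof (rule level_sum_bound[of n q c D P2 L "\<lambda>b. card (V b)" "\<lambda>a. card (U a)" "\<lambda>b a. e (U a) (V b)"])
    fix b a assume "(b, a) \<in> P2"
    then have ab: "(a, b) \<in> R" "card (U a) \<le> card (V b)" by (auto simp: P2_def)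
    then show "0 < real (card (U a)) \<and> real (card (U a)) \<le> real (card (V b)) \<and> real (card (V b)) \<le> real n \<and>
      0 \<le> e (U a) (V b) \<and> q < 4 * 2 ^ b * 2 ^ a \<and> 2 ^ a < 2 * q * 2 ^ b \<and>
      (e (U a) (V b) \<le> exp 2 * (2 * q\<^sup>2 * real (card (V b)) * real (card (U a)) / real n) \<or>
       e (U a) (V b) * ln (e (U a) (V b) / (2 * q\<^sup>2 * real (card (V b)) * real (card (U a)) / real n))
         \<le> c * real (card (V b)) * ln (exp 1 * real n / real (card (V b))))"
      using disc'[OF sub(1) sub(2), of a b] cardle[of b] cardpos(1)[of a] e0[of "U a" "V b"]
      unfolding q(2) by (simp add: R_def mult.commute mult.left_commute)
  qed (use n q c D Rsub Usum Vsum in \<open>auto simp: P2_def\<close>)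
  have finR: "finite R" using Rsub by (rule finite_subset) simp
  have "(\<Sum>(a, b)\<in>R. 2 ^ a * 2 ^ b * e (U a) (V b)) \<le> 2 * (K * q * n)"
  proof -
    have R: "R = P1 \<union> {(a, b) \<in> R. card (U a) < card (V b)}" by (auto simp: P1_def)
    have "(\<Sum>(a, b)\<in>R. 2 ^ a * 2 ^ b * e (U a) (V b)) = (\<Sum>(a, b)\<in>P1. 2 ^ a * 2 ^ b * e (U a) (V b))
      + (\<Sum>(a, b) | (a, b) \<in> R \<and> card (U a) < card (V b). 2 ^ a * 2 ^ b * e (U a) (V b))"
      using finR by (subst R, intro sum.union_disjoint) (auto simp: P1_def intro: finite_subset[OF _ finR])
    also have "(\<Sum>(a, b) | (a, b) \<in> R \<and> card (U a) < card (V b). 2 ^ a * 2 ^ b * e (U a) (V b))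
      = (\<Sum>(b, a)\<in>P2. 2 ^ b * 2 ^ a * e (U a) (V b))"
      by (rule sum.reindex_bij_witness[of _ prod.swap prod.swap]) (auto simp: P2_def mult_ac)
    finally show ?thesis using B1 B2 by linarith
  qed
  note levels = this
  \<comment> \<open>The balanced heavy pairs: neither entry is \<open>q\<close> times the other or
    more.\<close>
  define Q where "Q = {(i, j). i < n \<and> j < n \<and> q < real (u i) * v j \<and> v j < q * u i \<and> u i < q * v j}"
  have lev: "0 < u i \<and> 0 < v j \<and> (floor_log (u i), floor_log (v j)) \<in> R" if "(i, j) \<in> Q" for i j
  proof -
    have Q: "i < n" "j < n" "q < real (u i) * v j" "v j < q * u i" "u i < q * v j" using that by (auto simp: Q_def)
    then have pos: "0 < u i" "0 < v j" using q by (auto intro!: Nat.gr0I)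
    have pow: "2 ^ floor_log m \<le> real m" "real m < 2 * 2 ^ floor_log m" if "0 < m" for m
    proof -
      have "real (2 ^ floor_log m) \<le> real m" "real m < real (2 * 2 ^ floor_log m)"
        using floor_log_exp2_le[OF that] floor_log_exp2_gt[of m] by (simp_all only: of_nat_le_iff of_nat_less_iff)
      then show "2 ^ floor_log m \<le> real m" "real m < 2 * 2 ^ floor_log m" by simp_all
    qed
    note u1 = pow[OF pos(1)] and v1 = pow[OF pos(2)]
    have "q < (2 * 2 ^ floor_log (u i)) * (2 * 2 ^ floor_log (v j))"
      using Q(3) mult_mono[OF less_imp_le[OF u1(2)] less_imp_le[OF v1(2)]] by simp
    moreover have "2 ^ floor_log (v j) < q * (2 * 2 ^ floor_log (u i))"
      using Q(4) v1(1) mult_left_mono[OF less_imp_le[OF u1(2)], of q] q by linarith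
    moreover have "2 ^ floor_log (u i) < q * (2 * 2 ^ floor_log (v j))"
      using Q(5) u1(1) mult_left_mono[OF less_imp_le[OF v1(2)], of q] q by linarith
    moreover have "i \<in> U (floor_log (u i))" "j \<in> V (floor_log (v j))" using Q pos by (auto simp: U_def V_def)
    ultimately show ?thesis using pos L Q by (auto simp: R_def mult_ac)
  qed
  \<comment> \<open>The 8 is 4, for rounding both entries down to powers of two, times 2, for the
    two orders of the level sizes.\<close>
  have mid: "(\<Sum>(i, j)\<in>Q. u i * v j * A i j) \<le> 8 * K * q * n"
  proof -
    have "(\<Sum>(i, j)\<in>Q. u i * v j * A i j) \<le> (\<Sum>(a, b)\<in>R. \<Sum>i\<in>U a. \<Sum>j\<in>V b. u i * v j * A i j)"
      unfolding U_def V_def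
      by (rule sum_double_levels[OF _ _ finR lev]) (auto simp: Q_def A0)
    also have "\<dots> \<le> (\<Sum>(a, b)\<in>R. 4 * (2 ^ a * 2 ^ b * e (U a) (V b)))"
    proof (intro sum_mono, clarify)
      fix a b assume "(a, b) \<in> R"
      have "(\<Sum>i\<in>U a. \<Sum>j\<in>V b. u i * v j * A i j) \<le> (\<Sum>i\<in>U a. \<Sum>j\<in>V b. 4 * (2 ^ a * 2 ^ b) * A i j)"
      proof (intro sum_mono mult_right_mono A0)
        fix i j assume "i \<in> U a" "j \<in> V b"
        then have "u i \<le> 2 * 2 ^ a" "v j \<le> 2 * 2 ^ b"
          using floor_log_exp2_ge[of "u i"] floor_log_exp2_ge[of "v j"] by (auto simp: U_def V_def)
        then have "u i * v j \<le> (2 * 2 ^ a) * (2 * 2 ^ b)" by (rule mult_le_mono)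
        then have "real (u i * v j) \<le> real ((2 * 2 ^ a) * (2 * 2 ^ b))" by (simp only: of_nat_le_iff)
        then show "real (u i * v j) \<le> 4 * (2 ^ a * 2 ^ b)" by simp
      qed
      then show "(\<Sum>i\<in>U a. \<Sum>j\<in>V b. u i * v j * A i j) \<le> 4 * (2 ^ a * 2 ^ b * e (U a) (V b))"
        by (simp add: e_def sum_distrib_left mult.assoc)
    qed
    also have "\<dots> = 4 * (\<Sum>(a, b)\<in>R. 2 ^ a * 2 ^ b * e (U a) (V b))"
      by (simp add: sum_distrib_left case_prod_beta)
    finally show ?thesis using levels by (simp add: mult.assoc)
  qed
  have col: "(\<Sum>i<n. A i j) = d" if "j < n" for j
    using row[OF that] by (subst sym)
  \<comment> \<open>For unbalanced pairs the product is at most the larger square divided by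
    \<open>q\<close>. Summed against a row or column of sum \<open>d = q\<^sup>2\<close>, this gives
    \<open>q\<close> times the sum of squares, hence the \<open>2 * D\<close>.\<close>
  have ratio: "x * y \<le> y\<^sup>2 / q" if "q * x \<le> y" "0 \<le> y" for x y :: real
  proof -
    have "(q * x) * y \<le> y * y" using that by (rule mult_right_mono)
    then show ?thesis using q by (simp add: field_simps power2_eq_square)
  qed
  have "(\<Sum>i<n. \<Sum>j<n. if q < u i * v j then u i * v j * A i j else 0)
     \<le> (\<Sum>i<n. \<Sum>j<n. (if (i, j) \<in> Q then u i * v j * A i j else 0)
          + (real (v j))\<^sup>2 / q * A i j + (real (u i))\<^sup>2 / q * A i j)"
  proof (intro sum_mono)
    fix i j assume ij: "i \<in> {..<n}" "j \<in> {..<n}"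
    have nn: "0 \<le> (real (v j))\<^sup>2 / q * A i j" "0 \<le> (real (u i))\<^sup>2 / q * A i j" using q A0 by auto
    have "(i, j) \<in> Q \<or> q * u i \<le> v j \<or> q * v j \<le> u i \<or> \<not> q < u i * v j"
      using ij by (auto simp: Q_def)
    then consider "(i, j) \<in> Q" | "q * u i \<le> v j" | "q * v j \<le> u i" | "\<not> q < u i * v j" by blast
    then show "(if q < u i * v j then u i * v j * A i j else 0) \<le> (if (i, j) \<in> Q then u i * v j * A i j else 0)
          + (real (v j))\<^sup>2 / q * A i j + (real (u i))\<^sup>2 / q * A i j"
    proof cases
      case 2
      then have "u i * v j * A i j \<le> (real (v j))\<^sup>2 / q * A i j"
        using ratio[of "u i" "v j"] A0 by (intro mult_right_mono) auto
      then show ?thesis using nn A0[of i j] by auto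
    next
      case 3
      then have "u i * v j * A i j \<le> (real (u i))\<^sup>2 / q * A i j"
        using ratio[of "v j" "u i"] A0 by (intro mult_right_mono) (auto simp: mult.commute)
      then show ?thesis using nn A0[of i j] by auto
    qed (use nn A0[of i j] in auto)
  qed
  also have "\<dots> = (\<Sum>i<n. \<Sum>j<n. if (i, j) \<in> Q then u i * v j * A i j else 0)
     + (\<Sum>i<n. \<Sum>j<n. (real (v j))\<^sup>2 / q * A i j) + (\<Sum>i<n. \<Sum>j<n. (real (u i))\<^sup>2 / q * A i j)"
    by (simp add: sum.distrib)
  also have "(\<Sum>i<n. \<Sum>j<n. if (i, j) \<in> Q then u i * v j * A i j else 0) = (\<Sum>(i, j)\<in>Q. u i * v j * A i j)"
  proof -
    have "(\<Sum>p\<in>{..<n} \<times> {..<n}. if p \<in> Q then (case p of (i, j) \<Rightarrow> u i * v j * A i j) else 0)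
       = (\<Sum>p\<in>{..<n} \<times> {..<n} \<inter> Q. case p of (i, j) \<Rightarrow> u i * v j * A i j)"
      by (rule sum.inter_restrict[symmetric]) simp
    moreover have "{..<n} \<times> {..<n} \<inter> Q = Q" by (auto simp: Q_def)
    ultimately show ?thesis by (simp add: sum.cartesian_product case_prod_beta cong: if_cong)
  qed
  also have "(\<Sum>i<n. \<Sum>j<n. (real (v j))\<^sup>2 / q * A i j) = (\<Sum>j<n. (real (v j))\<^sup>2 / q * d)"
  proof -
    have "(\<Sum>i<n. \<Sum>j<n. (real (v j))\<^sup>2 / q * A i j) = (\<Sum>j<n. (real (v j))\<^sup>2 / q * (\<Sum>i<n. A i j))"
      unfolding sum_distrib_left by (rule sum.swap)
    then show ?thesis by (simp add: col)
  qed
  also have "(\<Sum>i<n. \<Sum>j<n. (real (u i))\<^sup>2 / q * A i j) = (\<Sum>j<n. (real (u j))\<^sup>2 / q * d)"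
    unfolding sum_distrib_left[symmetric] by (simp add: row)
  also have "(\<Sum>j<n. (real (v j))\<^sup>2 / q * d) = q * (\<Sum>j<n. (real (v j))\<^sup>2)"
    using q(1) by (simp add: sum_distrib_left power2_eq_square mult_ac flip: q(2))
  also have "(\<Sum>j<n. (real (u j))\<^sup>2 / q * d) = q * (\<Sum>j<n. (real (u j))\<^sup>2)"
    using q(1) by (simp add: sum_distrib_left power2_eq_square mult_ac flip: q(2))
  also have "(\<Sum>(i, j)\<in>Q. u i * v j * A i j) + q * (\<Sum>j<n. (real (v j))\<^sup>2) + q * (\<Sum>j<n. (real (u j))\<^sup>2)
     \<le> 8 * K * q * n + q * (D * n) + q * (D * n)"
    using q(1) by (intro add_mono mid mult_left_mono u v) auto
  also have "\<dots> = (2 * D + 8 * K) * q * n" by (simp add: algebra_simps)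
  finally show ?thesis by (simp add: K_def q_def)
qed

section \<open>Light pairs\<close>

text \<open>Symmetrising \<open>g\<close> and dividing by \<open>32 * sqrt d\<close> gives symmetric
  weights of size at most 1/16, whose statistic is that of \<open>g\<close> divided by
  \<open>16 * sqrt d\<close>. Their variance proxy is at most \<open>2 * n\<close>, so 770 is
  \<open>16 * 24 * 2\<close> plus 2 for the error in the centring, and 32 is
  \<open>16 * 2\<close>.\<close>

lemma light_sum_tail:
  fixes g :: "nat \<Rightarrow> nat \<Rightarrow> real"
  assumes n: "n \<ge> 2" and d: "d \<ge> 1" and g: "\<And>i j. \<bar>g i j\<bar> \<le> sqrt d"
    and g2: "(\<Sum>i<n. \<Sum>j<n. (g i j)\<^sup>2) \<le> 256 * (real n)\<^sup>2" and s: "s \<ge> 0"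
  shows "real (card {M \<in> perfect_matchings ({..<n} \<times> {..<d}).
      (\<Sum>i<n. \<Sum>j<n. g i j * (edge_count n d M i j - d / n)) \<ge> (770 * real n + 32 * s) * sqrt d})
    \<le> 2 * exp (- s) * card (perfect_matchings ({..<n} \<times> {..<d}))"
proof -
  let ?S = "{..<n} \<times> {..<d}"
  let ?P = "perfect_matchings ?S"
  define q where "q = sqrt (real d)"
  have q: "q \<ge> 1" "q\<^sup>2 = d" using d by (auto simp: q_def)
  define h where "h = (\<lambda>i j. (g i j + g j i) / (32 * q))"
  define w where "w = (\<lambda>(p :: nat \<times> nat) (p' :: nat \<times> nat). h (fst p) (fst p'))"
  define G where "G = (\<Sum>i<n. \<Sum>j<n. g i j)"
  define g0 where "g0 = (\<Sum>i<n. g i i)"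
  define N where "N = real n * real d - 1"
  have nd: "n * d \<ge> 2" using n d by (metis mult_le_mono nat_mult_1_right)
  then have N: "N > 0" "real n * real d \<le> 2 * N" unfolding N_def by (rule slots_minus_one)+
  have card: "card ?S \<ge> 2" using nd by (simp add: card_slot)
  have sumT: "(\<Sum>i<n. \<Sum>j<n. x j i) = (\<Sum>i<n. \<Sum>j<n. x i j)" for x :: "nat \<Rightarrow> nat \<Rightarrow> real"
    by (rule sum.swap)
  have w: "\<bar>w p p'\<bar> \<le> 1 / 16" for p p'
  proof -
    have "\<bar>g i j + g j i\<bar> \<le> 2 * q" for i j using g[of i j] g[of j i] unfolding q_def by linarith
    then show ?thesis using q(1) by (simp add: w_def h_def abs_mult divide_le_eq)
  qed
  have wsym: "w p p' = w p' p" for p p' by (simp add: w_def h_def add.commute)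
  have mean: "edge_mean ?S w = (real d ^ 2 * (G / (16 * q)) - real d * (g0 / (16 * q))) / N"
  proof -
    have "(\<Sum>i<n. \<Sum>j<n. h i j) = G / (16 * q)"
      unfolding h_def G_def by (simp add: sum.distrib sumT[of g] flip: sum_divide_distrib)
    moreover have "(\<Sum>i<n. h i i) = g0 / (16 * q)"
      unfolding h_def g0_def by (simp flip: sum_divide_distrib sum_distrib_left mult_2)
    ultimately show ?thesis unfolding w_def by (subst edge_mean_slots[OF nd]) (simp add: N_def)
  qed
  define v where "v = edge_mean ?S (\<lambda>p p'. (w p p')\<^sup>2)"
  have v: "v \<le> 2 * n"
  proof -
    have "(\<Sum>i<n. \<Sum>j<n. (h i j)\<^sup>2) \<le> (\<Sum>i<n. \<Sum>j<n. (2 * (g i j)\<^sup>2 + 2 * (g j i)\<^sup>2) / (1024 * d))"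
    proof (intro sum_mono)
      fix i j
      have "(g i j + g j i)\<^sup>2 \<le> 2 * (g i j)\<^sup>2 + 2 * (g j i)\<^sup>2"
        using zero_le_power2[of "g i j - g j i"] by (simp add: power2_sum power2_diff)
      then show "(h i j)\<^sup>2 \<le> (2 * (g i j)\<^sup>2 + 2 * (g j i)\<^sup>2) / (1024 * d)"
        using d by (simp add: h_def power_divide power_mult_distrib q divide_right_mono)
    qed
    also have "\<dots> = 4 * (\<Sum>i<n. \<Sum>j<n. (g i j)\<^sup>2) / (1024 * d)"
      by (simp add: sum.distrib sumT[of "\<lambda>i j. (g i j)\<^sup>2"] flip: sum_divide_distrib sum_distrib_left)
    also have "\<dots> \<le> 4 * (256 * (real n)\<^sup>2) / (1024 * d)"
      using g2 d by (intro divide_right_mono mult_left_mono) auto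
    finally have h2: "(\<Sum>i<n. \<Sum>j<n. (h i j)\<^sup>2) \<le> (real n)\<^sup>2 / d" by simp
    have "v = (real d ^ 2 * (\<Sum>i<n. \<Sum>j<n. (h i j)\<^sup>2) - real d * (\<Sum>i<n. (h i i)\<^sup>2)) / N"
      unfolding v_def w_def by (subst edge_mean_slots[OF nd]) (simp add: N_def)
    also have "\<dots> \<le> (real d ^ 2 * ((real n)\<^sup>2 / d) - 0) / N"
      using N h2 by (intro divide_right_mono diff_mono mult_left_mono) (auto intro!: mult_nonneg_nonneg sum_nonneg)
    also have "\<dots> = n * (real n * real d) / N" using d by (simp add: power2_eq_square)
    also have "\<dots> \<le> n * (2 * N) / N" using N by (intro divide_right_mono mult_left_mono) auto
    finally show ?thesis using N by simp
  qed
  have G: "\<bar>G\<bar> \<le> (real n)\<^sup>2 * q"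
  proof -
    have "\<bar>G\<bar> \<le> (\<Sum>i<n. \<Sum>j<n. \<bar>g i j\<bar>)"
      unfolding G_def by (rule order_trans[OF sum_abs]) (intro sum_mono sum_abs)
    also have "\<dots> \<le> (\<Sum>i<n. \<Sum>j<n. q)" using g by (intro sum_mono) (simp add: q_def)
    finally show ?thesis by (simp add: power2_eq_square)
  qed
  have g0: "\<bar>g0\<bar> \<le> n * q"
  proof -
    have "\<bar>g0\<bar> \<le> (\<Sum>i<n. \<bar>g i i\<bar>)" unfolding g0_def by (rule sum_abs)
    also have "\<dots> \<le> (\<Sum>i<n. q)" using g by (intro sum_mono) (simp add: q_def)
    finally show ?thesis by simp
  qed
  \<comment> \<open>Passing from the exact mean to the centring \<open>d / n\<close> costs at most
    \<open>4 * q\<close>, including the excluded diagonal of slots; this is at most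
    \<open>2 * n * q\<close> as \<open>n \<ge> 2\<close>.\<close>
  have meanG: "16 * q * edge_mean ?S w \<le> real d / n * G + 2 * n * q"
  proof -
    have "16 * q * edge_mean ?S w = (real d ^ 2 * G - real d * g0) / N"
    proof -
      have "a * (G / (16 * q)) - b * (g0 / (16 * q)) = (a * G - b * g0) / (16 * q)" for a b
        by (simp add: diff_divide_distrib)
      then show ?thesis unfolding mean using q(1) by simp
    qed
    also have "\<dots> = real d / n * G + (real d / n * G - real d * g0) / N"
      using N n by (simp add: field_simps N_def power2_eq_square)
    also have "real d / n * G - real d * g0 \<le> 4 * q * N"
    proof -
      have "real d / n * G \<le> real d / n * ((real n)\<^sup>2 * q)" using G by (intro mult_left_mono) auto
      moreover have "- (real d * g0) \<le> real d * (n * q)"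
        using mult_left_mono[of "- g0" "n * q" "real d"] g0 by auto
      moreover have "real d / n * ((real n)\<^sup>2 * q) = real d * (n * q)" using n by (simp add: power2_eq_square)
      ultimately have "real d / n * G - real d * g0 \<le> real d * (n * q) + real d * (n * q)" by linarith
      also have "\<dots> = 2 * q * (real n * real d)" by simp
      also have "\<dots> \<le> 2 * q * (2 * N)" using N q by (intro mult_left_mono) auto
      finally show ?thesis by simp
    qed
    also have "4 * q * N / N \<le> 2 * n * q" using N q(1) n by simp
    finally show ?thesis using N(1) by (simp add: divide_right_mono)
  qed
  have sub: "{M \<in> ?P. (\<Sum>i<n. \<Sum>j<n. g i j * (edge_count n d M i j - d / n)) \<ge> (770 * real n + 32 * s) * sqrt d}
    \<subseteq> {M \<in> ?P. edge_stat ?S w M \<ge> edge_mean ?S w + 24 * v + 2 * s}"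
  proof clarify
    fix M assume M: "M \<in> ?P"
      and ge: "(770 * real n + 32 * s) * sqrt d \<le> (\<Sum>i<n. \<Sum>j<n. g i j * (edge_count n d M i j - d / n))"
    define Y where "Y = (\<Sum>i<n. \<Sum>j<n. g i j * edge_count n d M i j)"
    have "edge_stat ?S w M = (\<Sum>i<n. \<Sum>j<n. h i j * edge_count n d M i j)"
      unfolding w_def by (rule sum_edge_count[OF M, symmetric])
    also have "\<dots> = ((\<Sum>i<n. \<Sum>j<n. g i j * edge_count n d M i j) + (\<Sum>i<n. \<Sum>j<n. g j i * edge_count n d M i j)) / (32 * q)"
      by (simp add: h_def sum_divide_distrib add_divide_distrib distrib_right flip: sum.distrib)
    also have "(\<Sum>i<n. \<Sum>j<n. g j i * edge_count n d M i j) = (\<Sum>i<n. \<Sum>j<n. g j i * edge_count n d M j i)"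
      using edge_count_sym[OF M] by (intro sum.cong refl) metis
    also have "\<dots> = Y" unfolding Y_def by (rule sumT)
    finally have X: "16 * q * edge_stat ?S w M = Y" using q(1) by (simp add: Y_def)
    have "(\<Sum>i<n. \<Sum>j<n. g i j * (edge_count n d M i j - d / n)) = Y - G * (d / n)"
      unfolding Y_def G_def right_diff_distrib sum_subtractf sum_distrib_right ..
    also have "G * (d / n) = real d / n * G" by simp
    finally have "(\<Sum>i<n. \<Sum>j<n. g i j * (edge_count n d M i j - d / n)) = Y - real d / n * G" .
    with ge have "(770 * real n + 32 * s) * q + real d / n * G \<le> Y" by (simp add: q_def)
    then have "16 * q * edge_mean ?S w - 2 * n * q + (770 * real n + 32 * s) * q \<le> 16 * q * edge_stat ?S w M"
      using meanG X by linarith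
    then have "16 * q * (edge_mean ?S w + 48 * n + 2 * s) \<le> 16 * q * edge_stat ?S w M"
      by (simp add: algebra_simps)
    then have "edge_mean ?S w + 48 * n + 2 * s \<le> edge_stat ?S w M" using q(1) by simp
    then show "edge_mean ?S w + 24 * v + 2 * s \<le> edge_stat ?S w M" using v by linarith
  qed
  have "finite ?P" by (intro finite_perfect_matchings) auto
  then have "card {M \<in> ?P. (\<Sum>i<n. \<Sum>j<n. g i j * (edge_count n d M i j - d / n)) \<ge> (770 * real n + 32 * s) * sqrt d}
    \<le> card {M \<in> ?P. edge_stat ?S w M \<ge> edge_mean ?S w + 24 * v + 2 * s}"
    by (intro card_mono sub) auto
  then have "real (card {M \<in> ?P. (\<Sum>i<n. \<Sum>j<n. g i j * (edge_count n d M i j - d / n)) \<ge> (770 * real n + 32 * s) * sqrt d})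
    \<le> real (card {M \<in> ?P. edge_stat ?S w M \<ge> edge_mean ?S w + 24 * v + 2 * s})" by (simp only: of_nat_le_iff)
  also have "\<dots> \<le> 2 * exp (- s) * card ?P"
    unfolding v_def by (rule edge_stat_tail[OF _ card wsym w s]) auto
  finally show ?thesis .
qed

section \<open>Discrepancy\<close>

text \<open>An ordered count: an edge with both ends in \<open>U \<inter> V\<close> counts
  twice.\<close>

definition edges_between :: "nat \<Rightarrow> nat \<Rightarrow> (nat \<times> nat) set set \<Rightarrow> nat set \<Rightarrow> nat set \<Rightarrow> real" where
  "edges_between n d M U V = (\<Sum>i\<in>U. \<Sum>j\<in>V. edge_count n d M i j)"

text \<open>The tail is evaluated at the smallest exceptional value of the statistic.\<close>

lemma edges_between_tail:
  assumes n: "n \<ge> 2" and d: "d \<ge> 1" and U: "U \<subseteq> {..<n}" "U \<noteq> {}" and V: "V \<subseteq> {..<n}" "V \<noteq> {}"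
  defines "\<mu> \<equiv> 2 * real d * card U * card V / n"
  shows "real (card {M \<in> perfect_matchings ({..<n} \<times> {..<d}). edges_between n d M U V > exp 2 * \<mu> \<and>
      edges_between n d M U V * ln (edges_between n d M U V / \<mu>) > l})
    \<le> exp (- l / 8) * card (perfect_matchings ({..<n} \<times> {..<d}))"
proof -
  let ?S = "{..<n} \<times> {..<d}"
  let ?P = "perfect_matchings ?S"
  let ?e = "\<lambda>M. edges_between n d M U V"
  define w where "w = (\<lambda>(p :: nat \<times> nat) (p' :: nat \<times> nat). (if fst p \<in> U \<and> fst p' \<in> V then 1 else 0) :: real)"
  define B where "B = {M \<in> ?P. ?e M > exp 2 * \<mu> \<and> ?e M * ln (?e M / \<mu>) > l}"
  have fin: "finite ?P" by (intro finite_perfect_matchings) auto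
  have nd: "n * d \<ge> 2" using n d by (metis mult_le_mono nat_mult_1_right)
  then have card: "card ?S \<ge> 2" by (simp add: card_slot)
  have finUV: "finite U" "finite V" using U V by (auto intro: finite_subset)
  then have "card U > 0" "card V > 0" using U V by (auto simp: card_gt_0_iff)
  then have \<mu>: "\<mu> > 0" using n d by (simp add: \<mu>_def)
  have ind: "(\<Sum>i<n. \<Sum>j<n. (if i \<in> U \<and> j \<in> V then 1 else 0) * x i j) = (\<Sum>i\<in>U. \<Sum>j\<in>V. x i j)"
    for x :: "nat \<Rightarrow> nat \<Rightarrow> real"
  proof -
    have "(\<Sum>i\<in>U. \<Sum>j\<in>V. x i j) = (\<Sum>i\<in>U. \<Sum>j<n. (if i \<in> U \<and> j \<in> V then 1 else 0) * x i j)"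
      using V by (intro sum.cong refl sum.mono_neutral_cong_left) auto
    also have "\<dots> = (\<Sum>i<n. \<Sum>j<n. (if i \<in> U \<and> j \<in> V then 1 else 0) * x i j)"
      using U by (intro sum.mono_neutral_left) auto
    finally show ?thesis by simp
  qed
  have X: "edge_stat ?S w M = ?e M" if "M \<in> ?P" for M
    using sum_edge_count[OF that, of "\<lambda>i j. if i \<in> U \<and> j \<in> V then 1 else 0"]
    unfolding ind edges_between_def w_def by simp
  \<comment> \<open>The factor 2 in \<open>\<mu>\<close> absorbs the denominator
    \<open>n * d - 1\<close>.\<close>
  have mean: "edge_mean ?S w \<le> \<mu>"
  proof -
    define N where "N = real n * real d - 1"
    have N: "N > 0" "real n * real d \<le> 2 * N" using nd unfolding N_def by (rule slots_minus_one)+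
    have "(\<Sum>i<n. \<Sum>j<n. if i \<in> U \<and> j \<in> V then 1 else 0 :: real) = real (card U) * card V"
      using ind[of "\<lambda>_ _. 1"] by simp
    then have "edge_mean ?S w = (real d ^ 2 * (real (card U) * card V) - real d * (\<Sum>i<n. if i \<in> U \<and> i \<in> V then 1 else 0)) / N"
      unfolding w_def by (subst edge_mean_slots[OF nd]) (simp add: N_def)
    also have "\<dots> \<le> (real d ^ 2 * (real (card U) * card V) - 0) / N"
      using N by (intro divide_right_mono diff_mono) (auto intro!: mult_nonneg_nonneg sum_nonneg)
    also have "\<dots> = \<mu> * (real n * real d) / (2 * N)" using n N by (simp add: \<mu>_def power2_eq_square)
    also have "\<dots> \<le> \<mu> * (2 * N) / (2 * N)" using N \<mu> by (intro divide_right_mono mult_left_mono) auto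
    finally show ?thesis using N by simp
  qed
  show ?thesis
  proof (cases "B = {}")
    case True
    then show ?thesis unfolding B_def[symmetric] by simp
  next
    case False
    have finB: "finite B" using fin by (simp add: B_def)
    define M0 where "M0 = arg_min_on ?e B"
    have M0: "M0 \<in> B" "\<And>M. M \<in> B \<Longrightarrow> ?e M0 \<le> ?e M"
      unfolding M0_def using finB False arg_min_if_finite(1) arg_min_least by metis+
    define x where "x = ?e M0"
    define r where "r = ln (x / \<mu>)"
    have x: "exp 2 * \<mu> < x" "x * r > l" using M0(1) by (auto simp: B_def x_def r_def)
    have x0: "x > 0" using x(1) \<mu> by (smt (verit) exp_gt_zero mult_pos_pos)
    have r2: "r \<ge> 2"
    proof -
      have "exp 2 \<le> x / \<mu>" using x(1) \<mu> by (simp add: field_simps)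
      then have "ln (exp 2) \<le> r" unfolding r_def by (rule ln_mono) simp
      then show ?thesis by simp
    qed
    \<comment> \<open>With parameter \<open>r / 4\<close> the factor
      \<open>exp (4 * (r / 4))\<close> equals \<open>x / \<mu>\<close>, so the moment costs at most
      \<open>x / 4\<close>. As \<open>r \<ge> 2\<close>, this is at most half of the gain
      \<open>r * x / 4\<close>, and \<open>x * r / 8\<close> remains.\<close>
    have "(\<Sum>M\<in>?P. exp (r / 4 * edge_stat ?S w M)) \<le> card ?P * exp (edge_mean ?S w * (exp (4 * (r / 4)) - 1) / 4)"
      using r2 by (intro edge_stat_mgf_nonneg card) (auto simp: w_def)
    also have "\<dots> \<le> card ?P * exp (x / 4)"
    proof -
      have "exp (4 * (r / 4)) - 1 \<le> x / \<mu>" using x0 \<mu> by (simp add: r_def)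
      moreover have "0 \<le> exp (4 * (r / 4)) - 1" using r2 by simp
      ultimately have "edge_mean ?S w * (exp (4 * (r / 4)) - 1) \<le> \<mu> * (x / \<mu>)"
        using mean \<mu> by (intro mult_mono) auto
      then show ?thesis using \<mu> by (intro mult_left_mono) auto
    qed
    finally have "real (card {M \<in> ?P. r / 4 * edge_stat ?S w M \<ge> r / 4 * x})
      \<le> card ?P * exp (x / 4) * exp (- (r / 4 * x))" by (rule card_exp_tail[OF fin])
    moreover have "card B \<le> card {M \<in> ?P. r / 4 * edge_stat ?S w M \<ge> r / 4 * x}"
    proof (rule card_mono)
      show "B \<subseteq> {M \<in> ?P. r / 4 * edge_stat ?S w M \<ge> r / 4 * x}"
      proof
        fix M assume M: "M \<in> B"
        then have "x \<le> edge_stat ?S w M" using M0(2)[OF M] X by (simp add: x_def B_def)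
        then show "M \<in> {M \<in> ?P. r / 4 * edge_stat ?S w M \<ge> r / 4 * x}"
          using M r2 by (simp add: B_def mult_left_mono)
      qed
    qed (use fin in simp)
    moreover have "card ?P * exp (x / 4) * exp (- (r / 4 * x)) \<le> exp (- l / 8) * card ?P"
    proof -
      have "x * 2 \<le> x * r" using x0 r2 by (intro mult_left_mono) auto
      then have "x / 4 - r / 4 * x \<le> - l / 8" using x(2) by (simp add: algebra_simps)
      then have "exp (x / 4) * exp (- (r / 4 * x)) \<le> exp (- l / 8)" by (simp flip: exp_add)
      then have "card ?P * (exp (x / 4) * exp (- (r / 4 * x))) \<le> card ?P * exp (- l / 8)"
        by (intro mult_left_mono) auto
      then show ?thesis by (simp only: mult_ac)
    qed
    ultimately show ?thesis unfolding B_def[symmetric] by linarith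
  qed
qed

section \<open>Union bound over pairs of vertex sets\<close>

lemma sum_Pow_power_card:
  fixes y :: real
  assumes "finite A"
  shows "(\<Sum>X\<in>Pow A. y ^ card X) = (1 + y) ^ card A"
  using prod_add[OF assms, of "\<lambda>_. y" "\<lambda>_. 1"] by (simp add: add.commute)

text \<open>In the expansion of \<open>(1 + t / n) ^ n\<close>, which is at most
  \<open>exp t\<close>, every subset of size at most \<open>t\<close> has weight at least
  \<open>(t / n) ^ t\<close>.\<close>

lemma card_small_subsets_le:
  fixes t n :: nat
  assumes "1 \<le> t" "t \<le> n"
  shows "real (card {X. X \<subseteq> {..<n} \<and> card X \<le> t}) \<le> exp (t * ln (exp 1 * n / t))"
proof -
  let ?y = "real t / n"
  have y: "0 < ?y" "?y \<le> 1" using assms by auto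
  have "?y ^ t * real (card {X. X \<subseteq> {..<n} \<and> card X \<le> t}) = (\<Sum>X | X \<subseteq> {..<n} \<and> card X \<le> t. ?y ^ t)" by simp
  also have "\<dots> \<le> (\<Sum>X | X \<subseteq> {..<n} \<and> card X \<le> t. ?y ^ card X)"
    using y by (intro sum_mono power_decreasing) auto
  also have "\<dots> \<le> (\<Sum>X\<in>Pow {..<n}. ?y ^ card X)" using y by (intro sum_mono2) auto
  also have "\<dots> = (1 + ?y) ^ n" by (subst sum_Pow_power_card) auto
  also have "\<dots> \<le> exp ?y ^ n" using y by (intro power_mono exp_ge_add_one_self) auto
  also have "\<dots> = exp t" using assms by (simp flip: exp_of_nat_mult)
  finally have "?y ^ t * real (card {X. X \<subseteq> {..<n} \<and> card X \<le> t}) \<le> exp t" .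
  then have "real (card {X. X \<subseteq> {..<n} \<and> card X \<le> t}) \<le> exp t / ?y ^ t"
    using y by (simp only: pos_le_divide_eq zero_less_power mult.commute)
  also have "exp (real t) / ?y ^ t = (exp 1 * n / t) ^ t"
    using assms by (simp add: power_divide power_mult_distrib flip: exp_of_nat_mult)
  also have "\<dots> = exp (t * ln (exp 1 * n / t))"
    using assms by (simp add: exp_of_nat_mult)
  finally show ?thesis .
qed

text \<open>The right-hand side is least at \<open>t = 1\<close>. The term \<open>ln n\<close> pays
  for the sum over set sizes in \<open>discrepancy_tail\<close>.\<close>

lemma entropy_ge:
  fixes t n :: nat
  assumes "1 \<le> t" "t \<le> n"
  shows "1 + ln (real n) \<le> t * ln (exp 1 * n / real t)"
proof -
  have "ln (exp 1 * n / real t) = 1 + ln (real n) - ln (real t)"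
    using assms by (simp add: ln_mult ln_div)
  then have "t * ln (exp 1 * n / real t) = t * (1 + ln (real n) - ln (real t))" by (simp only:)
  moreover have "(real t - 1) * ln (real t) \<le> (real t - 1) * ln (real n)"
    using assms by (intro mult_left_mono) auto
  moreover have "ln (real t) \<le> real t - 1" using assms by (intro ln_le_minus_one) auto
  ultimately show ?thesis by (simp add: algebra_simps)
qed

text \<open>The negation of the alternative assumed in \<open>heavy_pairs_bound\<close>;
  \<open>V\<close> is meant to be the larger set.\<close>

definition discrepancy_bad :: "real \<Rightarrow> nat \<Rightarrow> nat \<Rightarrow> (nat \<times> nat) set set \<Rightarrow> nat set \<Rightarrow> nat set \<Rightarrow> bool" where
  "discrepancy_bad c n d M U V \<longleftrightarrow> edges_between n d M U V > exp 2 * (2 * real d * card U * card V / n) \<and>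
    edges_between n d M U V * ln (edges_between n d M U V / (2 * real d * card U * card V / n))
      > c * real (card V) * ln (exp 1 * n / card V)"

text \<open>Write \<open>h t\<close> for \<open>t * ln (exp 1 * n / t)\<close>. A fixed pair with
  \<open>card V = t\<close> is bad with probability at most
  \<open>exp (- (\<kappa> + 2) * h t)\<close>. Choosing \<open>U\<close> and \<open>V\<close> costs
  \<open>exp (h t)\<close> each, and the remaining \<open>exp (- \<kappa> * h t)\<close> is at most
  \<open>exp (- \<kappa>) / n\<close>, which can be summed over \<open>t\<close>.\<close>

lemma discrepancy_tail:
  assumes n: "n \<ge> 2" and d: "d \<ge> 1" and \<kappa>: "\<kappa> \<ge> 1"
  shows "real (card {M \<in> perfect_matchings ({..<n} \<times> {..<d}). \<exists>U V. U \<subseteq> {..<n} \<and> V \<subseteq> {..<n} \<and> U \<noteq> {} \<and>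
      card U \<le> card V \<and> discrepancy_bad (8 * (\<kappa> + 2)) n d M U V})
    \<le> exp (- \<kappa>) * card (perfect_matchings ({..<n} \<times> {..<d}))"
proof -
  let ?P = "perfect_matchings ({..<n} \<times> {..<d})"
  define h where "h = (\<lambda>t::nat. t * ln (exp 1 * n / real t))"
  define W where "W = {V. V \<subseteq> {..<n} \<and> V \<noteq> {}}"
  define Z where "Z = (\<lambda>t. {U. U \<subseteq> {..<n} \<and> U \<noteq> {} \<and> card U \<le> t})"
  define B where "B = (\<lambda>V U. {M \<in> ?P. discrepancy_bad (8 * (\<kappa> + 2)) n d M U V})"
  have fin: "finite ?P" by (intro finite_perfect_matchings) auto
  have finW: "finite W" by (rule finite_subset[of _ "Pow {..<n}"]) (auto simp: W_def)
  have finZ: "finite (Z t)" for t by (rule finite_subset[of _ "Pow {..<n}"]) (auto simp: Z_def)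
  have finsmall: "finite {X. X \<subseteq> {..<n} \<and> card X \<le> t}" for t by (rule finite_subset[of _ "Pow {..<n}"]) auto
  have cardW: "1 \<le> card V" "card V \<le> n" if "V \<in> W" for V
  proof -
    have "finite V" using that by (auto simp: W_def intro: finite_subset)
    then show "1 \<le> card V" using that by (auto simp: W_def Suc_le_eq card_gt_0_iff)
    show "card V \<le> n" using that card_mono[of "{..<n}" V] by (auto simp: W_def)
  qed
  have "{M \<in> ?P. \<exists>U V. U \<subseteq> {..<n} \<and> V \<subseteq> {..<n} \<and> U \<noteq> {} \<and> card U \<le> card V \<and>
      discrepancy_bad (8 * (\<kappa> + 2)) n d M U V} \<subseteq> (\<Union>V\<in>W. \<Union>U\<in>Z (card V). B V U)"
  proof clarify
    fix M U V assume M: "M \<in> ?P" and UV: "U \<subseteq> {..<n}" "V \<subseteq> {..<n}" "U \<noteq> {}" "card U \<le> card V"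
      and bad: "discrepancy_bad (8 * (\<kappa> + 2)) n d M U V"
    have "finite U" using UV(1) by (rule finite_subset) simp
    then have "0 < card U" using UV(3) by (simp add: card_gt_0_iff)
    then have "V \<noteq> {}" using UV(4) by auto
    then show "M \<in> (\<Union>V\<in>W. \<Union>U\<in>Z (card V). B V U)"
      using M UV bad by (auto simp: W_def Z_def B_def)
  qed
  then have "card {M \<in> ?P. \<exists>U V. U \<subseteq> {..<n} \<and> V \<subseteq> {..<n} \<and> U \<noteq> {} \<and> card U \<le> card V \<and>
      discrepancy_bad (8 * (\<kappa> + 2)) n d M U V} \<le> card (\<Union>V\<in>W. \<Union>U\<in>Z (card V). B V U)"
    using fin finW finZ by (intro card_mono) (auto simp: B_def)
  also have "\<dots> \<le> (\<Sum>V\<in>W. \<Sum>U\<in>Z (card V). card (B V U))"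
    using finW finZ by (intro order_trans[OF card_UN_le] sum_mono card_UN_le) auto
  finally have "real (card {M \<in> ?P. \<exists>U V. U \<subseteq> {..<n} \<and> V \<subseteq> {..<n} \<and> U \<noteq> {} \<and> card U \<le> card V \<and>
      discrepancy_bad (8 * (\<kappa> + 2)) n d M U V}) \<le> real (\<Sum>V\<in>W. \<Sum>U\<in>Z (card V). card (B V U))"
    by (simp only: of_nat_le_iff)
  also have "\<dots> = (\<Sum>V\<in>W. \<Sum>U\<in>Z (card V). real (card (B V U)))" by simp
  also have "\<dots> \<le> (\<Sum>V\<in>W. \<Sum>U\<in>Z (card V). exp (- ((\<kappa> + 2) * h (card V))) * card ?P)"
  proof (intro sum_mono)
    fix V U assume "V \<in> W" "U \<in> Z (card V)"
    then have "real (card (B V U)) \<le> exp (- (8 * (\<kappa> + 2) * card V * ln (exp 1 * n / card V)) / 8) * card ?P"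
      using edges_between_tail[OF n d, of U V "8 * (\<kappa> + 2) * card V * ln (exp 1 * n / card V)"]
      unfolding B_def discrepancy_bad_def by (simp only: W_def Z_def mem_Collect_eq simp_thms)
    also have "- (8 * (\<kappa> + 2) * card V * ln (exp 1 * n / card V)) / 8 = - ((\<kappa> + 2) * h (card V))"
    proof -
      have "- (8 * k * a * b) / 8 = - (k * (a * b))" for k a b :: real by simp
      then show ?thesis unfolding h_def .
    qed
    finally show "real (card (B V U)) \<le> exp (- ((\<kappa> + 2) * h (card V))) * card ?P" .
  qed
  also have "\<dots> = (\<Sum>V\<in>W. card (Z (card V)) * (exp (- ((\<kappa> + 2) * h (card V))) * card ?P))" by simp
  also have "\<dots> \<le> (\<Sum>V\<in>W. exp (h (card V)) * (exp (- ((\<kappa> + 2) * h (card V))) * card ?P))"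
  proof (intro sum_mono mult_right_mono)
    fix V assume V: "V \<in> W"
    have "card (Z (card V)) \<le> card {X. X \<subseteq> {..<n} \<and> card X \<le> card V}"
      using finsmall by (intro card_mono) (auto simp: Z_def)
    then show "real (card (Z (card V))) \<le> exp (h (card V))"
      using card_small_subsets_le[OF cardW[OF V]] unfolding h_def by linarith
  qed auto
  also have "\<dots> = (\<Sum>V\<in>W. exp (- ((\<kappa> + 1) * h (card V)))) * card ?P"
    unfolding sum_distrib_right
  proof (rule sum.cong[OF refl])
    fix V
    have "exp (h (card V)) * exp (- ((\<kappa> + 2) * h (card V))) = exp (- ((\<kappa> + 1) * h (card V)))"
      unfolding exp_add[symmetric] by (rule arg_cong[of _ _ exp]) (simp add: algebra_simps)
    then show "exp (h (card V)) * (exp (- ((\<kappa> + 2) * h (card V))) * card ?P) = exp (- ((\<kappa> + 1) * h (card V))) * card ?P"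
      by (simp only: mult.assoc[symmetric])
  qed
  also have "(\<Sum>V\<in>W. exp (- ((\<kappa> + 1) * h (card V)))) = (\<Sum>t\<in>{1..n}. \<Sum>V | V \<in> W \<and> card V = t. exp (- ((\<kappa> + 1) * h (card V))))"
    using finW cardW by (intro sum.group[symmetric]) auto
  also have "\<dots> \<le> (\<Sum>t\<in>{1..n}. exp (- \<kappa>) / n)"
  proof (rule sum_mono)
    fix t assume t: "t \<in> {1..n}"
    have "(\<Sum>V | V \<in> W \<and> card V = t. exp (- ((\<kappa> + 1) * h (card V)))) = card {V \<in> W. card V = t} * exp (- ((\<kappa> + 1) * h t))"
      by simp
    also have "\<dots> \<le> exp (h t) * exp (- ((\<kappa> + 1) * h t))"
    proof (intro mult_right_mono)
      have "card {V \<in> W. card V = t} \<le> card {X. X \<subseteq> {..<n} \<and> card X \<le> t}"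
        using finsmall by (intro card_mono) (auto simp: W_def)
      then show "real (card {V \<in> W. card V = t}) \<le> exp (h t)"
        using card_small_subsets_le[of t n] t unfolding h_def by auto
    qed simp
    also have "\<dots> = exp (- (\<kappa> * h t))" by (simp add: algebra_simps flip: exp_add)
    also have "\<dots> \<le> exp (- (\<kappa> + ln (real n)))"
    proof -
      have "\<kappa> * (1 + ln (real n)) \<le> \<kappa> * h t"
        using entropy_ge[of t n] t \<kappa> unfolding h_def by (intro mult_left_mono) auto
      moreover have "1 * ln (real n) \<le> \<kappa> * ln (real n)" using \<kappa> n by (intro mult_right_mono) auto
      ultimately show ?thesis by (simp add: algebra_simps)
    qed
    also have "\<dots> = exp (- \<kappa>) / n" using n by (simp add: exp_diff)
    finally show "(\<Sum>V | V \<in> W \<and> card V = t. exp (- ((\<kappa> + 1) * h (card V)))) \<le> exp (- \<kappa>) / n" .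
  qed
  also have "\<dots> = exp (- \<kappa>)" using n by simp
  finally show ?thesis by (simp add: mult_right_mono)
qed

section \<open>The spectral bound\<close>

text \<open>Written in net units: the entries of the ball points multiply to
  \<open>k i * l j / (16 * n)\<close>, so the cut lies at \<open>sqrt d / (16 * n)\<close>.\<close>

definition light_part :: "nat \<Rightarrow> (nat \<Rightarrow> int) \<Rightarrow> (nat \<Rightarrow> int) \<Rightarrow> nat \<Rightarrow> nat \<Rightarrow> real" where
  "light_part d k l i j = (if \<bar>real_of_int (k i * l j)\<bar> \<le> sqrt d then real_of_int (k i * l j) else 0)"

lemma sum_net_squares:
  assumes "k \<in> net n"
  shows "(\<Sum>i<n. (real_of_int (k i))\<^sup>2) \<le> 16 * real n"
proof -
  have "real_of_int (\<Sum>i<n. (k i)\<^sup>2) \<le> real_of_int (16 * int n)"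
    using assms by (simp only: of_int_le_iff) (simp add: net_def)
  then show ?thesis by simp
qed

lemma sum_net_product_squares:
  assumes "k \<in> net n" "l \<in> net n"
  shows "(\<Sum>i<n. \<Sum>j<n. (real_of_int (k i * l j))\<^sup>2) \<le> 256 * (real n)\<^sup>2"
proof -
  have "(\<Sum>i<n. \<Sum>j<n. (real_of_int (k i * l j))\<^sup>2) = (\<Sum>i<n. (real_of_int (k i))\<^sup>2) * (\<Sum>j<n. (real_of_int (l j))\<^sup>2)"
    by (simp add: sum_product power_mult_distrib)
  also have "\<dots> \<le> (16 * real n) * (16 * real n)"
    by (intro mult_mono sum_net_squares assms) (auto intro: sum_nonneg)
  finally show ?thesis by (simp add: power2_eq_square)
qed

text \<open>The \<open>36 * n\<close> in \<open>s\<close> pays for at most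
  \<open>2 ^ (36 * n)\<close> pairs of net points, and 1922 is \<open>770 + 32 * 36\<close>. The 4
  is the 2 of \<open>light_sum_tail\<close> for each of the two signs.\<close>

lemma light_part_tail:
  assumes n: "n \<ge> 2" and d: "d \<ge> 1" and \<sigma>: "\<sigma> \<ge> 0"
  shows "real (card {M \<in> perfect_matchings ({..<n} \<times> {..<d}). \<exists>k\<in>net n. \<exists>l\<in>net n.
      \<bar>\<Sum>i<n. \<Sum>j<n. light_part d k l i j * (edge_count n d M i j - d / n)\<bar> \<ge> (1922 + 32 * \<sigma>) * n * sqrt d})
    \<le> 4 * exp (- \<sigma>) * card (perfect_matchings ({..<n} \<times> {..<d}))"
proof -
  let ?P = "perfect_matchings ({..<n} \<times> {..<d})"
  define X where "X = (\<lambda>k l M. \<Sum>i<n. \<Sum>j<n. light_part d k l i j * (edge_count n d M i j - d / n))"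
  define T where "T = (1922 + 32 * \<sigma>) * n * sqrt d"
  define s where "s = 36 * real n + \<sigma>"
  have fin: "finite ?P" by (intro finite_perfect_matchings) auto
  have T: "(770 * real n + 32 * s) * sqrt d \<le> T"
  proof -
    have "32 * \<sigma> * 1 \<le> 32 * \<sigma> * real n" using \<sigma> n by (intro mult_left_mono) auto
    then have "770 * real n + 32 * s \<le> (1922 + 32 * \<sigma>) * n" by (simp add: s_def algebra_simps)
    then show ?thesis unfolding T_def by (rule mult_right_mono) simp
  qed
  have bound: "real (card {M \<in> ?P. T \<le> \<bar>X k l M\<bar>}) \<le> 4 * exp (- s) * card ?P"
    if kl: "k \<in> net n" "l \<in> net n" for k l
  proof -
    have small: "\<bar>light_part d k l i j\<bar> \<le> sqrt d" for i j by (simp add: light_part_def)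
    have "(\<Sum>i<n. \<Sum>j<n. (light_part d k l i j)\<^sup>2) \<le> (\<Sum>i<n. \<Sum>j<n. (real_of_int (k i * l j))\<^sup>2)"
      by (intro sum_mono) (simp add: light_part_def)
    also have "\<dots> \<le> 256 * (real n)\<^sup>2" by (rule sum_net_product_squares[OF kl])
    finally have sq: "(\<Sum>i<n. \<Sum>j<n. (light_part d k l i j)\<^sup>2) \<le> 256 * (real n)\<^sup>2" .
    have s0: "s \<ge> 0" using \<sigma> by (simp add: s_def)
    have 1: "real (card {M \<in> ?P. X k l M \<ge> (770 * real n + 32 * s) * sqrt d}) \<le> 2 * exp (- s) * card ?P"
      unfolding X_def by (rule light_sum_tail[OF n d small sq s0])
    have "real (card {M \<in> ?P. (\<Sum>i<n. \<Sum>j<n. - light_part d k l i j * (edge_count n d M i j - d / n)) \<ge> (770 * real n + 32 * s) * sqrt d})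
        \<le> 2 * exp (- s) * card ?P"
      using small sq s0 by (intro light_sum_tail[OF n d]) auto
    then have 2: "real (card {M \<in> ?P. - X k l M \<ge> (770 * real n + 32 * s) * sqrt d}) \<le> 2 * exp (- s) * card ?P"
      by (simp add: X_def sum_negf)
    have "{M \<in> ?P. T \<le> \<bar>X k l M\<bar>} \<subseteq> {M \<in> ?P. X k l M \<ge> (770 * real n + 32 * s) * sqrt d} \<union> {M \<in> ?P. - X k l M \<ge> (770 * real n + 32 * s) * sqrt d}"
      using T by (auto simp: abs_if)
    then have "card {M \<in> ?P. T \<le> \<bar>X k l M\<bar>} \<le> card ({M \<in> ?P. X k l M \<ge> (770 * real n + 32 * s) * sqrt d} \<union> {M \<in> ?P. - X k l M \<ge> (770 * real n + 32 * s) * sqrt d})"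
      using fin by (intro card_mono) auto
    also have "\<dots> \<le> card {M \<in> ?P. X k l M \<ge> (770 * real n + 32 * s) * sqrt d} + card {M \<in> ?P. - X k l M \<ge> (770 * real n + 32 * s) * sqrt d}"
      by (rule card_Un_le)
    finally have "real (card {M \<in> ?P. T \<le> \<bar>X k l M\<bar>}) \<le> real (card {M \<in> ?P. X k l M \<ge> (770 * real n + 32 * s) * sqrt d})
       + real (card {M \<in> ?P. - X k l M \<ge> (770 * real n + 32 * s) * sqrt d})" by (simp flip: of_nat_add)
    also have "\<dots> \<le> 2 * exp (- s) * card ?P + 2 * exp (- s) * card ?P" by (rule add_mono[OF 1 2])
    finally show ?thesis by simp
  qed
  have "{M \<in> ?P. \<exists>k\<in>net n. \<exists>l\<in>net n. \<bar>X k l M\<bar> \<ge> T} = (\<Union>k\<in>net n. \<Union>l\<in>net n. {M \<in> ?P. T \<le> \<bar>X k l M\<bar>})" by auto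
  then have "card {M \<in> ?P. \<exists>k\<in>net n. \<exists>l\<in>net n. \<bar>X k l M\<bar> \<ge> T} \<le> (\<Sum>k\<in>net n. \<Sum>l\<in>net n. card {M \<in> ?P. T \<le> \<bar>X k l M\<bar>})"
    using finite_net by (auto intro!: order_trans[OF card_UN_le] sum_mono card_UN_le)
  then have "real (card {M \<in> ?P. \<exists>k\<in>net n. \<exists>l\<in>net n. \<bar>X k l M\<bar> \<ge> T}) \<le> real (\<Sum>k\<in>net n. \<Sum>l\<in>net n. card {M \<in> ?P. T \<le> \<bar>X k l M\<bar>})"
    by (simp only: of_nat_le_iff)
  also have "\<dots> = (\<Sum>k\<in>net n. \<Sum>l\<in>net n. real (card {M \<in> ?P. T \<le> \<bar>X k l M\<bar>}))" by simp
  also have "\<dots> \<le> (\<Sum>k\<in>net n. \<Sum>l\<in>net n. 4 * exp (- s) * card ?P)" by (intro sum_mono bound)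
  also have "\<dots> = real (card (net n)) * real (card (net n)) * (4 * exp (- s) * card ?P)" by simp
  also have "\<dots> \<le> exp (36 * real n) * (4 * exp (- s) * card ?P)"
  proof (rule mult_right_mono)
    have "real (card (net n)) * real (card (net n)) \<le> 2 ^ (18 * n) * 2 ^ (18 * n)"
      by (intro mult_mono card_net_le) auto
    also have "\<dots> = (2::real) ^ (36 * n)" by (simp flip: power_add)
    also have "\<dots> \<le> exp 1 ^ (36 * n)" using exp_ge_add_one_self[of 1] by (intro power_mono) auto
    also have "\<dots> = exp (36 * real n)" by (simp flip: exp_of_nat_mult)
    finally show "real (card (net n)) * real (card (net n)) \<le> exp (36 * real n)" .
  qed simp
  also have "\<dots> = 4 * exp (- \<sigma>) * card ?P"
  proof -
    have "exp (36 * real n) * exp (- s) = exp (- \<sigma>)" unfolding exp_add[symmetric] by (simp add: s_def)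
    moreover have "exp (36 * real n) * (4 * exp (- s) * card ?P) = 4 * (exp (36 * real n) * exp (- s)) * card ?P"
      by (simp only: mult_ac)
    ultimately show ?thesis by simp
  qed
  finally show ?thesis by (simp add: X_def T_def)
qed

text \<open>The deterministic half of the argument. The three summands bound the light part, the
  heavy edges by \<open>heavy_pairs_bound\<close> with \<open>D = 16\<close>, and the mean over
  heavy pairs; the division by 8 comes from \<open>bilin_le_net\<close>.\<close>

lemma max_eigenvalue_le_of_good:
  assumes M: "M \<in> perfect_matchings ({..<n} \<times> {..<d})" and n: "n \<ge> 2" and d: "d \<ge> 1" and c: "c \<ge> 0"
    and light: "\<And>k l. k \<in> net n \<Longrightarrow> l \<in> net n \<Longrightarrow>
      \<bar>\<Sum>i<n. \<Sum>j<n. light_part d k l i j * (edge_count n d M i j - d / n)\<bar> \<le> K * n * sqrt d"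
    and disc: "\<And>U V. U \<subseteq> {..<n} \<Longrightarrow> V \<subseteq> {..<n} \<Longrightarrow> U \<noteq> {} \<Longrightarrow> card U \<le> card V \<Longrightarrow> \<not> discrepancy_bad c n d M U V"
  defines "A \<equiv> adjacency_matrix n (multigraph_of_matching M)"
  shows "max (nth_eigenvalue A 2) (- nth_eigenvalue A n)
    \<le> (K + (32 + 8 * (2048 * exp 2 + 384 * c + 1024 + 32 * exp 1 * c)) + 256) / 8 * sqrt d"
proof -
  define q where "q = sqrt (real d)"
  have q: "q \<ge> 1" "q\<^sup>2 = d" using d by (auto simp: q_def)
  define H where "H = 32 + 8 * (2048 * exp 2 + 384 * c + 1024 + 32 * exp 1 * c)"
  define B where "B = (\<lambda>i j. edge_count n d M i j - d / n)"
  have A: "A $$ (i, j) = edge_count n d M i j" if "i < n" "j < n" for i j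
    unfolding A_def by (rule adjacency_matrix_edge_count[OF M that])
  have net: "\<bar>bilin n B (\<lambda>i. of_int (k i)) (\<lambda>i. of_int (l i))\<bar> \<le> ((K + H + 256) * q) * n"
    if kl: "k \<in> net n" "l \<in> net n" for k l
  proof -
    define u v where "u = (\<lambda>i. nat \<bar>k i\<bar>)" and "v = (\<lambda>i. nat \<bar>l i\<bar>)"
    have uv: "real (u i * v j) = \<bar>real_of_int (k i * l j)\<bar>" for i j
      by (simp add: u_def v_def abs_mult)
    have "(\<Sum>i<n. \<Sum>j<n. if sqrt d < u i * v j then u i * v j * edge_count n d M i j else 0)
      \<le> (2 * 16 + 8 * (8 * exp 2 * 16\<^sup>2 + 24 * c * 16 + 4 * 16\<^sup>2 + 32 * exp 1 * c)) * sqrt d * n"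
    proof (rule heavy_pairs_bound)
      show "edge_count n d M i j = edge_count n d M j i" for i j by (rule edge_count_sym[OF M])
      show "(\<Sum>j<n. edge_count n d M i j) = real d" if "i < n" for i by (rule edge_count_row_sum[OF M that])
      show "(\<Sum>i<n. (real (u i))\<^sup>2) \<le> 16 * real n" using sum_net_squares[OF kl(1)] by (simp add: u_def)
      show "(\<Sum>i<n. (real (v i))\<^sup>2) \<le> 16 * real n" using sum_net_squares[OF kl(2)] by (simp add: v_def)
      fix S T assume ST: "S \<subseteq> {..<n}" "T \<subseteq> {..<n}" "S \<noteq> {}" "card S \<le> card T"
      show "(\<Sum>i\<in>S. \<Sum>j\<in>T. edge_count n d M i j) \<le> exp 2 * (2 * real d * card S * card T / n) \<or>
      (\<Sum>i\<in>S. \<Sum>j\<in>T. edge_count n d M i j) * ln ((\<Sum>i\<in>S. \<Sum>j\<in>T. edge_count n d M i j) / (2 * real d * card S * card T / n))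
        \<le> c * card T * ln (exp 1 * n / card T)"
        using disc[OF ST] unfolding discrepancy_bad_def edges_between_def by (simp only: not_less de_Morgan_conj)
    qed (use n d c edge_count_nonneg in simp_all)
    then have heavy: "(\<Sum>i<n. \<Sum>j<n. if q < u i * v j then u i * v j * edge_count n d M i j else 0) \<le> H * q * n"
      by (simp add: H_def q_def)
    \<comment> \<open>Heaviness replaces one factor \<open>q\<close> of \<open>d = q\<^sup>2\<close>
      by the product \<open>u i * v j\<close>, so the sum of squared products controls the
      mean.\<close>
    have "(\<Sum>i<n. \<Sum>j<n. if q < u i * v j then u i * v j * (d / n) else 0)
      \<le> (\<Sum>i<n. \<Sum>j<n. (real_of_int (k i * l j))\<^sup>2 * (q / n))"
    proof (intro sum_mono)
      fix i j
      have "real (u i * v j) * q \<le> (real (u i * v j))\<^sup>2" if "q < u i * v j"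
        unfolding power2_eq_square using that by (intro mult_left_mono) auto
      then have "real (u i * v j) * q * (q / n) \<le> (real (u i * v j))\<^sup>2 * (q / n)" if "q < u i * v j"
        using that q(1) by (intro mult_right_mono) auto
      moreover have "0 \<le> (real (u i * v j))\<^sup>2 * (q / n)" using q(1) by simp
      moreover have "real (u i * v j) * q * (q / n) = real (u i * v j) * (d / n)"
        by (simp add: power2_eq_square flip: q(2))
      ultimately show "(if q < u i * v j then u i * v j * (d / n) else 0) \<le> (real_of_int (k i * l j))\<^sup>2 * (q / n)"
        by (simp only: uv power2_abs split: if_split) auto
    qed
    also have "\<dots> = (\<Sum>i<n. \<Sum>j<n. (real_of_int (k i * l j))\<^sup>2) * (q / n)" by (simp only: sum_distrib_right)
    also have "\<dots> \<le> (256 * (real n)\<^sup>2) * (q / n)"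
      using q(1) by (intro mult_right_mono sum_net_product_squares kl) auto
    also have "\<dots> = 256 * q * n" using n by (simp add: power2_eq_square)
    finally have heavy_mean: "(\<Sum>i<n. \<Sum>j<n. if q < u i * v j then u i * v j * (d / n) else 0) \<le> 256 * q * n" .
    define h where "h = (\<lambda>i j. if q < u i * v j then real_of_int (k i * l j) else 0)"
    have "bilin n B (\<lambda>i. of_int (k i)) (\<lambda>i. of_int (l i))
      = (\<Sum>i<n. \<Sum>j<n. light_part d k l i j * B i j + h i j * B i j)"
      unfolding bilin_def
    proof (intro sum.cong refl)
      fix i j
      have "of_int (k i) * B i j * of_int (l j) = of_int (k i * l j) * B i j" by simp
      also have "\<dots> = light_part d k l i j * B i j + h i j * B i j"
        unfolding light_part_def h_def uv q_def by (auto simp del: of_int_mult)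
      finally show "of_int (k i) * B i j * of_int (l j) = light_part d k l i j * B i j + h i j * B i j" .
    qed
    also have "\<dots> = (\<Sum>i<n. \<Sum>j<n. light_part d k l i j * B i j) + (\<Sum>i<n. \<Sum>j<n. h i j * B i j)"
      by (simp add: sum.distrib)
    finally have split: "\<bar>bilin n B (\<lambda>i. of_int (k i)) (\<lambda>i. of_int (l i))\<bar>
      \<le> \<bar>\<Sum>i<n. \<Sum>j<n. light_part d k l i j * B i j\<bar> + \<bar>\<Sum>i<n. \<Sum>j<n. h i j * B i j\<bar>"
      by (simp only: abs_triangle_ineq)
    have "\<bar>\<Sum>i<n. \<Sum>j<n. h i j * B i j\<bar> \<le> (\<Sum>i<n. \<Sum>j<n. \<bar>h i j * B i j\<bar>)"
      by (rule order_trans[OF sum_abs]) (intro sum_mono sum_abs)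
    also have "\<dots> \<le> (\<Sum>i<n. \<Sum>j<n. (if q < u i * v j then u i * v j * edge_count n d M i j else 0)
        + (if q < u i * v j then u i * v j * (d / n) else 0))"
    proof (intro sum_mono)
      fix i j
      have "\<bar>B i j\<bar> \<le> edge_count n d M i j + d / n"
        using edge_count_nonneg[of n d M i j] by (simp add: B_def abs_le_iff)
      then have "real (u i * v j) * \<bar>B i j\<bar> \<le> real (u i * v j) * (edge_count n d M i j + d / n)"
        by (rule mult_left_mono) simp
      then show "\<bar>h i j * B i j\<bar> \<le> (if q < u i * v j then u i * v j * edge_count n d M i j else 0)
        + (if q < u i * v j then u i * v j * (d / n) else 0)"
        unfolding h_def abs_mult distrib_left by (simp only: uv split: if_split) auto
    qed
    also have "\<dots> \<le> H * q * n + 256 * q * n"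
      unfolding sum.distrib by (intro add_mono heavy heavy_mean)
    finally have hB: "\<bar>\<Sum>i<n. \<Sum>j<n. h i j * B i j\<bar> \<le> H * q * n + 256 * q * n" .
    have "\<bar>\<Sum>i<n. \<Sum>j<n. light_part d k l i j * B i j\<bar> \<le> K * n * q"
      unfolding B_def q_def by (rule light[OF kl])
    with split hB have "\<bar>bilin n B (\<lambda>i. of_int (k i)) (\<lambda>i. of_int (l i))\<bar>
      \<le> K * n * q + (H * q * n + 256 * q * n)" by linarith
    then show ?thesis by (simp add: algebra_simps)
  qed
  have "max (nth_eigenvalue A 2) (- nth_eigenvalue A n) \<le> ((K + H + 256) * q) / 8"
  proof (rule nth_eigenvalue_le[of A n "real d"])
    show "A \<in> carrier_mat n n" by (simp add: A_def adjacency_matrix_def)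
    show "A $$ (i, j) = A $$ (j, i)" if "i < n" "j < n" for i j
      using edge_count_sym[OF M] by (simp add: A that)
    show "(\<Sum>j<n. A $$ (i, j)) = d" if "i < n" for i
      using edge_count_row_sum[OF M that] by (simp add: A that)
    fix x y :: "nat \<Rightarrow> real" assume xy: "(\<Sum>i<n. (x i)\<^sup>2) \<le> 1" "(\<Sum>i<n. (y i)\<^sup>2) \<le> 1"
    have eq: "(\<Sum>i<n. \<Sum>j<n. x i * (A $$ (i, j) - d / n) * y j) = bilin n B x y"
      unfolding bilin_def B_def by (intro sum.cong refl) (simp add: A)
    show "\<bar>\<Sum>i<n. \<Sum>j<n. x i * (A $$ (i, j) - d / n) * y j\<bar> \<le> ((K + H + 256) * q) / 8"
      unfolding eq by (rule bilin_le_net[OF _ net xy]) (use n in simp)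
  qed (use n in simp_all)
  then show ?thesis unfolding H_def q_def times_divide_eq_left .
qed

theorem theorem1p10:
  shows "\<forall>\<epsilon>::real. \<epsilon> > 0 \<longrightarrow> (\<exists>C::real. \<forall>n d::nat. n \<ge> 2 \<longrightarrow> d \<ge> 2 \<longrightarrow> even (n * d) \<longrightarrow>
    measure_pmf.prob (configuration_model n d)
      {G. max (nth_eigenvalue (adjacency_matrix n G) 2) (- nth_eigenvalue (adjacency_matrix n G) n)
            \<le> C * sqrt (real d - 1)} \<ge> 1 - \<epsilon>)"
proof (intro allI impI)
  fix \<epsilon> :: real assume \<epsilon>: "\<epsilon> > 0"
  \<comment> \<open>Chosen so that each of the two bad events has probability at most
    \<open>\<epsilon> / 2\<close>; the maxima ensure \<open>\<sigma> \<ge> 0\<close> and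
    \<open>\<kappa> \<ge> 1\<close>.\<close>
  define \<sigma> where "\<sigma> = max 0 (ln (8 / \<epsilon>))"
  define \<kappa> where "\<kappa> = max 1 (ln (2 / \<epsilon>))"
  have exps: "4 * exp (- \<sigma>) \<le> \<epsilon> / 2" "exp (- \<kappa>) \<le> \<epsilon> / 2"
  proof -
    have "exp (- \<sigma>) \<le> exp (- ln (8 / \<epsilon>))" by (simp add: \<sigma>_def)
    then show "4 * exp (- \<sigma>) \<le> \<epsilon> / 2" using \<epsilon> by (simp add: exp_minus)
    have "exp (- \<kappa>) \<le> exp (- ln (2 / \<epsilon>))" by (simp add: \<kappa>_def)
    then show "exp (- \<kappa>) \<le> \<epsilon> / 2" using \<epsilon> by (simp add: exp_minus)
  qed
  define c where "c = 8 * (\<kappa> + 2)"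
  define K where "K = 1922 + 32 * \<sigma>"
  define C where "C = (K + (32 + 8 * (2048 * exp 2 + 384 * c + 1024 + 32 * exp 1 * c)) + 256) / 8"
  have c: "c \<ge> 0" by (simp add: c_def \<kappa>_def)
  have C: "C \<ge> 0" using c by (simp add: C_def K_def \<sigma>_def)
  show "\<exists>C::real. \<forall>n d::nat. n \<ge> 2 \<longrightarrow> d \<ge> 2 \<longrightarrow> even (n * d) \<longrightarrow>
    measure_pmf.prob (configuration_model n d)
      {G. max (nth_eigenvalue (adjacency_matrix n G) 2) (- nth_eigenvalue (adjacency_matrix n G) n)
            \<le> C * sqrt (real d - 1)} \<ge> 1 - \<epsilon>"
  \<comment> \<open>The 2 passes from \<open>sqrt d\<close> to \<open>sqrt (d - 1)\<close>, since
    \<open>d \<le> 4 * (d - 1)\<close> for \<open>d \<ge> 2\<close>.\<close>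
  proof (intro exI[of _ "2 * C"] allI impI)
    fix n d :: nat assume n: "n \<ge> 2" and d: "d \<ge> 2" and even: "even (n * d)"
    let ?S = "{..<n} \<times> {..<d}"
    let ?P = "perfect_matchings ?S"
    let ?G = "{G. max (nth_eigenvalue (adjacency_matrix n G) 2) (- nth_eigenvalue (adjacency_matrix n G) n)
            \<le> 2 * C * sqrt (real d - 1)}"
    have d1: "d \<ge> 1" using d by simp
    have fin: "finite ?P" by (intro finite_perfect_matchings) auto
    have ne: "?P \<noteq> {}" using even by (intro perfect_matchings_nonempty) (auto simp: card_slot)
    define B1 where "B1 = {M \<in> ?P. \<exists>k\<in>net n. \<exists>l\<in>net n.
      \<bar>\<Sum>i<n. \<Sum>j<n. light_part d k l i j * (edge_count n d M i j - d / n)\<bar> \<ge> K * n * sqrt d}"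
    define B2 where "B2 = {M \<in> ?P. \<exists>U V. U \<subseteq> {..<n} \<and> V \<subseteq> {..<n} \<and> U \<noteq> {} \<and>
      card U \<le> card V \<and> discrepancy_bad c n d M U V}"
    have "real (card B1) \<le> 4 * exp (- \<sigma>) * card ?P"
      unfolding B1_def K_def by (rule light_part_tail[OF n d1]) (simp add: \<sigma>_def)
    also have "\<dots> \<le> \<epsilon> / 2 * card ?P" by (intro mult_right_mono exps) simp
    finally have B1: "real (card B1) \<le> \<epsilon> / 2 * card ?P" .
    have "real (card B2) \<le> exp (- \<kappa>) * card ?P"
      unfolding B2_def c_def by (rule discrepancy_tail[OF n d1]) (simp add: \<kappa>_def)
    also have "\<dots> \<le> \<epsilon> / 2 * card ?P" by (intro mult_right_mono exps) simp
    finally have B2: "real (card B2) \<le> \<epsilon> / 2 * card ?P" .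
    have "sqrt d \<le> 2 * sqrt (real d - 1)"
    proof -
      have "sqrt d \<le> sqrt (4 * (real d - 1))" using d by (intro real_sqrt_le_mono) simp
      then show ?thesis by (simp only: real_sqrt_mult real_sqrt_four)
    qed
    then have Cd: "C * sqrt d \<le> 2 * C * sqrt (real d - 1)"
      using mult_left_mono[of "sqrt d" "2 * sqrt (real d - 1)" C] C by (simp add: mult_ac)
    have good: "multigraph_of_matching M \<in> ?G" if M: "M \<in> ?P - (B1 \<union> B2)" for M
    proof -
      have "max (nth_eigenvalue (adjacency_matrix n (multigraph_of_matching M)) 2)
          (- nth_eigenvalue (adjacency_matrix n (multigraph_of_matching M)) n) \<le> C * sqrt d"
        unfolding C_def
      proof (rule max_eigenvalue_le_of_good[OF _ n d1 c])
        show P: "M \<in> ?P" using M by simp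
        show "\<not> discrepancy_bad c n d M U V"
          if "U \<subseteq> {..<n}" "V \<subseteq> {..<n}" "U \<noteq> {}" "card U \<le> card V" for U V
          using M P that unfolding B2_def by blast
        show "\<bar>\<Sum>i<n. \<Sum>j<n. light_part d k l i j * (edge_count n d M i j - d / n)\<bar> \<le> K * n * sqrt d"
          if "k \<in> net n" "l \<in> net n" for k l
        proof (rule ccontr)
          assume "\<not> ?thesis"
          then have "K * n * sqrt d \<le> \<bar>\<Sum>i<n. \<Sum>j<n. light_part d k l i j * (edge_count n d M i j - d / n)\<bar>"
            by (simp only: not_le less_imp_le)
          with that P have "M \<in> B1" unfolding B1_def by blast
          then show False using M by simp
        qed
      qed
      then show ?thesis unfolding mem_Collect_eq using Cd by (rule order_trans)
    qed
    have "?P \<subseteq> (?P \<inter> multigraph_of_matching -` ?G) \<union> (B1 \<union> B2)" using good by blast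
    then have "card ?P \<le> card ((?P \<inter> multigraph_of_matching -` ?G) \<union> (B1 \<union> B2))"
      using fin by (intro card_mono) (auto simp: B1_def B2_def)
    also have "\<dots> \<le> card (?P \<inter> multigraph_of_matching -` ?G) + (card B1 + card B2)"
      by (intro order_trans[OF card_Un_le] add_left_mono card_Un_le)
    finally have "real (card ?P) \<le> real (card (?P \<inter> multigraph_of_matching -` ?G)) + (real (card B1) + real (card B2))"
      by (simp flip: of_nat_add)
    with B1 B2 have "real (card ?P) - \<epsilon> * card ?P \<le> real (card (?P \<inter> multigraph_of_matching -` ?G))" by simp
    then have "(1 - \<epsilon>) * card ?P \<le> real (card (?P \<inter> multigraph_of_matching -` ?G))" by (simp add: algebra_simps)
    moreover have "card ?P > 0" using fin ne by (simp add: card_gt_0_iff)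
    ultimately have "1 - \<epsilon> \<le> card (?P \<inter> multigraph_of_matching -` ?G) / card ?P" by (simp add: pos_le_divide_eq)
    also have "\<dots> = measure_pmf.prob (configuration_model n d) ?G"
      using fin ne by (simp add: configuration_model_def measure_pmf_of_set)
    finally show "measure_pmf.prob (configuration_model n d) ?G \<ge> 1 - \<epsilon>" .
  qed
qed

end
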